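(* Let $\Omega\subset\mathbb{R}^n$ be open and $1\le p\le\infty$. If $F\in\mathcal{DM}^p(\Omega)$ and $\phi\in C^0(\Omega)\cap L^\infty(\Omega)$ with $\nabla\phi\in L^{p'}(\Omega;\mathbb{R}^n)$ for $p'=\frac{p}{p-1}$, then $\phi F\in\mathcal{DM}^p(\Omega)$ and $$\mathrm{div}(\phi F)=\phi\,\mathrm{div}F+F\cdot\nabla\phi .$$
   Context: $\mathcal{DM}^p(\Omega)$ is the space of vector fields $F\in L^p(\Omega;\mathbb{R}^n)$ whose distributional divergence $\mathrm{div}F$ is a real finite Radon measure on $\Omega$. $p'$ is the conjugate exponent ($p'=\infty$ if $p=1$, $p'=1$ if $p=\infty$). $F\cdot\nabla\phi$ denotes the measure $(F\cdot\nabla\phi)\,\mathcal{L}^n$, and the identity is between Radon measures on $\Omega$. *)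

theory Defs
  imports "HOL-Analysis.Analysis"
begin

section \<open>Lebesgue spaces\<close>

text \<open>
  Elements of Lebesgue and Sobolev-type spaces are given by representatives, i.e. by total
  functions whose values outside \<open>\<Omega>\<close> are irrelevant.  Exponents range over \<open>[0, \<infinity>]\<close> as
  extended nonnegative reals; they are used for \<open>1 \<le> p \<le> \<infinity>\<close>.
\<close>

definition Lp :: "ennreal \<Rightarrow> 'a::euclidean_space set \<Rightarrow> ('a \<Rightarrow> 'b::euclidean_space) set" where
  "Lp p \<Omega> = {f \<in> borel_measurable (lebesgue_on \<Omega>).
     if p = \<infinity> then \<exists>C::real. AE x in lebesgue_on \<Omega>. norm (f x) \<le> C
     else integrable (lebesgue_on \<Omega>) (\<lambda>x. norm (f x) powr enn2real p)}"

definition conj_exponent :: "ennreal \<Rightarrow> ennreal" where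
  "conj_exponent p = (if p = 1 then \<infinity> else if p = \<infinity> then 1 else p / (p - 1))"

definition locally_integrable :: "'a::euclidean_space set \<Rightarrow> ('a \<Rightarrow> 'b::euclidean_space) \<Rightarrow> bool" where
  "locally_integrable \<Omega> f \<longleftrightarrow> (\<forall>K. compact K \<and> K \<subseteq> \<Omega> \<longrightarrow> set_integrable lebesgue K f)"


section \<open>Test functions and weak gradients\<close>

primrec Ck :: "nat \<Rightarrow> ('a::euclidean_space \<Rightarrow> real) \<Rightarrow> bool" where
  "Ck 0 f \<longleftrightarrow> continuous_on UNIV f"
| "Ck (Suc k) f \<longleftrightarrow> (\<forall>x. f differentiable at x) \<and>
     (\<forall>b\<in>Basis. Ck k (\<lambda>x. frechet_derivative f (at x) b))"

text \<open>The space \<open>C\<^sub>c\<^sup>\<infinity>(\<Omega>)\<close>, its elements being extended by zero to the whole space.\<close>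

definition test_functions :: "'a::euclidean_space set \<Rightarrow> ('a \<Rightarrow> real) set" where
  "test_functions \<Omega> = {\<psi>. (\<forall>k. Ck k \<psi>) \<and>
     compact (closure {x. \<psi> x \<noteq> 0}) \<and> closure {x. \<psi> x \<noteq> 0} \<subseteq> \<Omega>}"

definition grad :: "('a::euclidean_space \<Rightarrow> real) \<Rightarrow> 'a \<Rightarrow> 'a" where
  "grad f x = (\<Sum>b\<in>Basis. frechet_derivative f (at x) b *\<^sub>R b)"

definition has_weak_gradient ::
  "'a::euclidean_space set \<Rightarrow> ('a \<Rightarrow> real) \<Rightarrow> ('a \<Rightarrow> 'a) \<Rightarrow> bool" where
  "has_weak_gradient \<Omega> \<phi> G \<longleftrightarrow> locally_integrable \<Omega> \<phi> \<and> locally_integrable \<Omega> G \<and>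
     (\<forall>\<psi>\<in>test_functions \<Omega>. \<forall>b\<in>Basis.
        (LINT x|lebesgue_on \<Omega>. \<phi> x * (grad \<psi> x \<bullet> b)) = - (LINT x|lebesgue_on \<Omega>. (G x \<bullet> b) * \<psi> x))"


section \<open>Finite real measures\<close>

text \<open>
  A finite real measure on \<open>\<Omega>\<close> is a real-valued, countably additive function on the Borel subsets
  of \<open>\<Omega>\<close>.  For open \<open>\<Omega>\<close> in a Euclidean space its variation is automatically a finite Radon
  measure.  As for emeasure, the value on non-measurable sets is fixed to be \<open>0\<close>, so that two
  measures are equal as soon as they agree on the Borel subsets of \<open>\<Omega>\<close>.
\<close>

definition borel_subsets :: "'a::topological_space set \<Rightarrow> 'a set set" where
  "borel_subsets \<Omega> = {B \<in> sets borel. B \<subseteq> \<Omega>}"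

definition real_radon_measure :: "'a::euclidean_space set \<Rightarrow> ('a set \<Rightarrow> real) \<Rightarrow> bool" where
  "real_radon_measure \<Omega> \<nu> \<longleftrightarrow>
     (\<forall>B. B \<notin> borel_subsets \<Omega> \<longrightarrow> \<nu> B = 0) \<and>
     \<nu> {} = 0 \<and>
     (\<forall>A::nat \<Rightarrow> 'a set. range A \<subseteq> borel_subsets \<Omega> \<longrightarrow> disjoint_family A \<longrightarrow>
        (\<lambda>i. \<nu> (A i)) sums \<nu> (\<Union>i. A i))"

text \<open>
  The positive part \<open>\<nu>\<^sup>+\<close> of the Jordan decomposition; the negative part is \<open>(-\<nu>)\<^sup>+\<close>.  Since
  \<open>\<nu> {} = 0\<close>, the truncation of negative values by ennreal does not affect the supremum.
\<close>

definition pos_variation :: "'a::euclidean_space set \<Rightarrow> ('a set \<Rightarrow> real) \<Rightarrow> 'a measure" where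
  "pos_variation \<Omega> \<nu> =
     measure_of \<Omega> (borel_subsets \<Omega>) (\<lambda>B. SUP A\<in>{A \<in> borel_subsets \<Omega>. A \<subseteq> B}. ennreal (\<nu> A))"

definition real_measure_integral ::
  "'a::euclidean_space set \<Rightarrow> ('a set \<Rightarrow> real) \<Rightarrow> ('a \<Rightarrow> real) \<Rightarrow> real" where
  "real_measure_integral \<Omega> \<nu> f =
     (LINT x|pos_variation \<Omega> \<nu>. f x) - (LINT x|pos_variation \<Omega> (\<lambda>B. - \<nu> B). f x)"


section \<open>Divergence-measure fields\<close>

definition has_divergence_measure ::
  "'a::euclidean_space set \<Rightarrow> ('a \<Rightarrow> 'a) \<Rightarrow> ('a set \<Rightarrow> real) \<Rightarrow> bool" where
  "has_divergence_measure \<Omega> F \<nu> \<longleftrightarrow> locally_integrable \<Omega> F \<and> real_radon_measure \<Omega> \<nu> \<and>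
     (\<forall>\<psi>\<in>test_functions \<Omega>.
        (LINT x|lebesgue_on \<Omega>. F x \<bullet> grad \<psi> x) = - real_measure_integral \<Omega> \<nu> \<psi>)"

definition DM :: "ennreal \<Rightarrow> 'a::euclidean_space set \<Rightarrow> ('a \<Rightarrow> 'a) set" where
  "DM p \<Omega> = {F \<in> Lp p \<Omega>. \<exists>\<nu>. has_divergence_measure \<Omega> F \<nu>}"

text \<open>For open \<open>\<Omega>\<close>, a real Radon measure is determined by its integrals of test functions.\<close>

definition divergence :: "'a::euclidean_space set \<Rightarrow> ('a \<Rightarrow> 'a) \<Rightarrow> 'a set \<Rightarrow> real" where
  "divergence \<Omega> F = (THE \<nu>. has_divergence_measure \<Omega> F \<nu>)"

end

theory Submission
  imports Defs
begin

text \<open>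
  Test the equation \<open>div F = \<nu>\<close> with \<open>\<psi> \<phi>\<^sub>n\<close>, where \<open>\<phi>\<^sub>n\<close> is a mollification of \<open>\<phi>\<close>, and let
  \<open>n \<rightarrow> \<infinity>\<close>.  The terms with \<open>\<phi>\<^sub>n\<close> converge by dominated convergence, because \<open>\<phi>\<close> is continuous and
  bounded.  The remaining term is, by Fubini, the average of the correlation
  \<open>h \<mapsto> \<integral> \<psi>(x) F(x) \<bullet> G(x - h) dx\<close> against the mollifier, so it suffices that this
  function is continuous at \<open>0\<close>.  All exponents are treated at once by replacing the pair of
  \<open>L\<^sup>p\<close>-conditions with a bound \<open>\<bar>F x\<bar> \<bar>G y\<bar> \<le> A x + B y\<close> with integrable \<open>A\<close> and \<open>B\<close>, given by
  Young's inequality; then only continuity of translations in \<open>L\<^sup>1\<close> is needed.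
  The limit identity says that \<open>\<phi> \<nu> + F \<bullet> G\<close> is a divergence measure of \<open>\<phi> F\<close>, and such
  a measure is unique since indicators of open sets are pointwise limits of test functions.
\<close>

section \<open>Finite real measures\<close>

text \<open>The endpoint that rules out a direct use of Lebesgue norms is p = 1: there G is merely
  bounded, and translations need not be continuous in L^\<infinity>. Near the compact support of a
  test function G is integrable for every p, which is what makes an L^1 argument possible. A second
  obstacle is that \<phi> is continuous only on \<Omega> and cannot be convolved globally. All
  convolutions take place in a compact neighbourhood of the support, off which \<phi> is replaced by
  a continuous extension with the same bound. The shifted kernel is then itself a test function on
  \<Omega>, and this is how the weak gradient turns into the gradient of the mollification. On the
  measure side, integrals against \<nu> are defined through positive variations, which do not depend
  linearly on \<nu>. The variations of \<phi> \<nu> + F \<bullet> G are therefore never computed;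
  instead a linear identity between set functions is extended to bounded integrands. Fubini requires
  Borel functions while the fields are only Lebesgue measurable, hence the passage to Borel
  versions.\<close>

lemma sets_restrict_borel:
  "\<Omega> \<in> sets borel \<Longrightarrow> sets (restrict_space borel \<Omega>) = borel_subsets \<Omega>"
  by (auto simp: borel_subsets_def sets_restrict_space_iff)

lemma sigma_algebra_borel_subsets:
  "\<Omega> \<in> sets borel \<Longrightarrow> sigma_algebra \<Omega> (borel_subsets \<Omega>)"
  using sets.sigma_algebra_axioms[of "restrict_space borel \<Omega>"]
  by (simp add: sets_restrict_borel space_restrict_space)

section \<open>Additivity of finite real measures\<close>

lemma real_radon_measure_sums:
  assumes "real_radon_measure \<Omega> \<nu>" "range A \<subseteq> borel_subsets \<Omega>" "disjoint_family A"
  shows "(\<lambda>i. \<nu> (A i)) sums \<nu> (\<Union>i. A i)"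
  using assms by (auto simp: real_radon_measure_def)

lemma real_radon_measure_empty: "real_radon_measure \<Omega> \<nu> \<Longrightarrow> \<nu> {} = 0"
  by (auto simp: real_radon_measure_def)

lemma real_radon_measure_uminus:
  "real_radon_measure \<Omega> \<nu> \<Longrightarrow> real_radon_measure \<Omega> (\<lambda>B. - \<nu> B)"
  by (auto simp: real_radon_measure_def intro: sums_minus)

lemma real_radon_measure_Un:
  assumes "real_radon_measure \<Omega> \<nu>" "A \<in> borel_subsets \<Omega>" "B \<in> borel_subsets \<Omega>" "A \<inter> B = {}"
  shows "\<nu> (A \<union> B) = \<nu> A + \<nu> B"
proof -
  have "range (binaryset A B) \<subseteq> borel_subsets \<Omega>"
    using assms by (auto simp: range_binaryset_eq borel_subsets_def)
  moreover have "disjoint_family (binaryset A B)"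
    using assms by (auto simp: disjoint_family_on_def binaryset_def)
  ultimately have "(\<lambda>i. \<nu> (binaryset A B i)) sums \<nu> (A \<union> B)"
    using real_radon_measure_sums[OF assms(1)] by (metis UN_binaryset_eq)
  moreover have "(\<lambda>i. \<nu> (binaryset A B i)) sums (\<nu> A + \<nu> B)"
    using assms(1) by (intro binaryset_sums) (rule real_radon_measure_empty)
  ultimately show ?thesis by (rule sums_unique2)
qed

lemma real_radon_measure_Diff:
  assumes "real_radon_measure \<Omega> \<nu>" "A \<in> borel_subsets \<Omega>" "B \<in> borel_subsets \<Omega>" "A \<subseteq> B"
  shows "\<nu> (B - A) = \<nu> B - \<nu> A"
proof -
  have "B - A \<in> borel_subsets \<Omega>" using assms by (auto simp: borel_subsets_def)
  then have "\<nu> (A \<union> (B - A)) = \<nu> A + \<nu> (B - A)"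
    using assms by (intro real_radon_measure_Un) auto
  moreover have "A \<union> (B - A) = B" using assms by auto
  ultimately show ?thesis by simp
qed

lemma real_radon_measure_UN_lessThan:
  fixes A :: "nat \<Rightarrow> 'a::euclidean_space set"
  assumes "real_radon_measure \<Omega> \<nu>" "\<And>i. A i \<in> borel_subsets \<Omega>" "disjoint_family A"
  shows "\<nu> (\<Union>i<n. A i) = (\<Sum>i<n. \<nu> (A i))"
proof (induction n)
  case 0 then show ?case using real_radon_measure_empty[OF assms(1)] by simp
next
  case (Suc n)
  have "(\<Union>i<n. A i) \<in> borel_subsets \<Omega>"
    using assms(2) by (fastforce simp: borel_subsets_def)
  moreover have "A n \<inter> (\<Union>i<n. A i) = {}"
  proof -
    have "A n \<inter> A i = {}" if "i < n" for i
      using that by (intro disjoint_family_onD[OF assms(3)]) auto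
    then show ?thesis by blast
  qed
  ultimately have "\<nu> (A n \<union> (\<Union>i<n. A i)) = \<nu> (A n) + \<nu> (\<Union>i<n. A i)"
    using assms by (intro real_radon_measure_Un) auto
  then show ?case by (simp add: lessThan_Suc Suc.IH)
qed

text \<open>The set function from which \<open>pos_variation\<close> is built. It is kept apart
  because \<open>measure_of\<close> has this function as its \<open>emeasure\<close> only once
  countable additivity is known.\<close>

definition upper_variation :: "'a::euclidean_space set \<Rightarrow> ('a set \<Rightarrow> real) \<Rightarrow> 'a set \<Rightarrow> ennreal" where
  "upper_variation \<Omega> \<nu> B = (SUP A\<in>{A \<in> borel_subsets \<Omega>. A \<subseteq> B}. ennreal (\<nu> A))"

lemma upper_variation_upper:
  "A \<in> borel_subsets \<Omega> \<Longrightarrow> A \<subseteq> B \<Longrightarrow> ennreal (\<nu> A) \<le> upper_variation \<Omega> \<nu> B"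
  unfolding upper_variation_def by (rule SUP_upper) auto

text \<open>For \<open>\<le>\<close>, a competitor \<open>A\<close> in the union is cut into the
  pieces \<open>A \<inter> B i\<close>. For \<open>\<ge>\<close>, finite partial sums suffice:
  nearly optimal competitors in finitely many disjoint \<open>B i\<close> unite to a competitor in
  the union.\<close>

lemma countably_additive_upper_variation:
  assumes "real_radon_measure \<Omega> \<nu>"
  shows "countably_additive (borel_subsets \<Omega>) (upper_variation \<Omega> \<nu>)"
  unfolding countably_additive_def
proof (intro allI impI antisym)
  fix B :: "nat \<Rightarrow> 'a set"
  assume B: "range B \<subseteq> borel_subsets \<Omega>" "disjoint_family B" "\<Union>(range B) \<in> borel_subsets \<Omega>"
  have Bi: "B i \<in> borel_subsets \<Omega>" for i using B(1) by auto
  show "upper_variation \<Omega> \<nu> (\<Union>(range B)) \<le> (\<Sum>i. upper_variation \<Omega> \<nu> (B i))"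
    unfolding upper_variation_def[of _ _ "\<Union>(range B)"]
  proof (rule SUP_least)
    fix A assume "A \<in> {A \<in> borel_subsets \<Omega>. A \<subseteq> \<Union>(range B)}"
    then have A: "A \<in> borel_subsets \<Omega>" "A \<subseteq> \<Union>(range B)" by auto
    have AB: "A \<inter> B i \<in> borel_subsets \<Omega>" for i
      using A(1) Bi[of i] by (auto simp: borel_subsets_def)
    have "(\<lambda>i. \<nu> (A \<inter> B i)) sums \<nu> (\<Union>i. A \<inter> B i)"
      using AB B(2) by (intro real_radon_measure_sums[OF assms])
        (auto simp: disjoint_family_on_def)
    also have "(\<Union>i. A \<inter> B i) = A" using A(2) by auto
    finally have "(\<lambda>n. ennreal (\<Sum>i<n. \<nu> (A \<inter> B i))) \<longlonglongrightarrow> ennreal (\<nu> A)"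
      by (intro tendsto_ennrealI) (simp add: sums_def)
    moreover have "ennreal (\<Sum>i<n. \<nu> (A \<inter> B i)) \<le> (\<Sum>i. upper_variation \<Omega> \<nu> (B i))" for n
    proof -
      \<comment> \<open>\<open>ennreal\<close> truncates negative values, so it commutes with the
        sum only after negative pieces are replaced by 0.\<close>
      have "ennreal (\<Sum>i<n. \<nu> (A \<inter> B i)) \<le> ennreal (\<Sum>i<n. max 0 (\<nu> (A \<inter> B i)))"
        by (intro ennreal_leI sum_mono) auto
      also have "\<dots> = (\<Sum>i<n. ennreal (max 0 (\<nu> (A \<inter> B i))))"
        by (rule sum_ennreal[symmetric]) auto
      also have "\<dots> \<le> (\<Sum>i<n. upper_variation \<Omega> \<nu> (B i))"
        using upper_variation_upper[OF AB, where \<nu>=\<nu> and B="B _"]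
        by (intro sum_mono) (auto simp: max_def)
      also have "\<dots> \<le> (\<Sum>i. upper_variation \<Omega> \<nu> (B i))"
        by (rule sum_le_suminf) auto
      finally show ?thesis .
    qed
    ultimately show "ennreal (\<nu> A) \<le> (\<Sum>i. upper_variation \<Omega> \<nu> (B i))"
      by (intro LIMSEQ_le_const2) auto
  qed
  show "(\<Sum>i. upper_variation \<Omega> \<nu> (B i)) \<le> upper_variation \<Omega> \<nu> (\<Union>(range B))"
  proof (rule suminf_le_const, goal_cases)
    case (2 n)
    show ?case
    proof (rule ccontr)
      assume "\<not> ?thesis"
      then have *: "upper_variation \<Omega> \<nu> (\<Union>(range B)) < (\<Sum>i<n. upper_variation \<Omega> \<nu> (B i))" by simp
      have fin: "upper_variation \<Omega> \<nu> (\<Union>(range B)) < top"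
        using * by (metis order_less_le_trans top_greatest)
      have fini: "upper_variation \<Omega> \<nu> (B i) < top" for i
      proof -
        have "upper_variation \<Omega> \<nu> (B i) \<le> upper_variation \<Omega> \<nu> (\<Union>(range B))"
          unfolding upper_variation_def by (rule SUP_subset_mono) auto
        then show ?thesis using fin by (rule order_le_less_trans)
      qed
      define v where "v i = enn2real (upper_variation \<Omega> \<nu> (B i))" for i
      define V where "V = enn2real (upper_variation \<Omega> \<nu> (\<Union>(range B)))"
      have v: "upper_variation \<Omega> \<nu> (B i) = ennreal (v i)" for i using fini[of i] by (simp add: v_def)
      have V: "upper_variation \<Omega> \<nu> (\<Union>(range B)) = ennreal V" using fin by (simp add: V_def)
      have v0: "v i \<ge> 0" for i by (simp add: v_def)
      have V0: "V \<ge> 0" by (simp add: V_def)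
      have lt: "V < (\<Sum>i<n. v i)"
        using * v0 V0 unfolding v V by (simp add: sum_ennreal ennreal_less_iff)
      \<comment> \<open>The gap is divided by n + 1, so that losing \<open>e\<close> on each of the
        n sets still leaves a surplus of \<open>e\<close>.\<close>
      define e where "e = ((\<Sum>i<n. v i) - V) / (real n + 1)"
      have e: "e > 0" using lt by (simp add: e_def)
      \<comment> \<open>The case \<open>v i = 0\<close> takes the empty competitor: there the
        truncated value \<open>ennreal (v i - e)\<close> is 0 and hence not strictly below the
        supremum.\<close>
      have "\<exists>A. A \<in> borel_subsets \<Omega> \<and> A \<subseteq> B i \<and> \<nu> A \<ge> v i - e" for i
      proof (cases "v i = 0")
        case True
        have "{} \<in> borel_subsets \<Omega>" by (auto simp: borel_subsets_def)
        then show ?thesis using True e real_radon_measure_empty[OF assms] by (intro exI[of _ "{}"]) auto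
      next
        case False
        then have "v i > 0" using v0[of i] by simp
        then have "ennreal (v i - e) < upper_variation \<Omega> \<nu> (B i)"
          using e unfolding v by (simp add: ennreal_lessI)
        then obtain A where "A \<in> borel_subsets \<Omega>" "A \<subseteq> B i" "ennreal (v i - e) < ennreal (\<nu> A)"
          unfolding upper_variation_def by (auto simp: less_SUP_iff)
        then show ?thesis
          using ennreal_leI[of "\<nu> A" "v i - e"] by (intro exI[of _ A]) (auto simp: not_le[symmetric] intro: less_imp_le)
      qed
      then obtain A where A: "\<And>i. A i \<in> borel_subsets \<Omega>" "\<And>i. A i \<subseteq> B i" "\<And>i. \<nu> (A i) \<ge> v i - e"
        by metis
      have dA: "disjoint_family A"
        using B(2) A(2) unfolding disjoint_family_on_def by blast
      have "(\<Union>i<n. A i) \<in> borel_subsets \<Omega>" using A(1) by (fastforce simp: borel_subsets_def)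
      moreover have "(\<Union>i<n. A i) \<subseteq> \<Union>(range B)" using A(2) by blast
      ultimately have "ennreal (\<nu> (\<Union>i<n. A i)) \<le> ennreal V"
        unfolding V[symmetric] by (rule upper_variation_upper)
      then have "\<nu> (\<Union>i<n. A i) \<le> V" using V0 by (simp add: ennreal_le_iff)
      moreover have "(\<Sum>i<n. v i - e) \<le> \<nu> (\<Union>i<n. A i)"
        unfolding real_radon_measure_UN_lessThan[OF assms A(1) dA] by (intro sum_mono A(3))
      ultimately have "(\<Sum>i<n. v i) - real n * e \<le> V" by (simp add: sum_subtractf)
      moreover have "(\<Sum>i<n. v i) - V = real n * e + e"
      proof -
        have "(real n + 1) * e = (\<Sum>i<n. v i) - V" by (simp add: e_def)
        then show ?thesis by (simp add: distrib_right)
      qed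
      ultimately show False using e by simp
    qed
  qed auto
qed

lemma upper_variation_split:
  assumes "real_radon_measure \<Omega> \<nu>" "\<Omega> \<in> sets borel" "A \<in> borel_subsets \<Omega>" "B \<in> borel_subsets \<Omega>" "A \<subseteq> B"
  shows "upper_variation \<Omega> \<nu> B = upper_variation \<Omega> \<nu> A + upper_variation \<Omega> \<nu> (B - A)"
proof -
  interpret sigma_algebra \<Omega> "borel_subsets \<Omega>" using assms by (intro sigma_algebra_borel_subsets)
  have "positive (borel_subsets \<Omega>) (upper_variation \<Omega> \<nu>)"
    using real_radon_measure_empty[OF assms(1)]
    by (auto simp: positive_def upper_variation_def borel_subsets_def bot_ennreal[symmetric] intro!: antisym SUP_least)
  then have "additive (borel_subsets \<Omega>) (upper_variation \<Omega> \<nu>)"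
    using countably_additive_upper_variation[OF assms(1)]
    by (intro countably_additive_additive)
  moreover have "B - A \<in> borel_subsets \<Omega>" using assms by (auto simp: borel_subsets_def)
  ultimately have "upper_variation \<Omega> \<nu> (A \<union> (B - A)) = upper_variation \<Omega> \<nu> A + upper_variation \<Omega> \<nu> (B - A)"
    using assms by (intro additiveD) auto
  moreover have "A \<union> (B - A) = B" using assms by auto
  ultimately show ?thesis by simp
qed

text \<open>If the variation were infinite, one could split off forever disjoint sets on which
  \<open>\<bar>\<nu>\<bar> \<ge> 1\<close>, contradicting the convergence of the series of their measures.\<close>

lemma upper_variation_finite:
  assumes "real_radon_measure \<Omega> \<nu>" "\<Omega> \<in> sets borel"
  shows "upper_variation \<Omega> \<nu> \<Omega> < \<infinity>"
proof (rule ccontr)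
  assume "\<not> ?thesis"
  then have inf: "upper_variation \<Omega> \<nu> \<Omega> = \<infinity>" by (metis infinity_ennreal_def top.not_eq_extremum)
  define S where "S = {B \<in> borel_subsets \<Omega>. upper_variation \<Omega> \<nu> B = \<infinity>}"
  have step: "\<exists>C. C \<in> S \<and> C \<subseteq> B \<and> \<bar>\<nu> (B - C)\<bar> \<ge> 1" if "B \<in> S" for B
  proof -
    have B: "B \<in> borel_subsets \<Omega>" "upper_variation \<Omega> \<nu> B = \<infinity>" using that by (auto simp: S_def)
    \<comment> \<open>The threshold makes both \<open>\<nu> A\<close> and
      \<open>\<nu> (B - A)\<close> at least 1 in absolute value. Whichever half keeps infinite
      variation, the other one can be split off.\<close>
    have "ennreal (1 + \<bar>\<nu> B\<bar>) < upper_variation \<Omega> \<nu> B" using B by simp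
    then obtain A where A: "A \<in> borel_subsets \<Omega>" "A \<subseteq> B" "ennreal (1 + \<bar>\<nu> B\<bar>) < ennreal (\<nu> A)"
      unfolding upper_variation_def by (auto simp: less_SUP_iff)
    then have nA: "\<nu> A > 1 + \<bar>\<nu> B\<bar>" using ennreal_less_iff[of "1 + \<bar>\<nu> B\<bar>" "\<nu> A"] by linarith
    have BA: "B - A \<in> borel_subsets \<Omega>" using A B by (auto simp: borel_subsets_def)
    have nBA: "\<nu> (B - A) = \<nu> B - \<nu> A" using real_radon_measure_Diff[OF assms(1) A(1) B(1) A(2)] .
    have "upper_variation \<Omega> \<nu> A + upper_variation \<Omega> \<nu> (B - A) = \<infinity>"
      using upper_variation_split[OF assms A(1) B(1) A(2)] B(2) by simp
    then consider "upper_variation \<Omega> \<nu> A = \<infinity>" | "upper_variation \<Omega> \<nu> (B - A) = \<infinity>"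
      by (auto simp: ennreal_add_eq_top)
    then show ?thesis
    proof cases
      case 1
      then show ?thesis using A nA nBA by (intro exI[of _ A]) (auto simp: S_def)
    next
      case 2
      have "B - (B - A) = A" using A by auto
      then show ?thesis using 2 BA nA by (intro exI[of _ "B - A"]) (auto simp: S_def)
    qed
  qed
  then obtain c where c: "\<And>B. B \<in> S \<Longrightarrow> c B \<in> S \<and> c B \<subseteq> B \<and> \<bar>\<nu> (B - c B)\<bar> \<ge> 1" by metis
  define D where "D n = (c ^^ n) \<Omega>" for n
  have D: "D n \<in> S" for n
    by (induction n) (use inf assms c in \<open>auto simp: D_def S_def borel_subsets_def\<close>)
  have DS: "D (Suc n) \<subseteq> D n" "\<bar>\<nu> (D n - D (Suc n))\<bar> \<ge> 1" for n
    using c[OF D[of n]] by (auto simp: D_def)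
  have dec: "decseq D" using DS(1) by (rule decseq_SucI)
  have disj: "disjoint_family (\<lambda>n. D n - D (Suc n))"
    unfolding disjoint_family_on_def
  proof (intro ballI impI)
    fix m n :: nat assume "m \<noteq> n"
    then have "Suc m \<le> n \<or> Suc n \<le> m" by auto
    then show "(D m - D (Suc m)) \<inter> (D n - D (Suc n)) = {}"
      using decseqD[OF dec] by blast
  qed
  have "range (\<lambda>n. D n - D (Suc n)) \<subseteq> borel_subsets \<Omega>" using D by (auto simp: S_def borel_subsets_def)
  then have "(\<lambda>n. \<nu> (D n - D (Suc n))) \<longlonglongrightarrow> 0"
    using real_radon_measure_sums[OF assms(1) _ disj] summable_LIMSEQ_zero sums_summable by blast
  then have "eventually (\<lambda>n. \<bar>\<nu> (D n - D (Suc n))\<bar> < 1) sequentially"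
    by (auto simp: tendsto_iff dist_real_def elim: allE[of _ 1])
  then show False using DS(2) by (auto simp: eventually_sequentially not_le[symmetric])
qed

section \<open>Variation measures and the Jordan decomposition\<close>

lemma
  assumes "\<Omega> \<in> sets borel"
  shows space_pos_variation [simp]: "space (pos_variation \<Omega> \<nu>) = \<Omega>"
    and sets_pos_variation [simp]: "sets (pos_variation \<Omega> \<nu>) = borel_subsets \<Omega>"
proof -
  interpret sigma_algebra \<Omega> "borel_subsets \<Omega>" using assms by (intro sigma_algebra_borel_subsets)
  show "space (pos_variation \<Omega> \<nu>) = \<Omega>"
    by (simp add: pos_variation_def space_measure_of_conv)
  show "sets (pos_variation \<Omega> \<nu>) = borel_subsets \<Omega>"
    by (simp add: pos_variation_def sets_measure_of_eq)
qed

lemma emeasure_pos_variation: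
  assumes "real_radon_measure \<Omega> \<nu>" "\<Omega> \<in> sets borel" "B \<in> borel_subsets \<Omega>"
  shows "emeasure (pos_variation \<Omega> \<nu>) B = upper_variation \<Omega> \<nu> B"
proof -
  interpret sigma_algebra \<Omega> "borel_subsets \<Omega>" using assms by (intro sigma_algebra_borel_subsets)
  have "positive (borel_subsets \<Omega>) (upper_variation \<Omega> \<nu>)"
    using real_radon_measure_empty[OF assms(1)]
    by (auto simp: positive_def upper_variation_def borel_subsets_def bot_ennreal[symmetric] intro!: antisym SUP_least)
  moreover have "pos_variation \<Omega> \<nu> = measure_of \<Omega> (borel_subsets \<Omega>) (upper_variation \<Omega> \<nu>)"
    by (simp add: pos_variation_def upper_variation_def[abs_def])
  ultimately show ?thesis
    using countably_additive_upper_variation[OF assms(1)] assms(3) sigma_algebra_axioms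
    by (simp add: emeasure_measure_of_sigma)
qed

lemma finite_measure_pos_variation:
  assumes "real_radon_measure \<Omega> \<nu>" "\<Omega> \<in> sets borel"
  shows "finite_measure (pos_variation \<Omega> \<nu>)"
  using upper_variation_finite[OF assms] assms
  by (intro finite_measureI) (auto simp: emeasure_pos_variation borel_subsets_def)

text \<open>For \<open>A \<subseteq> B\<close>, the value
  \<open>\<nu> A = \<nu> B - \<nu> (B - A)\<close> is at most \<open>\<nu> B\<close> plus the
  negative variation of \<open>B\<close>. The supremum over \<open>A\<close> gives one inequality,
  and the same inequality for \<open>- \<nu>\<close> gives the other.\<close>

lemma real_radon_measure_Jordan:
  assumes "real_radon_measure \<Omega> \<nu>" "\<Omega> \<in> sets borel" "B \<in> borel_subsets \<Omega>"
  shows "\<nu> B = measure (pos_variation \<Omega> \<nu>) B - measure (pos_variation \<Omega> (\<lambda>B. - \<nu> B)) B"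
proof -
  have aux: "measure (pos_variation \<Omega> \<mu>) B \<le> \<mu> B + measure (pos_variation \<Omega> (\<lambda>B. - \<mu> B)) B"
    if \<mu>: "real_radon_measure \<Omega> \<mu>" for \<mu>
  proof -
    interpret P: finite_measure "pos_variation \<Omega> \<mu>"
      using assms \<mu> by (intro finite_measure_pos_variation)
    interpret N: finite_measure "pos_variation \<Omega> (\<lambda>B. - \<mu> B)"
      using assms \<mu> by (intro finite_measure_pos_variation real_radon_measure_uminus)
    have bd: "\<mu> A \<le> \<mu> B + measure (pos_variation \<Omega> (\<lambda>B. - \<mu> B)) B"
      if A: "A \<in> borel_subsets \<Omega>" "A \<subseteq> B" for A
    proof -
      have BA: "B - A \<in> borel_subsets \<Omega>" using A assms by (auto simp: borel_subsets_def)
      have "ennreal (- \<mu> (B - A)) \<le> emeasure (pos_variation \<Omega> (\<lambda>B. - \<mu> B)) B"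
        using emeasure_pos_variation[OF real_radon_measure_uminus[OF \<mu>] assms(2,3)]
          upper_variation_upper[OF BA, of B "\<lambda>B. - \<mu> B"] by auto
      then have "- \<mu> (B - A) \<le> measure (pos_variation \<Omega> (\<lambda>B. - \<mu> B)) B"
        by (simp add: N.emeasure_eq_measure)
      then show ?thesis using real_radon_measure_Diff[OF \<mu> A(1) assms(3) A(2)] by simp
    qed
    have "0 \<le> \<mu> B + measure (pos_variation \<Omega> (\<lambda>B. - \<mu> B)) B"
      using bd[of "{}"] real_radon_measure_empty[OF \<mu>] by (auto simp: borel_subsets_def)
    moreover have "emeasure (pos_variation \<Omega> \<mu>) B \<le> ennreal (\<mu> B + measure (pos_variation \<Omega> (\<lambda>B. - \<mu> B)) B)"
      unfolding emeasure_pos_variation[OF \<mu> assms(2,3)] upper_variation_def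
      by (intro SUP_least ennreal_leI bd) auto
    ultimately show ?thesis by (simp add: P.emeasure_eq_measure)
  qed
  from aux[OF assms(1)] aux[OF real_radon_measure_uminus[OF assms(1)]] show ?thesis by simp
qed

section \<open>Integrals of bounded functions\<close>

lemma borel_measurable_pos_variation:
  assumes "\<Omega> \<in> sets borel"
  shows "borel_measurable (pos_variation \<Omega> \<nu>) = borel_measurable (restrict_space borel \<Omega>)"
  using assms by (intro measurable_cong_sets) (auto simp: sets_restrict_borel)

lemma integrable_pos_variation:
  fixes f :: "'a::euclidean_space \<Rightarrow> real"
  assumes "real_radon_measure \<Omega> \<nu>" "\<Omega> \<in> sets borel"
    and "f \<in> borel_measurable (restrict_space borel \<Omega>)" "\<And>x. x \<in> \<Omega> \<Longrightarrow> \<bar>f x\<bar> \<le> C"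
  shows "integrable (pos_variation \<Omega> \<nu>) f"
proof -
  interpret finite_measure "pos_variation \<Omega> \<nu>" using assms(1,2) by (rule finite_measure_pos_variation)
  show ?thesis
    by (rule integrable_const_bound[where B=C])
      (use assms in \<open>auto intro!: AE_I2 simp: borel_measurable_pos_variation\<close>)
qed

text \<open>A substitute for linearity of the integral in the measure: a relation between weighted
  measures that is known on sets carries over to bounded functions by monotone class induction. The
  weights \<open>g j\<close> carry the signs and densities, while the measures themselves stay
  positive.\<close>

lemma sum_integrals_eq_0:
  fixes g :: "'i \<Rightarrow> 'a \<Rightarrow> real"
  assumes sets: "\<And>j. j \<in> J \<Longrightarrow> sets (M j) = sets N"
    and int: "\<And>j. j \<in> J \<Longrightarrow> integrable (M j) (g j)"
    and zero: "\<And>B. B \<in> sets N \<Longrightarrow> (\<Sum>j\<in>J. LINT x|M j. indicator B x * g j x) = 0"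
    and f: "f \<in> borel_measurable N" and bd: "\<And>x. x \<in> space N \<Longrightarrow> \<bar>f x\<bar> \<le> C"
  shows "(\<Sum>j\<in>J. LINT x|M j. f x * g j x) = 0"
proof -
  have space: "space (M j) = space N" if "j \<in> J" for j using sets[OF that] by (rule sets_eq_imp_space_eq)
  have meas: "u \<in> borel_measurable (M j)" if "u \<in> borel_measurable N" "j \<in> J" for u :: "'a \<Rightarrow> real" and j
    using that(1) by (subst measurable_cong_sets[OF sets[OF that(2)] refl])
  have integ: "integrable (M j) (\<lambda>x. u x * g j x)"
    if "u \<in> borel_measurable N" "j \<in> J" "\<And>x. x \<in> space N \<Longrightarrow> \<bar>u x\<bar> \<le> D" for u j D
  proof (rule Bochner_Integration.integrable_bound)
    show "integrable (M j) (\<lambda>x. D * \<bar>g j x\<bar>)" using int[OF that(2)] by simp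
    show "(\<lambda>x. u x * g j x) \<in> borel_measurable (M j)" using meas[OF that(1,2)] int[OF that(2)] by auto
    show "AE x in M j. norm (u x * g j x) \<le> norm (D * \<bar>g j x\<bar>)"
    proof (rule AE_I2)
      fix x assume "x \<in> space (M j)"
      then have "x \<in> space N" using space[OF that(2)] by simp
      from that(3)[OF this] have "\<bar>u x\<bar> \<le> \<bar>D\<bar>" by linarith
      then show "norm (u x * g j x) \<le> norm (D * \<bar>g j x\<bar>)" by (simp add: abs_mult mult_right_mono)
    qed
  qed
  \<comment> \<open>The bound sits inside the induction claim because the induction runs over all
    nonnegative measurable functions, and sums and limits can be taken out of the integrals only for
    bounded ones. Summands and approximants inherit \<open>D\<close>; scaling changes it, so it must
    vary.\<close>
  have nonneg: "(\<forall>x\<in>space N. u x \<le> D) \<longrightarrow> (\<Sum>j\<in>J. LINT x|M j. u x * g j x) = 0"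
    if "u \<in> borel_measurable N" "\<And>x. 0 \<le> u x" for u D
    using that
  proof (induction arbitrary: D rule: borel_measurable_induct_real)
    case (set A)
    then show ?case using zero by auto
  next
    case (mult u c)
    show ?case
    proof (cases "c = 0")
      case False
      show ?thesis
      proof
        assume "\<forall>x\<in>space N. c * u x \<le> D"
        then have "\<forall>x\<in>space N. u x \<le> D / c" using mult(1) False by (auto simp: field_simps)
        then have "(\<Sum>j\<in>J. LINT x|M j. u x * g j x) = 0" using mult(4)[of "D / c"] by blast
        then show "(\<Sum>j\<in>J. LINT x|M j. c * u x * g j x) = 0"
          by (simp add: mult.assoc sum_distrib_left[symmetric])
      qed
    qed auto
  next
    case (add u v)
    show ?case
    proof
      assume *: "\<forall>x\<in>space N. v x + u x \<le> D"
      then have bd: "\<forall>x\<in>space N. v x \<le> D" "\<forall>x\<in>space N. u x \<le> D"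
      proof -
        have "v x \<le> v x + u x" "u x \<le> v x + u x" for x using add.hyps(2)[of x] add.hyps(4)[of x] by auto
        with * show "\<forall>x\<in>space N. v x \<le> D" "\<forall>x\<in>space N. u x \<le> D"
          using order_trans by blast+
      qed
      then have "(LINT x|M j. (v x + u x) * g j x) = (LINT x|M j. v x * g j x) + (LINT x|M j. u x * g j x)"
        if "j \<in> J" for j
        using add.hyps(1-4) that unfolding distrib_right
        by (intro Bochner_Integration.integral_add integ[where D=D]) auto
      then show "(\<Sum>j\<in>J. LINT x|M j. (v x + u x) * g j x) = 0"
        using add.IH bd by (simp add: sum.distrib)
    qed
  next
    case (seq U)
    show ?case
    proof
      assume *: "\<forall>x\<in>space N. u x \<le> D"
      have Uu: "U i x \<le> u x" if "x \<in> space N" for i x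
        using seq.hyps(3,4) that by (intro incseq_le) (auto simp: incseq_def le_fun_def)
      have "(\<Sum>j\<in>J. LINT x|M j. U i x * g j x) = 0" for i
        using seq.IH[of i D] * Uu by (meson order_trans)
      moreover have "(\<lambda>i. \<Sum>j\<in>J. LINT x|M j. U i x * g j x) \<longlonglongrightarrow> (\<Sum>j\<in>J. LINT x|M j. u x * g j x)"
      proof (intro tendsto_sum integral_dominated_convergence)
        fix j assume j: "j \<in> J"
        show "integrable (M j) (\<lambda>x. D * \<bar>g j x\<bar>)" using int[OF j] by simp
        have u: "u \<in> borel_measurable N" 
          by (rule borel_measurable_LIMSEQ_real[OF seq.hyps(4) seq.hyps(1)])
        show "(\<lambda>x. u x * g j x) \<in> borel_measurable (M j)" 
          by (intro borel_measurable_times meas[OF u j] borel_measurable_integrable[OF int[OF j]])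
        show "(\<lambda>x. U i x * g j x) \<in> borel_measurable (M j)" for i 
          by (intro borel_measurable_times meas[OF seq.hyps(1) j] borel_measurable_integrable[OF int[OF j]])
        show "AE x in M j. (\<lambda>i. U i x * g j x) \<longlonglongrightarrow> u x * g j x"
          using seq.hyps(4) space[OF j] by (auto intro!: AE_I2 tendsto_mult)
        show "AE x in M j. norm (U i x * g j x) \<le> D * \<bar>g j x\<bar>" for i
        proof (rule AE_I2)
          fix x assume "x \<in> space (M j)"
          then have "x \<in> space N" using space[OF j] by simp
          with Uu[of x i] * have "U i x \<le> D" using order_trans by blast
          then show "norm (U i x * g j x) \<le> D * \<bar>g j x\<bar>"
            using seq.hyps(2)[of i x] by (simp add: abs_mult mult_right_mono)
        qed
      qed
      ultimately show "(\<Sum>j\<in>J. LINT x|M j. u x * g j x) = 0"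
        by (simp add: LIMSEQ_const_iff)
    qed
  qed
  define fp where "fp x = max 0 (f x)" for x
  define fn where "fn x = max 0 (- f x)" for x
  have [measurable]: "fp \<in> borel_measurable N" "fn \<in> borel_measurable N" 
    unfolding fp_def[abs_def] fn_def[abs_def] using f by auto
  have fb: "\<bar>fp x\<bar> \<le> \<bar>C\<bar>" "\<bar>fn x\<bar> \<le> \<bar>C\<bar>" if "x \<in> space N" for x
    using bd[OF that] by (auto simp: fp_def fn_def)
  have "(LINT x|M j. f x * g j x) = (LINT x|M j. fp x * g j x) - (LINT x|M j. fn x * g j x)" if "j \<in> J" for j
  proof -
    have "f x * g j x = fp x * g j x - fn x * g j x" for x by (auto simp: fp_def fn_def max_def)
    moreover have "integrable (M j) (\<lambda>x. fp x * g j x)" "integrable (M j) (\<lambda>x. fn x * g j x)"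
      using fb that by (auto intro: integ[where D="\<bar>C\<bar>"])
    ultimately show ?thesis by simp
  qed
  moreover have "(\<Sum>j\<in>J. LINT x|M j. fp x * g j x) = 0" "(\<Sum>j\<in>J. LINT x|M j. fn x * g j x) = 0"
    using nonneg[of fp "\<bar>C\<bar>"] nonneg[of fn "\<bar>C\<bar>"] fb by (fastforce simp: fp_def fn_def)+
  ultimately show ?thesis by (simp add: sum_subtractf)
qed

lemma real_measure_integral_indicator:
  assumes "real_radon_measure \<Omega> \<nu>" "\<Omega> \<in> sets borel" "B \<in> borel_subsets \<Omega>"
  shows "real_measure_integral \<Omega> \<nu> (indicator B) = \<nu> B"
  using real_radon_measure_Jordan[OF assms] assms
  by (auto simp: real_measure_integral_def borel_subsets_def Int_absorb1 Int_absorb2)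

section \<open>Smooth functions\<close>

lemma Ck_SucI:
  assumes "\<And>x. (f has_derivative D x) (at x)" "\<And>b. b \<in> Basis \<Longrightarrow> Ck k (\<lambda>x. D x b)"
  shows "Ck (Suc k) f"
proof -
  have "frechet_derivative f (at x) = D x" for x
    using frechet_derivative_at[OF assms(1)] by simp
  then show ?thesis using assms by (auto simp: differentiable_def)
qed

lemma Ck_SucD:
  "Ck (Suc k) f \<Longrightarrow> (f has_derivative frechet_derivative f (at x)) (at x)"
  "Ck (Suc k) f \<Longrightarrow> b \<in> Basis \<Longrightarrow> Ck k (\<lambda>x. frechet_derivative f (at x) b)"
  by (auto simp: frechet_derivative_works)

lemma Ck_Suc_imp: "Ck (Suc k) f \<Longrightarrow> Ck k f"
proof (induction k arbitrary: f)
  case 0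
  then show ?case by (auto intro!: continuous_at_imp_continuous_on differentiable_imp_continuous_within)
next
  case (Suc k)
  then show ?case by (metis Ck.simps(2))
qed

lemma Ck_imp_continuous_on: "Ck k f \<Longrightarrow> continuous_on UNIV f"
  by (induction k) (auto intro!: continuous_at_imp_continuous_on differentiable_imp_continuous_within)

lemma Ck_const: "Ck k (\<lambda>_. c)"
proof (induction k arbitrary: c)
  case (Suc k)
  show ?case by (rule Ck_SucI[where D="\<lambda>_ _. 0"]) (auto intro: Suc)
qed auto

lemma Ck_add: "Ck k f \<Longrightarrow> Ck k g \<Longrightarrow> Ck k (\<lambda>x. f x + g x)"
proof (induction k arbitrary: f g)
  case 0
  then show ?case by (auto intro: continuous_on_add)
next
  case (Suc k)
  note f = Ck_SucD[OF Suc.prems(1)] and g = Ck_SucD[OF Suc.prems(2)]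
  show ?case
    by (rule Ck_SucI[OF has_derivative_add[OF f(1) g(1)]]) (intro Suc.IH f g)
qed

lemma Ck_mult: "Ck k f \<Longrightarrow> Ck k g \<Longrightarrow> Ck k (\<lambda>x. f x * g x)"
proof (induction k arbitrary: f g)
  case 0
  then show ?case by (auto intro: continuous_on_mult)
next
  case (Suc k)
  note f = Ck_SucD[OF Suc.prems(1)] and g = Ck_SucD[OF Suc.prems(2)]
  note fg = Suc.prems[THEN Ck_Suc_imp]
  show ?case
    by (rule Ck_SucI[OF has_derivative_mult[OF f(1) g(1)]]) (intro Ck_add Suc.IH f g fg)
qed

lemma Ck_prod: "(\<And>i. i \<in> I \<Longrightarrow> Ck k (f i)) \<Longrightarrow> Ck k (\<lambda>x. \<Prod>i\<in>I. f i x)"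
  by (induction I rule: infinite_finite_induct) (auto intro: Ck_const Ck_mult)

lemma Ck_affine: "Ck k f \<Longrightarrow> Ck k (\<lambda>x. f (c + s *\<^sub>R x))"
proof (induction k arbitrary: f)
  case 0
  then show ?case by (auto intro!: continuous_on_compose2[of UNIV f] continuous_intros)
next
  case (Suc k)
  note f = Ck_SucD[OF Suc.prems]
  have d: "((\<lambda>x. f (c + s *\<^sub>R x)) has_derivative
      (\<lambda>h. s * frechet_derivative f (at (c + s *\<^sub>R x)) h)) (at x)" for x
  proof -
    have "((\<lambda>x. c + s *\<^sub>R x) has_derivative (\<lambda>h. s *\<^sub>R h)) (at x)"
      by (auto intro!: derivative_eq_intros)
    from has_derivative_compose[OF this f(1)]
    show ?thesis
      by (simp add: linear_cmul[OF has_derivative_linear[OF f(1)]])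
  qed
  show ?case by (rule Ck_SucI[OF d]) (intro Ck_mult Ck_const Suc.IH[OF f(2)])
qed

subsection \<open>Bump functions\<close>

text \<open>These functions span a space closed under differentiation, because
  \<open>h\<^sub>m' = h\<^bsub>m+2\<^esub> - m h\<^bsub>m+1\<^esub>\<close>.\<close>

definition flat_exp :: "nat \<Rightarrow> real \<Rightarrow> real" where
  "flat_exp m t = (if 0 < t then inverse t ^ m * exp (- inverse t) else 0)"

lemma flat_exp_tendsto_0: "(flat_exp m \<longlongrightarrow> 0) (at 0)"
proof -
  have "((\<lambda>t::real. inverse t ^ m / exp (inverse t)) \<longlongrightarrow> 0) (at_right 0)"
    using tendsto_power_div_exp_0[of m] filterlim_inverse_at_top_right by (rule filterlim_compose)
  then have "(flat_exp m \<longlongrightarrow> 0) (at_right 0)"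
    by (rule Lim_transform_eventually)
      (auto simp: flat_exp_def eventually_at_filter exp_minus divide_inverse)
  moreover have "(flat_exp m \<longlongrightarrow> 0) (at_left 0)"
    by (rule Lim_transform_eventually[OF tendsto_const])
      (auto simp: flat_exp_def eventually_at_filter)
  ultimately show ?thesis by (simp add: filterlim_at_split)
qed

lemma has_real_derivative_flat_exp:
  "(flat_exp m has_real_derivative (flat_exp (m + 2) t - real m * flat_exp (m + 1) t)) (at t)"
proof -
  consider "t > 0" | "t < 0" | "t = 0" by linarith
  then show ?thesis
  proof cases
    case 1
    have "((\<lambda>t. inverse t ^ m * exp (- inverse t)) has_real_derivative
        real m * inverse t ^ (m - 1) * - (inverse t)\<^sup>2 * exp (- inverse t)
          + inverse t ^ m * (exp (- inverse t) * (inverse t)\<^sup>2)) (at t)"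
      using 1 by (auto intro!: derivative_eq_intros simp: power2_eq_square)
    also have "real m * inverse t ^ (m - 1) * - (inverse t)\<^sup>2 * exp (- inverse t)
          + inverse t ^ m * (exp (- inverse t) * (inverse t)\<^sup>2)
        = flat_exp (m + 2) t - real m * flat_exp (m + 1) t"
      using 1 by (cases m) (simp_all add: flat_exp_def power2_eq_square algebra_simps)
    finally show ?thesis
      by (rule has_field_derivative_transform_within_open[of _ _ _ "{0<..}"])
        (use 1 in \<open>auto simp: flat_exp_def\<close>)
  next
    case 2
    have "((\<lambda>t. 0) has_real_derivative (flat_exp (m + 2) t - real m * flat_exp (m + 1) t)) (at t)"
      using 2 by (simp add: flat_exp_def)
    then show ?thesis
      by (rule has_field_derivative_transform_within_open[of _ _ _ "{..<0}"])
        (use 2 in \<open>auto simp: flat_exp_def\<close>)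
  next
    case 3
    \<comment> \<open>At 0 the difference quotient of \<open>flat_exp m\<close> is
      \<open>flat_exp (Suc m)\<close>, so the limit at 0 also yields the derivative there.\<close>
    have "((\<lambda>h. (flat_exp m (0 + h) - flat_exp m 0) / h) \<longlongrightarrow> 0) (at 0)"
      by (rule Lim_transform_eventually[OF flat_exp_tendsto_0[of "Suc m"]])
        (auto simp: flat_exp_def eventually_at_filter divide_inverse)
    then show ?thesis using 3 by (simp add: DERIV_def flat_exp_def)
  qed
qed

lemma Ck_flat_exp: "Ck k (\<lambda>x. flat_exp m (c + s * (x \<bullet> v)))"
proof (induction k arbitrary: m)
  case 0
  have "continuous_on UNIV (flat_exp m)"
    by (intro continuous_at_imp_continuous_on ballI DERIV_isCont[OF has_real_derivative_flat_exp])
  then show ?case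
    by (auto intro!: continuous_on_compose2[of UNIV "flat_exp m"] continuous_intros)
next
  case (Suc k)
  have d: "((\<lambda>x. flat_exp m (c + s * (x \<bullet> v))) has_derivative (\<lambda>h. (flat_exp (m + 2) (c + s * (x \<bullet> v))
      + (- real m) * flat_exp (m + 1) (c + s * (x \<bullet> v))) * (s * (h \<bullet> v)))) (at x)" for x
  proof -
    have "((\<lambda>x. c + s * (x \<bullet> v)) has_derivative (\<lambda>h. s * (h \<bullet> v))) (at x)"
      by (auto intro!: derivative_eq_intros)
    from has_derivative_compose[OF this has_real_derivative_flat_exp[unfolded has_field_derivative_def]]
    show ?thesis by simp
  qed
  show ?case by (rule Ck_SucI[OF d]) (intro Ck_mult Ck_add Ck_const Suc.IH)
qed

text \<open>For s > 0 this is positive exactly on the open box, and every factor tends to 1 there as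
  s grows. One family thus serves twice: with s = 1 as an unnormalised mollifier, and with s tending
  to infinity as a smooth approximation of the indicator of the box.\<close>

definition box_bump :: "real \<Rightarrow> 'a::euclidean_space \<Rightarrow> 'a \<Rightarrow> 'a \<Rightarrow> real" where
  "box_bump s a b x =
     (\<Prod>i\<in>Basis. flat_exp 0 (s * ((x - a) \<bullet> i)) * flat_exp 0 (s * ((b - x) \<bullet> i)))"

lemma Ck_box_bump: "Ck k (box_bump s a b)"
proof -
  have "Ck k (\<lambda>x. \<Prod>i\<in>Basis. flat_exp 0 (- (s * (a \<bullet> i)) + s * (x \<bullet> i)) *
      flat_exp 0 (s * (b \<bullet> i) + (- s) * (x \<bullet> i)))"
    by (intro Ck_prod Ck_mult Ck_flat_exp)
  then show ?thesis
    by (simp add: box_bump_def[abs_def] inner_diff_left algebra_simps)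
qed

lemma flat_exp_0_bounds: "0 \<le> flat_exp 0 t" "flat_exp 0 t \<le> 1"
  by (auto simp: flat_exp_def)

lemma box_bump_bounds: "0 \<le> box_bump s a b x" "box_bump s a b x \<le> 1"
  unfolding box_bump_def
  by (auto intro!: prod_nonneg prod_le_1 mult_le_one mult_nonneg_nonneg flat_exp_0_bounds)

lemma box_bump_neq_0_iff: "s > 0 \<Longrightarrow> box_bump s a b x \<noteq> 0 \<longleftrightarrow> x \<in> box a b"
  by (auto simp: box_bump_def flat_exp_def mem_box inner_diff_left zero_less_mult_iff)

lemma box_bump_tendsto_indicator:
  "(\<lambda>n. box_bump (real (Suc n)) a b x) \<longlonglongrightarrow> indicator (box a b) x"
proof (cases "x \<in> box a b")
  case True
  have *: "(\<lambda>n. flat_exp 0 (real (Suc n) * t)) \<longlonglongrightarrow> 1" if "t > 0" for t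
  proof -
    have "(\<lambda>n. exp (- (inverse (real (Suc n)) * inverse t))) \<longlonglongrightarrow> exp (- (0 * inverse t))"
      by (intro tendsto_intros LIMSEQ_inverse_real_of_nat)
    then show ?thesis using that by (simp add: flat_exp_def inverse_mult_distrib)
  qed
  have "(\<lambda>n. box_bump (real (Suc n)) a b x) \<longlonglongrightarrow> (\<Prod>i\<in>(Basis::'a set). 1 * 1)"
    unfolding box_bump_def
    using True by (intro tendsto_prod tendsto_mult *) (auto simp: mem_box inner_diff_left)
  then show ?thesis using True by simp
next
  case False
  then have "box_bump (real (Suc n)) a b x = 0" for n
    using box_bump_neq_0_iff[of "real (Suc n)" a b x] by auto
  then show ?thesis using False by simp
qed

subsection \<open>Gradients\<close>

lemma grad_inner_Basis: "b \<in> Basis \<Longrightarrow> grad f x \<bullet> b = frechet_derivative f (at x) b"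
  by (simp add: grad_def inner_sum_left inner_Basis if_distrib cong: if_cong)

lemma grad_mult:
  assumes "f differentiable at x" "g differentiable at x"
  shows "grad (\<lambda>x. f x * g x) x = f x *\<^sub>R grad g x + g x *\<^sub>R grad f x"
proof -
  have "((\<lambda>x. f x * g x) has_derivative
      (\<lambda>h. f x * frechet_derivative g (at x) h + frechet_derivative f (at x) h * g x)) (at x)"
    using assms by (intro has_derivative_mult) (auto simp: frechet_derivative_works)
  from frechet_derivative_at[OF this, symmetric] show ?thesis
    by (simp add: grad_def scaleR_sum_right sum.distrib scaleR_add_left mult.commute)
qed

lemma grad_eq_0:
  assumes "x \<notin> closure {x. f x \<noteq> 0}"
  shows "grad f x = 0"
proof -
  have "((\<lambda>_. 0::real) has_derivative (\<lambda>_. 0)) (at x)" by simp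
  then have "(f has_derivative (\<lambda>_. 0)) (at x)"
  proof (rule has_derivative_transform_within_open)
    show "x \<in> - closure {x. f x \<noteq> 0}" using assms by simp
    show "0 = f y" if "y \<in> - closure {x. f x \<noteq> 0}" for y
      using that closure_subset[of "{x. f x \<noteq> 0}"] by auto
  qed (simp_all add: open_Compl)
  from frechet_derivative_at[OF this] show ?thesis
    by (simp add: grad_def fun_eq_iff)
qed

lemma continuous_on_grad:
  "Ck (Suc k) f \<Longrightarrow> continuous_on UNIV (grad f)"
  unfolding grad_def[abs_def]
  by (intro continuous_intros Ck_imp_continuous_on[of k]) (rule Ck_SucD)

lemma grad_reflect:
  assumes "Ck (Suc k) f"
  shows "grad (\<lambda>y. f (x - y)) y = - grad f (x - y)"
proof -
  have "((\<lambda>y. x - y) has_derivative (\<lambda>h. - h)) (at y)"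
    by (auto intro!: derivative_eq_intros)
  from has_derivative_compose[OF this Ck_SucD(1)[OF assms]]
  have "((\<lambda>y. f (x - y)) has_derivative (\<lambda>h. frechet_derivative f (at (x - y)) (- h))) (at y)" .
  from frechet_derivative_at[OF this, symmetric] show ?thesis
    by (simp add: grad_def sum_negf linear_neg[OF has_derivative_linear[OF Ck_SucD(1)[OF assms]]])
qed

subsection \<open>Convolution with a smooth kernel\<close>

text \<open>Integration over a fixed box makes differentiation under the integral a matter of a
  compact domain. Wherever the integrand vanishes outside the box, this is the ordinary
  convolution.\<close>

definition box_convolution ::
  "'a::euclidean_space \<Rightarrow> 'a \<Rightarrow> ('a \<Rightarrow> real) \<Rightarrow> ('a \<Rightarrow> real) \<Rightarrow> 'a \<Rightarrow> real" where
  "box_convolution a b \<rho> f x = integral (cbox a b) (\<lambda>y. f y * \<rho> (x - y))"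

lemma has_derivative_box_convolution:
  assumes "Ck (Suc k) \<rho>" "continuous_on UNIV f"
  shows "(box_convolution a b \<rho> f has_derivative
    (\<lambda>h. \<Sum>i\<in>Basis. box_convolution a b (\<lambda>x. frechet_derivative \<rho> (at x) i) f x * (h \<bullet> i))) (at x)"
proof -
  define D where "D i x = frechet_derivative \<rho> (at x) i" for i x
  have D: "continuous_on UNIV (D i)" if "i \<in> Basis" for i
    using Ck_imp_continuous_on[OF Ck_SucD(2)[OF assms(1) that]] by (simp add: D_def[abs_def])
  have \<rho>: "continuous_on UNIV \<rho>" by (rule Ck_imp_continuous_on[OF assms(1)])
  \<comment> \<open>\<open>leibniz_rule\<close> asks for a jointly continuous derivative with values
    in bounded linear maps. Assembling it from partial derivatives exhibits every coordinate as a
    \<open>box_convolution\<close> again, which the later induction on the order of smoothness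
    relies on.\<close>
  define fx where "fx x t = (\<Sum>i\<in>Basis. (f t * D i (x - t)) *\<^sub>R blinfun_inner_left i)" for x t :: 'a
  have cont: "continuous_on S (\<lambda>p. f (snd p) * D i (fst p - snd p))" if "i \<in> Basis" for i S
    by (intro continuous_intros continuous_on_compose2[OF assms(2)] continuous_on_compose2[OF D[OF that]]) auto
  have cont1: "continuous_on S (\<lambda>t. f t * D i (x - t))" if "i \<in> Basis" for i x S
    by (intro continuous_intros continuous_on_compose2[OF assms(2)] continuous_on_compose2[OF D[OF that]]) auto
  have "((\<lambda>x. integral (cbox a b) (\<lambda>y. f y * \<rho> (x - y))) has_derivative
      blinfun_apply (integral (cbox a b) (fx x))) (at x within UNIV)"
  proof (rule leibniz_rule)
    fix x t :: 'a
    have lin: "linear (frechet_derivative \<rho> (at (x - t)))"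
      using has_derivative_linear[OF Ck_SucD(1)[OF assms(1)]] .
    have "((\<lambda>x. x - t) has_derivative (\<lambda>h. h)) (at x)"
      by (auto intro!: derivative_eq_intros)
    from has_derivative_mult_right[OF has_derivative_compose[OF this Ck_SucD(1)[OF assms(1)]], of "f t"]
    have "((\<lambda>x. f t * \<rho> (x - t)) has_derivative (\<lambda>h. f t * frechet_derivative \<rho> (at (x - t)) h)) (at x)" .
    moreover have "f t * frechet_derivative \<rho> (at (x - t)) h = blinfun_apply (fx x t) h" for h
    proof -
      have "frechet_derivative \<rho> (at (x - t)) h
          = frechet_derivative \<rho> (at (x - t)) (\<Sum>i\<in>Basis. (h \<bullet> i) *\<^sub>R i)"
        by (simp add: euclidean_representation)
      also have "\<dots> = (\<Sum>i\<in>Basis. (h \<bullet> i) * D i (x - t))"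
        by (simp add: linear_sum[OF lin] linear_cmul[OF lin] D_def)
      finally show ?thesis
        by (simp add: fx_def blinfun.sum_left blinfun.scaleR_left sum_distrib_left algebra_simps)
    qed
    ultimately show "((\<lambda>x. f t * \<rho> (x - t)) has_derivative blinfun_apply (fx x t)) (at x within UNIV)"
      by simp
  next
    show "(\<lambda>y. f y * \<rho> (x - y)) integrable_on cbox a b" for x
      by (intro integrable_continuous continuous_intros continuous_on_compose2[OF assms(2)]
          continuous_on_compose2[OF \<rho>]) auto
    show "continuous_on (UNIV \<times> cbox a b) (\<lambda>(x, t). fx x t)"
      unfolding split_beta fx_def by (intro continuous_on_sum continuous_on_scaleR cont continuous_on_const)
  qed auto
  moreover have "blinfun_apply (integral (cbox a b) (fx x)) =
      (\<lambda>h. \<Sum>i\<in>Basis. box_convolution a b (D i) f x * (h \<bullet> i))"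
  proof
    fix h
    have "fx x integrable_on cbox a b"
      unfolding fx_def by (intro integrable_continuous continuous_on_sum continuous_on_scaleR cont1 continuous_on_const)
    then have "blinfun_apply (integral (cbox a b) (fx x)) h = integral (cbox a b) (\<lambda>t. fx x t h)"
      by (rule blinfun_apply_integral)
    also have "\<dots> = integral (cbox a b) (\<lambda>t. \<Sum>i\<in>Basis. (f t * D i (x - t)) * (h \<bullet> i))"
      by (simp add: fx_def blinfun.sum_left blinfun.scaleR_left)
    also have "\<dots> = (\<Sum>i\<in>Basis. integral (cbox a b) (\<lambda>t. (f t * D i (x - t)) * (h \<bullet> i)))"
      by (intro integral_sum integrable_continuous continuous_on_mult cont1 continuous_on_const) auto
    finally show "blinfun_apply (integral (cbox a b) (fx x)) h =
        (\<Sum>i\<in>Basis. box_convolution a b (D i) f x * (h \<bullet> i))"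
      by (simp add: box_convolution_def)
  qed
  ultimately show ?thesis by (simp add: box_convolution_def[abs_def] D_def[abs_def])
qed

lemma Ck_box_convolution:
  assumes "continuous_on UNIV f"
  shows "Ck k \<rho> \<Longrightarrow> Ck k (box_convolution a b \<rho> f)"
proof (induction k arbitrary: \<rho>)
  case 0
  then have \<rho>: "continuous_on UNIV \<rho>" by simp
  show ?case
    unfolding Ck.simps box_convolution_def[abs_def]
    by (intro integral_continuous_on_param, unfold split_beta)
      (intro continuous_intros continuous_on_compose2[OF assms] continuous_on_compose2[OF \<rho>]; auto)
next
  case (Suc k)
  show ?case
  proof (rule Ck_SucI[OF has_derivative_box_convolution[OF Suc.prems assms]])
    fix b' :: 'a assume b: "b' \<in> Basis"
    have "(\<Sum>i\<in>Basis. box_convolution a b (\<lambda>x. frechet_derivative \<rho> (at x) i) f x * (b' \<bullet> i))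
        = box_convolution a b (\<lambda>x. frechet_derivative \<rho> (at x) b') f x" for x
      using b by (simp add: inner_Basis if_distrib cong: if_cong)
    then show "Ck k (\<lambda>x. \<Sum>i\<in>Basis. box_convolution a b (\<lambda>x. frechet_derivative \<rho> (at x) i) f x * (b' \<bullet> i))"
      using Suc.IH[OF Ck_SucD(2)[OF Suc.prems b]] by simp
  qed
qed

lemma grad_box_convolution:
  assumes "Ck (Suc k) \<rho>" "continuous_on UNIV f" "i \<in> Basis"
  shows "grad (box_convolution a b \<rho> f) x \<bullet> i = integral (cbox a b) (\<lambda>y. f y * (grad \<rho> (x - y) \<bullet> i))"
  using frechet_derivative_at[OF has_derivative_box_convolution[OF assms(1,2)], symmetric] assms(3)
  by (simp add: grad_inner_Basis inner_Basis if_distrib box_convolution_def cong: if_cong)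

section \<open>Translations and mollification in \<open>L\<^sup>1\<close>\<close>

lemma
  fixes f :: "'a::euclidean_space \<Rightarrow> 'b::{banach, second_countable_topology}"
  assumes "integrable lborel f"
  shows integrable_lborel_translate: "integrable lborel (\<lambda>x. f (x - h))"
    and integral_lborel_translate: "(LINT x|lborel. f (x - h)) = (LINT x|lborel. f x)"
proof -
  have *: "integrable (distr lborel borel ((+) (- h))) f"
    using assms by (simp add: lborel_distr_plus)
  have m: "(+) (- h) \<in> lborel \<rightarrow>\<^sub>M borel" by simp
  have f: "f \<in> borel_measurable borel" using assms by auto
  show "integrable lborel (\<lambda>x. f (x - h))"
    using integrable_distr[OF m *] by simp
  show "(LINT x|lborel. f (x - h)) = (LINT x|lborel. f x)"
    using integral_distr[OF m f] by (simp add: lborel_distr_plus)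
qed

lemma integral_lborel_reflect:
  fixes f :: "'a::euclidean_space \<Rightarrow> 'b::{banach, second_countable_topology}"
  assumes "f \<in> borel_measurable borel"
  shows "(LINT y|lborel. f (x - y)) = (LINT y|lborel. f y)"
proof -
  have "lborel = distr lborel borel (\<lambda>y. x - y)"
    using lborel_affine[of "-1" x] by (simp add: density_1)
  then have "(LINT y|lborel. f y) = (LINT y|distr lborel borel (\<lambda>y. x - y). f y)" by simp
  also have "\<dots> = (LINT y|lborel. f (x - y))"
    by (rule integral_distr) (use assms in auto)
  finally show ?thesis by simp
qed

subsection \<open>Continuity of translations\<close>

definition translation_modulus ::
  "('a::euclidean_space \<Rightarrow> 'b::{banach, second_countable_topology}) \<Rightarrow> 'a \<Rightarrow> real" where
  "translation_modulus f h = (LINT x|lborel. norm (f (x - h) - f x))"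

lemma translation_modulus_nonneg: "0 \<le> translation_modulus f h"
  by (simp add: translation_modulus_def)

text \<open>\<open>g\<close> is inserted at x - h and at x. By translation invariance both errors
  equal the L^1 distance of \<open>f\<close> and \<open>g\<close>, hence the factor 2.\<close>

lemma translation_modulus_approx:
  assumes f: "integrable lborel f" and g: "integrable lborel g"
  shows "translation_modulus f h \<le> translation_modulus g h + 2 * (LINT x|lborel. norm (f x - g x))"
proof -
  have fg: "integrable lborel (\<lambda>x. norm (f x - g x))" using f g by auto
  have g': "integrable lborel (\<lambda>x. norm (g (x - h) - g x))"
    using integrable_lborel_translate[OF g, of h] g by auto
  have "translation_modulus f h \<le>
      (LINT x|lborel. norm (f (x - h) - g (x - h)) + norm (g (x - h) - g x) + norm (f x - g x))"
    unfolding translation_modulus_def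
  proof (rule integral_mono)
    show "integrable lborel (\<lambda>x. norm (f (x - h) - f x))"
      using integrable_lborel_translate[OF f, of h] f by auto
    show "integrable lborel (\<lambda>x. norm (f (x - h) - g (x - h)) + norm (g (x - h) - g x) + norm (f x - g x))"
      using integrable_lborel_translate[OF fg, of h] fg g' by auto
    show "norm (f (x - h) - f x) \<le> norm (f (x - h) - g (x - h)) + norm (g (x - h) - g x) + norm (f x - g x)" for x
    proof -
      have "f (x - h) - f x = (f (x - h) - g (x - h)) + (g (x - h) - g x) + (g x - f x)" by simp
      then have "norm (f (x - h) - f x) \<le> norm ((f (x - h) - g (x - h)) + (g (x - h) - g x)) + norm (g x - f x)"
        by (metis norm_triangle_ineq)
      also have "\<dots> \<le> norm (f (x - h) - g (x - h)) + norm (g (x - h) - g x) + norm (g x - f x)"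
        using norm_triangle_ineq by (rule add_right_mono)
      finally show ?thesis by (simp add: norm_minus_commute)
    qed
  qed
  also have "\<dots> = translation_modulus g h + 2 * (LINT x|lborel. norm (f x - g x))"
    using integrable_lborel_translate[OF fg, of h] integral_lborel_translate[OF fg, of h] fg g'
    by (simp add: translation_modulus_def)
  finally show ?thesis .
qed

lemma translation_modulus_tendsto_approx:
  fixes f :: "'a::euclidean_space \<Rightarrow> 'b::{banach, second_countable_topology}"
  assumes f: "integrable lborel f"
    and approx: "\<And>e. e > 0 \<Longrightarrow> \<exists>g. integrable lborel g \<and> (LINT x|lborel. norm (f x - g x)) \<le> e \<and>
        (\<lambda>n. translation_modulus g (h n)) \<longlonglongrightarrow> 0"
  shows "(\<lambda>n. translation_modulus f (h n)) \<longlonglongrightarrow> 0"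
proof (rule tendstoI)
  fix e :: real assume "e > 0"
  then obtain g where g: "integrable lborel g" "(LINT x|lborel. norm (f x - g x)) \<le> e / 4"
    "(\<lambda>n. translation_modulus g (h n)) \<longlonglongrightarrow> 0" using approx[of "e / 4"] by auto
  have "eventually (\<lambda>n. dist (translation_modulus g (h n)) 0 < e / 2) sequentially"
    using g(3) \<open>e > 0\<close> by (intro tendstoD) auto
  then show "eventually (\<lambda>n. dist (translation_modulus f (h n)) 0 < e) sequentially"
  proof eventually_elim
    case (elim n)
    then show ?case
      using translation_modulus_approx[OF f g(1), of "h n"] g(2)
        translation_modulus_nonneg[of f "h n"] translation_modulus_nonneg[of g "h n"]
      by (simp add: dist_real_def)
  qed
qed

text \<open>The translates move, so the difference is not dominated directly. Expanding it leaves
  twice the measure of \<open>U\<close> minus twice the integral of the product of the two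
  indicators; this product is dominated by the fixed indicator, and it converges at each point of
  \<open>U\<close> because \<open>U\<close> is open.\<close>

lemma translation_modulus_indicator_open:
  fixes U :: "'a::euclidean_space set"
  assumes U: "open U" "emeasure lborel U < \<infinity>" and h: "h \<longlonglongrightarrow> 0"
  shows "(\<lambda>n. translation_modulus (indicator U :: 'a \<Rightarrow> real) (h n)) \<longlonglongrightarrow> 0"
proof -
  let ?i = "indicator U :: 'a \<Rightarrow> real"
  have Ub: "U \<in> sets borel" using U(1) by auto
  have int: "integrable lborel ?i" using U by (simp add: integrable_indicator_iff)
  have "(\<lambda>n. LINT x|lborel. ?i x * ?i (x - h n)) \<longlonglongrightarrow> (LINT x|lborel. ?i x)"
  proof (rule integral_dominated_convergence[OF _ _ int])
    show "?i \<in> borel_measurable lborel" using Ub by auto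
    show "(\<lambda>x. ?i x * ?i (x - h n)) \<in> borel_measurable lborel" for n using Ub by measurable
    show "AE x in lborel. norm (?i x * ?i (x - h n)) \<le> ?i x" for n
      by (auto simp: indicator_def)
    show "AE x in lborel. (\<lambda>n. ?i x * ?i (x - h n)) \<longlonglongrightarrow> ?i x"
    proof (rule AE_I2)
      fix x
      show "(\<lambda>n. ?i x * ?i (x - h n)) \<longlonglongrightarrow> ?i x"
      proof (cases "x \<in> U")
        case True
        have "(\<lambda>n. x - h n) \<longlonglongrightarrow> x - 0" by (intro tendsto_intros h)
        then have "eventually (\<lambda>n. x - h n \<in> U) sequentially"
          using U(1) True by (intro topological_tendstoD) auto
        then have "eventually (\<lambda>n. ?i x * ?i (x - h n) = ?i x) sequentially"
          by eventually_elim (auto simp: indicator_def)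
        then show ?thesis by (rule tendsto_eventually)
      qed auto
    qed
  qed
  then have "(\<lambda>n. 2 * (LINT x|lborel. ?i x) - 2 * (LINT x|lborel. ?i x * ?i (x - h n)))
      \<longlonglongrightarrow> 2 * (LINT x|lborel. ?i x) - 2 * (LINT x|lborel. ?i x)"
    by (intro tendsto_intros)
  moreover have "translation_modulus ?i h =
      2 * (LINT x|lborel. ?i x) - 2 * (LINT x|lborel. ?i x * ?i (x - h))" for h
  proof -
    have i: "integrable lborel (\<lambda>x. ?i x * ?i (x - h))"
      by (rule Bochner_Integration.integrable_bound[OF int]) (use Ub in \<open>auto simp: indicator_def\<close>)
    have "norm (?i (x - h) - ?i x) = ?i (x - h) + ?i x - 2 * (?i x * ?i (x - h))" for x
      by (auto simp: indicator_def)
    then show ?thesis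
      using integrable_lborel_translate[OF int, of h] integral_lborel_translate[OF int, of h] int i
      by (simp add: translation_modulus_def)
  qed
  ultimately show ?thesis by simp
qed

text \<open>Outer regularity passes from open sets to Borel sets of finite measure, and
  \<open>integrable_induct\<close> from there to all integrable functions, its limit step being an
  L^1 approximation.\<close>

lemma translation_modulus_tendsto_0:
  fixes f :: "'a::euclidean_space \<Rightarrow> 'b::{banach, second_countable_topology}"
  assumes "integrable lborel f" and h: "h \<longlonglongrightarrow> 0"
  shows "(\<lambda>n. translation_modulus f (h n)) \<longlonglongrightarrow> 0"
  using assms(1)
proof (induction rule: integrable_induct)
  case (base A c)
  have A: "A \<in> sets borel" using base by simp
  have intA: "integrable lborel (\<lambda>x. indicator A x *\<^sub>R c)"
    using base by (intro integrable_scaleR_left) (simp add: integrable_indicator_iff)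
  show ?case
  proof (rule translation_modulus_tendsto_approx[OF intA])
    fix e :: real assume "e > 0"
    \<comment> \<open>The summand 1 keeps the division meaningful for c = 0.\<close>
    define e' where "e' = e / (norm c + 1)"
    have nc: "norm c + 1 > 0" by (simp add: add_nonneg_pos)
    have e': "e' > 0" using \<open>e > 0\<close> nc by (simp add: e'_def)
    obtain U where U: "open U" "A \<subseteq> U" "emeasure lborel (U - A) \<le> e'"
      using outer_regular_lborel_le[OF A e'] by blast
    have Ub: "U \<in> sets borel" using U(1) by auto
    have "emeasure lborel U = emeasure lborel A + emeasure lborel (U - A)"
      using A Ub U(2) plus_emeasure[of A lborel "U - A"] by (simp add: Un_absorb1)
    then have fin: "emeasure lborel U < \<infinity>"
      using base U(3) by (auto simp: less_top[symmetric] top_unique)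
    have finD: "emeasure lborel (U - A) < \<infinity>" using U(3) by (auto simp: less_top[symmetric] top_unique)
    have intU: "integrable lborel (\<lambda>x. indicator U x *\<^sub>R c)"
      using fin Ub by (intro integrable_scaleR_left) (simp add: integrable_indicator_iff)
    show "\<exists>g. integrable lborel g \<and> (LINT x|lborel. norm (indicator A x *\<^sub>R c - g x)) \<le> e \<and>
        (\<lambda>n. translation_modulus g (h n)) \<longlonglongrightarrow> 0"
    proof (intro exI conjI, rule intU)
      have "norm (indicator A x *\<^sub>R c - indicator U x *\<^sub>R c) = norm c * indicator (U - A) x" for x
        using U(2) by (auto simp: indicator_def)
      then have "(LINT x|lborel. norm (indicator A x *\<^sub>R c - indicator U x *\<^sub>R c)) =
          norm c * measure lborel (U - A)" by simp
      also have "measure lborel (U - A) \<le> e'"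
        unfolding measure_def using U(3) e' by (metis enn2real_ennreal enn2real_mono ennreal_less_top less_imp_le)
      then have "norm c * measure lborel (U - A) \<le> norm c * e'" by (simp add: mult_left_mono)
      also have "\<dots> \<le> e" using nc \<open>e > 0\<close> by (simp add: e'_def field_simps)
      finally show "(LINT x|lborel. norm (indicator A x *\<^sub>R c - indicator U x *\<^sub>R c)) \<le> e" .
      have "translation_modulus (\<lambda>x. indicator U x *\<^sub>R c) h =
          translation_modulus (indicator U :: 'a \<Rightarrow> real) h * norm c" for h
        by (simp add: translation_modulus_def scaleR_diff_left[symmetric])
      then show "(\<lambda>n. translation_modulus (\<lambda>x. indicator U x *\<^sub>R c) (h n)) \<longlonglongrightarrow> 0"
        using tendsto_mult_left_zero[OF translation_modulus_indicator_open[OF U(1) fin h], of "norm c"] by simp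
    qed
  qed
next
  case (add f g)
  have *: "translation_modulus (\<lambda>x. f x + g x) h \<le> translation_modulus f h + translation_modulus g h" for h
  proof -
    have fg: "integrable lborel (\<lambda>x. f (x - h))" "integrable lborel (\<lambda>x. g (x - h))"
      using add by (auto intro: integrable_lborel_translate)
    have "translation_modulus (\<lambda>x. f x + g x) h \<le>
        (LINT x|lborel. norm (f (x - h) - f x) + norm (g (x - h) - g x))"
      unfolding translation_modulus_def
    proof (rule integral_mono)
      show "norm (f (x - h) + g (x - h) - (f x + g x)) \<le> norm (f (x - h) - f x) + norm (g (x - h) - g x)" for x
        using norm_triangle_ineq[of "f (x - h) - f x" "g (x - h) - g x"] by (simp add: algebra_simps)
    qed (use add fg in auto)
    also have "\<dots> = translation_modulus f h + translation_modulus g h"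
      unfolding translation_modulus_def using add fg by (intro Bochner_Integration.integral_add) auto
    finally show ?thesis .
  qed
  have "(\<lambda>n. translation_modulus f (h n) + translation_modulus g (h n)) \<longlonglongrightarrow> 0 + 0"
    using add by (intro tendsto_add)
  then have lim: "(\<lambda>n. translation_modulus f (h n) + translation_modulus g (h n)) \<longlonglongrightarrow> 0" by simp
  have "norm (translation_modulus (\<lambda>x. f x + g x) (h n)) \<le>
      translation_modulus f (h n) + translation_modulus g (h n)" for n
    using *[of "h n"] translation_modulus_nonneg[of "\<lambda>x. f x + g x" "h n"] by simp
  then show ?case
    by (intro Lim_null_comparison[OF _ lim] always_eventually) blast
next
  case (lim f s)
  show ?case
  proof (rule translation_modulus_tendsto_approx[OF lim.hyps(4)])
    fix e :: real assume "e > 0"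
    have "(\<lambda>i. LINT x|lborel. norm (f x - s i x)) \<longlonglongrightarrow> (LINT x|(lborel :: 'a measure). 0)"
    proof (rule integral_dominated_convergence)
      \<comment> \<open>The approximants satisfy \<open>norm (s i x) \<le> 2 * norm (f x)\<close>,
        hence the factor 3.\<close>
      show "integrable lborel (\<lambda>x. 3 * norm (f x))" using lim by simp
      show "AE x in lborel. norm (norm (f x - s i x)) \<le> 3 * norm (f x)" for i
      proof (rule AE_I2)
        fix x :: 'a assume "x \<in> space lborel"
        then show "norm (norm (f x - s i x)) \<le> 3 * norm (f x)"
          using lim.hyps(3)[of x i] norm_triangle_ineq4[of "f x" "s i x"] by simp
      qed
      show "AE x in lborel. (\<lambda>i. norm (f x - s i x)) \<longlonglongrightarrow> 0"
      proof (rule AE_I2)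
        fix x :: 'a assume "x \<in> space lborel"
        then have "(\<lambda>i. norm (f x - s i x)) \<longlonglongrightarrow> norm (f x - f x)"
          using lim.hyps(2)[of x] by (intro tendsto_intros)
        then show "(\<lambda>i. norm (f x - s i x)) \<longlonglongrightarrow> 0" by simp
      qed
    qed (use lim in auto)
    then have "eventually (\<lambda>i. dist (LINT x|lborel. norm (f x - s i x)) 0 < e) sequentially"
      using \<open>e > 0\<close> by (intro tendstoD) auto
    then obtain i where "dist (LINT x|lborel. norm (f x - s i x)) 0 < e"
      by (auto simp: eventually_sequentially)
    then show "\<exists>g. integrable lborel g \<and> (LINT x|lborel. norm (f x - g x)) \<le> e \<and>
        (\<lambda>n. translation_modulus g (h n)) \<longlonglongrightarrow> 0"
      using lim by (intro exI[of _ "s i"]) (auto simp: dist_real_def)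
  qed
qed

text \<open>Continuity of \<open>u\<close> is asked at 0 only, and integrability only of its
  products with the kernels, since these are the facts available for
  \<open>correlation\<close>.\<close>

lemma mollifier_tendsto:
  fixes u :: "'a::euclidean_space \<Rightarrow> real"
  assumes \<rho>: "\<And>n. integrable lborel (\<rho> n)" "\<And>n h. 0 \<le> \<rho> n h" "\<And>n. (LINT h|lborel. \<rho> n h) = 1"
    and supp: "\<And>d. d > 0 \<Longrightarrow> eventually (\<lambda>n. \<forall>h. \<rho> n h \<noteq> 0 \<longrightarrow> norm h < d) sequentially"
    and int: "\<And>n. integrable lborel (\<lambda>h. \<rho> n h * u h)" and cont: "isCont u 0"
  shows "(\<lambda>n. LINT h|lborel. \<rho> n h * u h) \<longlonglongrightarrow> u 0"
proof (rule tendstoI)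
  fix e :: real assume e: "e > 0"
  obtain d where d: "d > 0" "\<And>h. norm h < d \<Longrightarrow> \<bar>u h - u 0\<bar> < e / 2"
    using cont e unfolding continuous_at_eps_delta
    by (auto simp: dist_norm dest!: spec[of _ "e / 2"])
  from supp[OF d(1)]
  show "eventually (\<lambda>n. dist (LINT h|lborel. \<rho> n h * u h) (u 0) < e) sequentially"
  proof eventually_elim
    case (elim n)
    have i: "integrable lborel (\<lambda>h. \<rho> n h * u h - \<rho> n h * u 0)"
      using int \<rho>(1) by simp
    have "(LINT h|lborel. \<rho> n h * u h) - u 0 = (LINT h|lborel. \<rho> n h * u h - \<rho> n h * u 0)"
      using int \<rho>(1,3) by simp
    also have "norm \<dots> \<le> (LINT h|lborel. \<rho> n h * (e / 2))"
    proof (rule Bochner_Integration.integral_norm_bound_integral[OF i])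
      show "norm (\<rho> n h * u h - \<rho> n h * u 0) \<le> \<rho> n h * (e / 2)" for h
      proof (cases "\<rho> n h = 0")
        case False
        then have "\<bar>u h - u 0\<bar> \<le> e / 2" using d(2)[of h] elim by force
        then have "\<rho> n h * \<bar>u h - u 0\<bar> \<le> \<rho> n h * (e / 2)"
          using \<rho>(2) by (rule mult_left_mono)
        then show ?thesis using \<rho>(2)[of n h] by (simp add: abs_mult right_diff_distrib[symmetric])
      qed simp
    qed (use \<rho>(1) in auto)
    also have "\<dots> = e / 2" using \<rho>(3) by simp
    finally show ?case using e by (simp add: dist_real_def)
  qed
qed

subsection \<open>Mollification of a duality pairing\<close>

text \<open>The bound holds at every pair of points, so it can be used at y = x - h for each shift h
  without tracking null sets. Later \<open>H\<close> is a Borel version of \<psi> F and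
  \<open>G\<close> one of the weak gradient cut off to a compact set, which is why both are
  integrable whatever the exponent is.\<close>

locale paired_fields =
  fixes H G :: "'a::euclidean_space \<Rightarrow> 'a" and A B :: "'a \<Rightarrow> real"
  assumes H: "integrable lborel H" and G: "integrable lborel G"
    and A: "integrable lborel A" and B: "integrable lborel B"
    and bound: "\<And>x y. norm (H x) * norm (G y) \<le> A x + B y"
begin

definition correlation :: "'a \<Rightarrow> real" where
  "correlation h = (LINT x|lborel. H x \<bullet> G (x - h))"

lemma meas [measurable]:
  "H \<in> borel_measurable borel" "G \<in> borel_measurable borel"
  "A \<in> borel_measurable borel" "B \<in> borel_measurable borel"
  using H G A B by auto

lemma integrable_pairing: "integrable lborel (\<lambda>x. H x \<bullet> G (x - h))"
proof (rule Bochner_Integration.integrable_bound)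
  show "integrable lborel (\<lambda>x. A x + B (x - h))"
    using A integrable_lborel_translate[OF B] by simp
  show "AE x in lborel. norm (H x \<bullet> G (x - h)) \<le> norm (A x + B (x - h))"
  proof (rule AE_I2)
    fix x
    show "norm (H x \<bullet> G (x - h)) \<le> norm (A x + B (x - h))"
      using bound[of x "x - h"] Cauchy_Schwarz_ineq2[of "H x" "G (x - h)"] by simp
  qed
qed measurable

text \<open>Split according to whether \<open>\<bar>H\<bar> \<le> N\<close>; on the remaining set the bound \<open>A x + B y\<close> has a
  small integral, so that no continuity of translations in \<open>L\<^sup>p\<close> for \<open>p > 1\<close> is needed.\<close>

lemma correlation_diff_le:
  assumes "N \<ge> 0"
  shows "\<bar>correlation h - correlation 0\<bar> \<le> N * translation_modulus G h + translation_modulus B h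
    + (LINT x|lborel. indicator {x. norm (H x) > N} x * (2 * A x + 2 * B x))"
proof -
  have Gh: "integrable lborel (\<lambda>x. norm (G (x - h) - G x))"
    using G integrable_lborel_translate[OF G, of h] by auto
  have Bh: "integrable lborel (\<lambda>x. norm (B (x - h) - B x))"
    using B integrable_lborel_translate[OF B, of h] by auto
  have AB: "integrable lborel (\<lambda>x. indicator {x. norm (H x) > N} x * (2 * A x + 2 * B x))"
  proof -
    have "{x. norm (H x) > N} \<in> sets lborel" by measurable
    from integrable_mult_indicator[OF this, of "\<lambda>x. 2 * A x + 2 * B x"] show ?thesis
      using A B by simp
  qed
  have "correlation h - correlation 0 = (LINT x|lborel. H x \<bullet> G (x - h) - H x \<bullet> G x)"
    using integrable_pairing[of h] integrable_pairing[of 0] by (simp add: correlation_def)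
  also have "norm \<dots> \<le> (LINT x|lborel. N * norm (G (x - h) - G x) + norm (B (x - h) - B x)
      + indicator {x. norm (H x) > N} x * (2 * A x + 2 * B x))"
  proof (rule Bochner_Integration.integral_norm_bound_integral)
    show "integrable lborel (\<lambda>x. H x \<bullet> G (x - h) - H x \<bullet> G x)"
      using integrable_pairing[of h] integrable_pairing[of 0] by simp
    show "integrable lborel (\<lambda>x. N * norm (G (x - h) - G x) + norm (B (x - h) - B x)
        + indicator {x. norm (H x) > N} x * (2 * A x + 2 * B x))"
      using Gh Bh AB by simp
    show "norm (H x \<bullet> G (x - h) - H x \<bullet> G x) \<le> N * norm (G (x - h) - G x) + norm (B (x - h) - B x)
        + indicator {x. norm (H x) > N} x * (2 * A x + 2 * B x)" for x
    proof -
      have "norm (H x \<bullet> G (x - h) - H x \<bullet> G x) \<le> norm (H x) * norm (G (x - h) - G x)"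
        using Cauchy_Schwarz_ineq2[of "H x" "G (x - h) - G x"] by (simp add: inner_diff_right)
      also have "\<dots> \<le> N * norm (G (x - h) - G x) + norm (B (x - h) - B x)
          + indicator {x. norm (H x) > N} x * (2 * A x + 2 * B x)"
      proof (cases "norm (H x) > N")
        case False
        then have "norm (H x) * norm (G (x - h) - G x) \<le> N * norm (G (x - h) - G x)"
          by (intro mult_right_mono) auto
        then show ?thesis using False by (simp add: add_increasing2)
      next
        case True
        have "norm (H x) * norm (G (x - h) - G x) \<le> norm (H x) * (norm (G (x - h)) + norm (G x))"
          by (intro mult_left_mono norm_triangle_ineq4) auto
        \<comment> \<open>The bound at y = x - h produces \<open>B (x - h)\<close>. Writing it as
          \<open>B x\<close> plus a difference leaves a tail term that does not depend on h, at the
          price of the translation modulus of \<open>B\<close>.\<close>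
        also have "\<dots> \<le> 2 * A x + 2 * B x + norm (B (x - h) - B x)"
          using bound[of x "x - h"] bound[of x x] by (simp add: distrib_left)
        also have "\<dots> \<le> N * norm (G (x - h) - G x) + norm (B (x - h) - B x) + (2 * A x + 2 * B x)"
          using assms by simp
        finally show ?thesis using True by simp
      qed
      finally show ?thesis .
    qed
  qed
  also have "\<dots> = N * translation_modulus G h + translation_modulus B h
      + (LINT x|lborel. indicator {x. norm (H x) > N} x * (2 * A x + 2 * B x))"
    using Gh Bh AB by (simp add: translation_modulus_def)
  finally show ?thesis by simp
qed

lemma isCont_correlation: "isCont correlation 0"
  unfolding continuous_at_sequentially comp_def
proof (intro allI impI)
  fix h :: "nat \<Rightarrow> 'a" assume h: "h \<longlonglongrightarrow> 0"
  show "(\<lambda>n. correlation (h n)) \<longlonglongrightarrow> correlation 0"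
  proof (rule tendstoI)
    fix e :: real assume e: "e > 0"
    \<comment> \<open>The level N is fixed before h becomes small, because it multiplies the
      translation modulus of \<open>G\<close>.\<close>
    have "(\<lambda>N. LINT x|lborel. indicator {x. norm (H x) > real N} x * (2 * A x + 2 * B x))
        \<longlonglongrightarrow> (LINT x|(lborel::'a measure). 0)"
    proof (rule integral_dominated_convergence)
      show "integrable lborel (\<lambda>x. norm (2 * A x + 2 * B x))" using A B by simp
      show "AE x in lborel. norm (indicator {x. norm (H x) > real N} x * (2 * A x + 2 * B x))
          \<le> norm (2 * A x + 2 * B x)" for N
        by (auto simp: indicator_def)
      show "AE x in lborel. (\<lambda>N. indicator {x. norm (H x) > real N} x * (2 * A x + 2 * B x)) \<longlonglongrightarrow> 0"
      proof (rule AE_I2)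
        fix x
        obtain N0 where "norm (H x) < real N0" using reals_Archimedean2 by blast
        then have "eventually (\<lambda>N. indicator {x. norm (H x) > real N} x * (2 * A x + 2 * B x) = 0) sequentially"
          by (auto simp: eventually_sequentially intro!: exI[of _ N0])
        then show "(\<lambda>N. indicator {x. norm (H x) > real N} x * (2 * A x + 2 * B x)) \<longlonglongrightarrow> 0"
          by (rule tendsto_eventually)
      qed
    qed auto
    then have "eventually (\<lambda>N. dist (LINT x|lborel. indicator {x. norm (H x) > real N} x * (2 * A x + 2 * B x)) 0 < e / 2) sequentially"
      using e by (intro tendstoD) auto
    then obtain N where "dist (LINT x|lborel. indicator {x. norm (H x) > real N} x * (2 * A x + 2 * B x)) 0 < e / 2"
      by (auto simp: eventually_sequentially)
    then have N: "(LINT x|lborel. indicator {x. norm (H x) > real N} x * (2 * A x + 2 * B x)) < e / 2"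
      by (simp add: dist_real_def)
    have "(\<lambda>n. real N * translation_modulus G (h n) + translation_modulus B (h n)) \<longlonglongrightarrow> real N * 0 + 0"
      by (intro tendsto_intros translation_modulus_tendsto_0 G B h)
    then have "eventually (\<lambda>n. dist (real N * translation_modulus G (h n) + translation_modulus B (h n)) 0 < e / 2) sequentially"
      using e by (intro tendstoD) auto
    then show "eventually (\<lambda>n. dist (correlation (h n)) (correlation 0) < e) sequentially"
    proof eventually_elim
      case (elim n)
      then show ?case
        using correlation_diff_le[of "real N" "h n"] N unfolding dist_real_def by linarith
    qed
  qed
qed

text \<open>Fubini applies since, by translation invariance, the integral of
  \<open>A x + B (x - h)\<close> over x is the same for every h; the inner integral of the norm is
  therefore at most a constant multiple of \<open>\<rho> h\<close>.\<close>

lemma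
  assumes \<rho>: "integrable lborel \<rho>" "\<And>h. 0 \<le> \<rho> h"
  shows integrable_mollified_pairing:
      "integrable lborel (\<lambda>x. LINT h|lborel. \<rho> h * (H x \<bullet> G (x - h)))"
    and integrable_mult_correlation: "integrable lborel (\<lambda>h. \<rho> h * correlation h)"
    and integral_mollified_pairing:
      "(LINT x|lborel. LINT h|lborel. \<rho> h * (H x \<bullet> G (x - h))) = (LINT h|lborel. \<rho> h * correlation h)"
proof -
  have [measurable]: "\<rho> \<in> borel_measurable borel" using \<rho> by auto
  let ?f = "\<lambda>(h, x). \<rho> h * (H x \<bullet> G (x - h))"
  have meas: "?f \<in> borel_measurable (lborel \<Otimes>\<^sub>M lborel)" by measurable
  have f: "integrable (lborel \<Otimes>\<^sub>M lborel) ?f"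
  proof (rule lborel_pair.Fubini_integrable[OF meas])
    show "AE h in lborel. integrable lborel (\<lambda>x. ?f (h, x))"
      using integrable_pairing by auto
    show "integrable lborel (\<lambda>h. LINT x|lborel. norm (?f (h, x)))"
    proof (rule Bochner_Integration.integrable_bound)
      show "integrable lborel (\<lambda>h. \<rho> h * ((LINT x|lborel. A x) + (LINT x|lborel. B x)))"
        using \<rho> by simp
      show "(\<lambda>h. LINT x|lborel. norm (?f (h, x))) \<in> borel_measurable lborel"
        by (intro lborel.borel_measurable_lebesgue_integral) (use meas in measurable)
      show "AE h in lborel. norm (LINT x|lborel. norm (?f (h, x))) \<le>
          norm (\<rho> h * ((LINT x|lborel. A x) + (LINT x|lborel. B x)))"
      proof (rule AE_I2)
        fix h
        have "(LINT x|lborel. norm (?f (h, x))) \<le> (LINT x|lborel. \<rho> h * (A x + B (x - h)))"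
        proof (rule integral_mono)
          show "norm (?f (h, x)) \<le> \<rho> h * (A x + B (x - h))" for x
            using bound[of x "x - h"] Cauchy_Schwarz_ineq2[of "H x" "G (x - h)"] \<rho>(2)[of h]
            by (auto simp: abs_mult intro!: mult_left_mono)
        qed (use integrable_pairing A integrable_lborel_translate[OF B] in auto)
        also have "\<dots> = \<rho> h * ((LINT x|lborel. A x) + (LINT x|lborel. B x))"
          using A integrable_lborel_translate[OF B] integral_lborel_translate[OF B] by simp
        finally show "norm (LINT x|lborel. norm (?f (h, x))) \<le>
            norm (\<rho> h * ((LINT x|lborel. A x) + (LINT x|lborel. B x)))" by simp
      qed
    qed
  qed
  show "integrable lborel (\<lambda>x. LINT h|lborel. \<rho> h * (H x \<bullet> G (x - h)))"
    using lborel_pair.integrable_snd[OF f] by simp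
  show "integrable lborel (\<lambda>h. \<rho> h * correlation h)"
    using lborel_pair.integrable_fst[OF f] by (simp add: correlation_def)
  show "(LINT x|lborel. LINT h|lborel. \<rho> h * (H x \<bullet> G (x - h))) = (LINT h|lborel. \<rho> h * correlation h)"
    using lborel_pair.Fubini_integral[OF f] by (simp add: correlation_def)
qed

lemma mollified_pairing_tendsto:
  assumes \<rho>: "\<And>n. integrable lborel (\<rho> n)" "\<And>n h. 0 \<le> \<rho> n h" "\<And>n. (LINT h|lborel. \<rho> n h) = 1"
    and supp: "\<And>d. d > 0 \<Longrightarrow> eventually (\<lambda>n. \<forall>h. \<rho> n h \<noteq> 0 \<longrightarrow> norm h < d) sequentially"
  shows "(\<lambda>n. LINT x|lborel. LINT h|lborel. \<rho> n h * (H x \<bullet> G (x - h))) \<longlonglongrightarrow> (LINT x|lborel. H x \<bullet> G x)"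
  using mollifier_tendsto[OF \<rho> supp integrable_mult_correlation[OF \<rho>(1,2)] isCont_correlation]
  by (simp add: integral_mollified_pairing[OF \<rho>(1,2)]) (simp add: correlation_def)

end

section \<open>Uniqueness and weighted sums of real measures\<close>

lemma real_measure_integral_tendsto:
  fixes f :: "'a::euclidean_space \<Rightarrow> real"
  assumes "real_radon_measure \<Omega> \<nu>" "\<Omega> \<in> sets borel"
    and f: "f \<in> borel_measurable (restrict_space borel \<Omega>)"
    and s: "\<And>n. s n \<in> borel_measurable (restrict_space borel \<Omega>)"
    and bd: "\<And>n x. x \<in> \<Omega> \<Longrightarrow> \<bar>s n x\<bar> \<le> C"
    and lim: "\<And>x. x \<in> \<Omega> \<Longrightarrow> (\<lambda>n. s n x) \<longlonglongrightarrow> f x"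
  shows "(\<lambda>n. real_measure_integral \<Omega> \<nu> (s n)) \<longlonglongrightarrow> real_measure_integral \<Omega> \<nu> f"
proof -
  have *: "(\<lambda>n. LINT x|pos_variation \<Omega> \<mu>. s n x) \<longlonglongrightarrow> (LINT x|pos_variation \<Omega> \<mu>. f x)"
    if \<mu>: "real_radon_measure \<Omega> \<mu>" for \<mu>
  proof (rule integral_dominated_convergence)
    show "integrable (pos_variation \<Omega> \<mu>) (\<lambda>_. C)"
      by (rule integrable_pos_variation[OF \<mu> assms(2), of _ "\<bar>C\<bar>"]) auto
    show "f \<in> borel_measurable (pos_variation \<Omega> \<mu>)" "s n \<in> borel_measurable (pos_variation \<Omega> \<mu>)" for n
      using f s assms(2) by (auto simp: borel_measurable_pos_variation)
  qed (use bd lim assms(2) in \<open>auto intro!: AE_I2\<close>)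
  show ?thesis
    unfolding real_measure_integral_def
    by (intro tendsto_diff * real_radon_measure_uminus assms(1))
qed

section \<open>Test functions determine real measures\<close>

lemma continuous_on_imp_measurable_restrict:
  "continuous_on UNIV f \<Longrightarrow> f \<in> borel_measurable (restrict_space borel \<Omega>)"
  by (intro measurable_restrict_space1 borel_measurable_continuous_onI)

lemma test_functions_Ck: "\<psi> \<in> test_functions \<Omega> \<Longrightarrow> Ck k \<psi>"
  by (simp add: test_functions_def)

lemma test_functions_measurable:
  "\<psi> \<in> test_functions \<Omega> \<Longrightarrow> \<psi> \<in> borel_measurable (restrict_space borel \<Omega>')"
  by (intro continuous_on_imp_measurable_restrict Ck_imp_continuous_on test_functions_Ck)

text \<open>The closed boxes are required to lie in \<open>U\<close> as well: finite unions of them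
  will be the compact sets that contain the supports of the test functions.\<close>

lemma open_eq_UN_box:
  fixes U :: "'a::euclidean_space set"
  assumes "open U"
  obtains a b :: "nat \<Rightarrow> 'a" where "\<And>j. cbox (a j) (b j) \<subseteq> U" "U = (\<Union>j. box (a j) (b j))"
proof (cases "U = {}")
  case True
  \<comment> \<open>The sequences have to be total, so an empty \<open>U\<close> is covered by boxes
    that are themselves empty; \<open>from_nat_into\<close> enumerates only nonempty
    families.\<close>
  have "cbox One (0::'a) = {}" "box One (0::'a) = {}"
    unfolding box_eq_empty by (auto intro: SOME_Basis)
  then have "cbox One 0 \<subseteq> U" "U = (\<Union>j::nat. box One 0)"
    using True by auto
  then show ?thesis by (rule that[of "\<lambda>_. One" "\<lambda>_. 0"])
next
  case False
  define \<F> where "\<F> = {box a b |a b. cbox a b \<subseteq> U}"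
  obtain \<F>' where F': "\<F>' \<subseteq> \<F>" "countable \<F>'" "\<Union>\<F>' = \<Union>\<F>"
    using Lindelof[of \<F>] by (auto simp: \<F>_def)
  have "\<Union>\<F> = U"
  proof
    show "\<Union>\<F> \<subseteq> U" using box_subset_cbox by (fastforce simp: \<F>_def)
    show "U \<subseteq> \<Union>\<F>"
    proof
      fix x assume "x \<in> U"
      obtain a b where "cbox a b \<subseteq> U" "x \<in> box a b"
        using open_contains_cbox[OF assms \<open>x \<in> U\<close>] by metis
      then show "x \<in> \<Union>\<F>" by (auto simp: \<F>_def)
    qed
  qed
  then have "\<F>' \<noteq> {}" using F' False by auto
  then have r: "range (from_nat_into \<F>') = \<F>'" using F'(2) by (rule range_from_nat_into)
  have "\<forall>j. \<exists>a b. from_nat_into \<F>' j = box a b \<and> cbox a b \<subseteq> U"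
    using r F'(1) unfolding \<F>_def by blast
  then obtain a b where ab: "\<And>j. from_nat_into \<F>' j = box (a j) (b j)" "\<And>j. cbox (a j) (b j) \<subseteq> U"
    by metis
  have "U = (\<Union>j. box (a j) (b j))"
    using r F'(3) \<open>\<Union>\<F> = U\<close> ab(1) by (metis (no_types, lifting) image_cong)
  then show ?thesis using ab(2) that by blast
qed

lemma open_indicator_test_function_limit:
  fixes U :: "'a::euclidean_space set"
  assumes "open U"
  obtains s where "\<And>n. s n \<in> test_functions U" "\<And>n x. 0 \<le> s n x" "\<And>n x. s n x \<le> 1"
    "\<And>x. (\<lambda>n. s n x) \<longlonglongrightarrow> indicator U x"
proof -
  obtain a b :: "nat \<Rightarrow> 'a" where ab: "\<And>j. cbox (a j) (b j) \<subseteq> U" "U = (\<Union>j. box (a j) (b j))"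
    using open_eq_UN_box[OF assms] by metis
  \<comment> \<open>The sharpness of the bumps and the number of boxes used in \<open>s n\<close>
    grow with the same n; \<open>Suc\<close> keeps the sharpness positive.\<close>
  define g where "g n j = box_bump (real (Suc n)) (a j) (b j)" for n j
  have g: "0 \<le> g n j x" "g n j x \<le> 1" for n j x by (auto simp: g_def box_bump_bounds)
  \<comment> \<open>A smooth substitute for the maximum of the first n bumps: it stays in [0, 1],
    dominates each of them, and vanishes where all of them do. The form \<open>+ (- 1) *\<close>
    lets \<open>Ck_add\<close> and \<open>Ck_mult\<close> apply as they stand.\<close>
  define s where "s n x = 1 + (- 1) * (\<Prod>j<n. 1 + (- 1) * g n j x)" for n x
  have pb: "0 \<le> (\<Prod>j<n. 1 + (- 1) * g n j x)" "(\<Prod>j<n. 1 + (- 1) * g n j x) \<le> 1" for n x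
    using g by (auto intro!: prod_nonneg prod_le_1)
  show ?thesis
  proof
    show "0 \<le> s n x" "s n x \<le> 1" for n x using pb[of n x] by (auto simp: s_def)
    show "s n \<in> test_functions U" for n
    proof -
      let ?T = "\<Union>j<n. cbox (a j) (b j)"
      have "{x. s n x \<noteq> 0} \<subseteq> ?T"
      proof
        fix x assume x: "x \<in> {x. s n x \<noteq> 0}"
        show "x \<in> ?T"
        proof (rule ccontr)
          assume "x \<notin> ?T"
          then have "g n j x = 0" if "j < n" for j
            using that box_bump_neq_0_iff[of "real (Suc n)" "a j" "b j" x] box_subset_cbox[of "a j" "b j"]
            by (auto simp: g_def)
          then show False using x by (simp add: s_def)
        qed
      qed
      moreover have T: "compact ?T" by (intro compact_UN) auto
      ultimately have cl: "closure {x. s n x \<noteq> 0} \<subseteq> ?T"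
        by (intro closure_minimal compact_imp_closed)
      moreover have "compact (closure {x. s n x \<noteq> 0})"
        using cl T by (metis closed_closure compact_Int_closed inf.absorb_iff2)
      moreover have "?T \<subseteq> U" using ab(1) by blast
      moreover have "Ck k (s n)" for k
        unfolding s_def[abs_def] g_def by (intro Ck_add Ck_mult Ck_const Ck_prod Ck_box_bump)
      ultimately show ?thesis by (auto simp: test_functions_def)
    qed
    show "(\<lambda>n. s n x) \<longlonglongrightarrow> indicator U x" for x
    proof (cases "x \<in> U")
      case True
      then obtain j where j: "x \<in> box (a j) (b j)" using ab(2) by auto
      have le: "g n j x \<le> s n x" if "j < n" for n
      proof -
        have "(\<Prod>j<n. 1 + (- 1) * g n j x) = (1 + (- 1) * g n j x) * (\<Prod>i\<in>{..<n} - {j}. 1 + (- 1) * g n i x)"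
          using that by (intro prod.remove) auto
        also have "\<dots> \<le> (1 + (- 1) * g n j x) * 1"
          using g by (intro mult_left_mono prod_le_1) auto
        finally show ?thesis by (simp add: s_def)
      qed
      have "(\<lambda>n. g n j x) \<longlonglongrightarrow> indicator (box (a j) (b j)) x"
        unfolding g_def by (rule box_bump_tendsto_indicator)
      then have "(\<lambda>n. g n j x) \<longlonglongrightarrow> 1" using j by simp
      moreover have "eventually (\<lambda>n. g n j x \<le> s n x) sequentially"
        using le by (auto simp: eventually_sequentially intro!: exI[of _ "Suc j"])
      moreover have "eventually (\<lambda>n. s n x \<le> 1) sequentially"
        using pb[of _ x] by (auto simp: s_def)
      ultimately show ?thesis using True tendsto_sandwich[OF _ _ _ tendsto_const] by fastforce
    next
      case False
      then have "x \<notin> box (a j) (b j)" for j using ab(2) by auto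
      then have "g n j x = 0" for n j
        using box_bump_neq_0_iff[of "real (Suc n)" "a j" "b j" x] by (auto simp: g_def)
      then show ?thesis using False by (simp add: s_def)
    qed
  qed
qed

lemma test_functions_mono: "U \<subseteq> \<Omega> \<Longrightarrow> test_functions U \<subseteq> test_functions \<Omega>"
  by (auto simp: test_functions_def)

text \<open>Once the values on open subsets agree, induction over disjoint unions spreads the
  agreement, as the open subsets of \<open>\<Omega>\<close> are an intersection-stable generator. On
  all other sets both sides are 0 by normalisation, so the equality is one of functions, as the
  \<open>THE\<close> in \<open>divergence\<close> demands.\<close>

lemma real_radon_measure_eqI:
  fixes \<Omega> :: "'a::euclidean_space set"
  assumes "open \<Omega>" "real_radon_measure \<Omega> \<mu>" "real_radon_measure \<Omega> \<nu>"
    and eq: "\<And>\<psi>. \<psi> \<in> test_functions \<Omega> \<Longrightarrow> real_measure_integral \<Omega> \<mu> \<psi> = real_measure_integral \<Omega> \<nu> \<psi>"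
  shows "\<mu> = \<nu>"
proof -
  have \<Omega>: "\<Omega> \<in> sets borel" using assms(1) by auto
  have op: "\<mu> U = \<nu> U" if U: "open U" "U \<subseteq> \<Omega>" for U
  proof -
    obtain s where s: "\<And>n. s n \<in> test_functions U" "\<And>n x. 0 \<le> s n x" "\<And>n x. s n x \<le> 1"
      "\<And>x. (\<lambda>n. s n x) \<longlonglongrightarrow> indicator U x"
      using open_indicator_test_function_limit[OF U(1)] by metis
    have Ub: "U \<in> borel_subsets \<Omega>" using U by (auto simp: borel_subsets_def)
    have "(indicator U :: 'a \<Rightarrow> real) \<in> borel_measurable borel" using U(1) by auto
    then have m: "(indicator U :: 'a \<Rightarrow> real) \<in> borel_measurable (restrict_space borel \<Omega>)"
      by (rule measurable_restrict_space1)
    have lim: "(\<lambda>n. real_measure_integral \<Omega> \<tau> (s n)) \<longlonglongrightarrow> \<tau> U"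
      if "real_radon_measure \<Omega> \<tau>" for \<tau>
    proof -
      have "(\<lambda>n. real_measure_integral \<Omega> \<tau> (s n)) \<longlonglongrightarrow> real_measure_integral \<Omega> \<tau> (indicator U)"
        by (rule real_measure_integral_tendsto[OF that \<Omega> m, where C=1])
          (use s in \<open>auto intro: test_functions_measurable\<close>)
      then show ?thesis using real_measure_integral_indicator[OF that \<Omega> Ub] by simp
    qed
    have "real_measure_integral \<Omega> \<mu> (s n) = real_measure_integral \<Omega> \<nu> (s n)" for n
      using eq s(1) test_functions_mono[OF U(2)] by blast
    then show ?thesis using lim[OF assms(2)] lim[OF assms(3)] LIMSEQ_unique by simp
  qed
  define \<G> where "\<G> = {U. open U \<and> U \<subseteq> \<Omega>}"
  have stable: "Int_stable \<G>" by (auto simp: Int_stable_def \<G>_def)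
  have sub: "\<G> \<subseteq> Pow \<Omega>" by (auto simp: \<G>_def)
  interpret sigma_algebra \<Omega> "borel_subsets \<Omega>" by (rule sigma_algebra_borel_subsets[OF \<Omega>])
  have sig: "sigma_sets \<Omega> \<G> = borel_subsets \<Omega>"
  proof
    show "sigma_sets \<Omega> \<G> \<subseteq> borel_subsets \<Omega>"
      by (rule sigma_sets_subset) (auto simp: \<G>_def borel_subsets_def)
    have "\<Omega> \<inter> B \<in> sigma_sets \<Omega> \<G>" if "B \<in> sigma_sets UNIV (Collect open)" for B
      using that
    proof induction
      case (Basic A)
      then show ?case using assms(1) by (intro sigma_sets.Basic) (auto simp: \<G>_def)
    next
      case (Compl A)
      have "\<Omega> \<inter> (UNIV - A) = \<Omega> - \<Omega> \<inter> A" by auto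
      then show ?case using sigma_sets.Compl[OF Compl.IH] by simp
    next
      case (Union A)
      have "\<Omega> \<inter> (\<Union>i. A i) = (\<Union>i. \<Omega> \<inter> A i)" by auto
      then show ?case using sigma_sets.Union[OF Union.IH] by simp
    qed (auto intro: sigma_sets.Empty)
    then show "borel_subsets \<Omega> \<subseteq> sigma_sets \<Omega> \<G>"
      unfolding borel_subsets_def borel_def by (auto simp: sets_measure_of) (metis inf.absorb_iff2)
  qed
  have "\<mu> B = \<nu> B" if "B \<in> borel_subsets \<Omega>" for B
    using stable sub that[folded sig]
  proof (induction rule: sigma_sets_induct_disjoint)
    case (basic A)
    then show ?case using op by (auto simp: \<G>_def)
  next
    case empty
    show ?case using assms(2,3) by (simp add: real_radon_measure_empty)
  next
    case (compl A)
    then have A: "A \<in> borel_subsets \<Omega>" using sig by simp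
    then have "A \<subseteq> \<Omega>" "\<Omega> \<in> borel_subsets \<Omega>" using \<Omega> by (auto simp: borel_subsets_def)
    then show ?case
      using real_radon_measure_Diff[OF assms(2) A] real_radon_measure_Diff[OF assms(3) A] compl op[of \<Omega>] assms(1)
      by simp
  next
    case (union A)
    then have "range A \<subseteq> borel_subsets \<Omega>" using sig by simp
    from real_radon_measure_sums[OF assms(2) this union(1)] real_radon_measure_sums[OF assms(3) this union(1)]
    show ?case using union(3) sums_unique2 by fastforce
  qed
  moreover have "\<mu> B = \<nu> B" if "B \<notin> borel_subsets \<Omega>" for B
    using assms(2,3) that by (simp add: real_radon_measure_def)
  ultimately show ?thesis by blast
qed

lemma divergence_eqI:
  assumes "open \<Omega>" "has_divergence_measure \<Omega> F \<nu>"
  shows "divergence \<Omega> F = \<nu>"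
  unfolding divergence_def
proof (rule the_equality, rule assms(2))
  fix \<mu> assume "has_divergence_measure \<Omega> F \<mu>"
  then show "\<mu> = \<nu>"
    using assms by (intro real_radon_measure_eqI[OF assms(1)]) (auto simp: has_divergence_measure_def)
qed

section \<open>The measure with weight \<phi> against \<nu> plus a Lebesgue density\<close>

lemma integral_indicator_sums:
  fixes f :: "'a \<Rightarrow> real"
  assumes f: "integrable M f" and A: "\<And>i. A i \<in> sets M" "disjoint_family A"
  shows "(\<lambda>i::nat. LINT x|M. indicator (A i) x * f x) sums (LINT x|M. indicator (\<Union>i. A i) x * f x)"
proof -
  have int: "integrable M (\<lambda>x. indicator B x * f x)" if "B \<in> sets M" for B
    using integrable_mult_indicator[OF that f] by simp
  have "(\<lambda>n. LINT x|M. indicator (\<Union>i<n. A i) x * f x) \<longlonglongrightarrow> (LINT x|M. indicator (\<Union>i. A i) x * f x)"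
  proof (rule integral_dominated_convergence)
    show "integrable M (\<lambda>x. \<bar>f x\<bar>)" using f by simp
    show "AE x in M. (\<lambda>n. indicator (\<Union>i<n. A i) x * f x) \<longlonglongrightarrow> indicator (\<Union>i. A i) x * f x"
      by (intro AE_I2 tendsto_mult LIMSEQ_indicator_UN tendsto_const)
    show "AE x in M. norm (indicator (\<Union>i<n. A i) x * f x) \<le> \<bar>f x\<bar>" for n
      by (auto simp: indicator_def)
    show "(\<lambda>x. indicator (\<Union>i. A i) x * f x) \<in> borel_measurable M"
      "(\<lambda>x. indicator (\<Union>i<n. A i) x * f x) \<in> borel_measurable M" for n
      using A(1) by (auto intro!: borel_measurable_integrable int)
  qed
  moreover have "(LINT x|M. indicator (\<Union>i<n. A i) x * f x) = (\<Sum>i<n. LINT x|M. indicator (A i) x * f x)" for n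
  proof -
    have "indicator (\<Union>i<n. A i) x = (\<Sum>i<n. indicator (A i) x :: real)" for x
      using A(2) by (intro indicator_UN_disjoint) (auto intro: disjoint_family_on_mono)
    then have "(LINT x|M. indicator (\<Union>i<n. A i) x * f x) = (LINT x|M. (\<Sum>i<n. indicator (A i) x * f x))"
      by (simp only: sum_distrib_right)
    also have "\<dots> = (\<Sum>i<n. LINT x|M. indicator (A i) x * f x)"
      by (intro Bochner_Integration.integral_sum int A(1))
    finally show ?thesis .
  qed
  ultimately show ?thesis by (simp add: sums_def)
qed

text \<open>The candidate for the divergence of \<phi> F, where \<open>g\<close> will be a Borel
  version of F \<bullet> G extended by 0. The value 0 elsewhere is the normalisation that
  \<open>real_radon_measure\<close> demands.\<close>

definition weighted_sum_measure ::
  "'a::euclidean_space set \<Rightarrow> ('a set \<Rightarrow> real) \<Rightarrow> ('a \<Rightarrow> real) \<Rightarrow> ('a \<Rightarrow> real) \<Rightarrow> 'a set \<Rightarrow> real" where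
  "weighted_sum_measure \<Omega> \<nu> \<phi> g B = (if B \<in> borel_subsets \<Omega> then
     real_measure_integral \<Omega> \<nu> (\<lambda>x. indicator B x * \<phi> x) + (LINT x|lborel. indicator B x * g x) else 0)"

lemma
  fixes \<Omega> :: "'a::euclidean_space set"
  assumes \<nu>: "real_radon_measure \<Omega> \<nu>" and \<Omega>: "\<Omega> \<in> sets borel"
    and \<phi>: "\<phi> \<in> borel_measurable (restrict_space borel \<Omega>)" "\<And>x. x \<in> \<Omega> \<Longrightarrow> \<bar>\<phi> x\<bar> \<le> C"
    and g: "integrable lborel g"
  shows real_radon_measure_weighted_sum: "real_radon_measure \<Omega> (weighted_sum_measure \<Omega> \<nu> \<phi> g)"
    and real_measure_integral_weighted_sum: "\<And>f::'a \<Rightarrow> real. \<And>D. f \<in> borel_measurable (restrict_space borel \<Omega>) \<Longrightarrow>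
      (\<And>x. x \<in> \<Omega> \<Longrightarrow> \<bar>f x\<bar> \<le> D) \<Longrightarrow>
      real_measure_integral \<Omega> (weighted_sum_measure \<Omega> \<nu> \<phi> g) f =
        real_measure_integral \<Omega> \<nu> (\<lambda>x. f x * \<phi> x) + (LINT x|lborel. indicator \<Omega> x * (f x * g x))"
proof -
  let ?\<mu> = "weighted_sum_measure \<Omega> \<nu> \<phi> g"
  have \<nu>': "real_radon_measure \<Omega> (\<lambda>B. - \<nu> B)" by (rule real_radon_measure_uminus[OF \<nu>])
  have int\<phi>: "integrable (pos_variation \<Omega> \<nu>) \<phi>" "integrable (pos_variation \<Omega> (\<lambda>B. - \<nu> B)) \<phi>"
    using \<phi> by (auto intro!: integrable_pos_variation[OF _ \<Omega>] \<nu> \<nu>')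
  show \<mu>: "real_radon_measure \<Omega> ?\<mu>"
    unfolding real_radon_measure_def
  proof (intro conjI allI impI)
    show "?\<mu> {} = 0" by (simp add: weighted_sum_measure_def real_measure_integral_def)
    fix A :: "nat \<Rightarrow> 'a set"
    assume A: "range A \<subseteq> borel_subsets \<Omega>" "disjoint_family A"
    have "(\<Union>i. A i) \<in> borel_subsets \<Omega>" using A(1) by (fastforce simp: borel_subsets_def)
    moreover have Ai: "A i \<in> borel_subsets \<Omega>" "A i \<in> sets borel" for i using A(1) by (auto simp: borel_subsets_def)
    ultimately show "(\<lambda>i. ?\<mu> (A i)) sums ?\<mu> (\<Union> (range A))"
      unfolding weighted_sum_measure_def real_measure_integral_def
      by (simp, intro sums_add sums_diff integral_indicator_sums int\<phi> g A) (use Ai \<Omega> in auto)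
  qed (simp add: weighted_sum_measure_def)
  have \<mu>': "real_radon_measure \<Omega> (\<lambda>B. - ?\<mu> B)" by (rule real_radon_measure_uminus[OF \<mu>])
  fix f :: "'a \<Rightarrow> real" and D assume f: "f \<in> borel_measurable (restrict_space borel \<Omega>)" "\<And>x. x \<in> \<Omega> \<Longrightarrow> \<bar>f x\<bar> \<le> D"
  \<comment> \<open>With \<mu> the weighted sum, the relation to be extended is \<mu>+ - \<mu>- -
    \<phi> \<nu>+ + \<phi> \<nu>- - g dx = 0, one measure and one weight per term. On Borel sets it
    is the definition of \<mu> together with its Jordan decomposition, so the variations of \<mu>
    need no description in terms of those of \<nu>.\<close>
  define M where "M = (!) [pos_variation \<Omega> ?\<mu>, pos_variation \<Omega> (\<lambda>B. - ?\<mu> B),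
    pos_variation \<Omega> \<nu>, pos_variation \<Omega> (\<lambda>B. - \<nu> B), restrict_space lborel \<Omega>]"
  define k where "k = (!) [\<lambda>_. 1, \<lambda>_. - 1, \<lambda>x. - \<phi> x, \<phi>, \<lambda>x. - g x]"
  have five: "{..<5::nat} = {0, 1, 2, 3, 4}" by auto
  have gr: "integrable (restrict_space lborel \<Omega>) g"
    using integrable_mult_indicator[of \<Omega> lborel g] g \<Omega> by (subst integrable_restrict_space) auto
  have gI: "(LINT x|restrict_space lborel \<Omega>. h x) = (LINT x|lborel. indicator \<Omega> x * h x)" for h :: "'a \<Rightarrow> real"
    using \<Omega> by (subst integral_restrict_space) auto
  have "(\<Sum>j<5. LINT x|M j. f x * k j x) = 0"
  proof (rule sum_integrals_eq_0)
    fix j :: nat assume "j \<in> {..<5}"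
    then consider "j = 0" | "j = 1" | "j = 2" | "j = 3" | "j = 4" by (auto simp: five)
    note j = this
    show "sets (M j) = sets (restrict_space borel \<Omega>)"
    proof -
      have eq: "sets (restrict_space lborel \<Omega>) = sets (restrict_space borel \<Omega>)"
        by (simp add: sets_restrict_space)
      show ?thesis by (cases rule: j) (use \<Omega> eq in \<open>simp_all add: M_def sets_restrict_borel\<close>)
    qed
    have c: "integrable (pos_variation \<Omega> \<tau>) (\<lambda>_. c)" if "real_radon_measure \<Omega> \<tau>" for \<tau> and c :: real
      by (rule integrable_pos_variation[OF that \<Omega>, of _ "\<bar>c\<bar>"]) auto
    show "integrable (M j) (k j)"
      by (cases rule: j) (use int\<phi> gr c[OF \<mu>] c[OF \<mu>'] in \<open>simp_all add: M_def k_def\<close>)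
  next
    fix B assume "B \<in> sets (restrict_space borel \<Omega>)"
    then have B: "B \<in> borel_subsets \<Omega>" using \<Omega> by (simp add: sets_restrict_borel)
    have "(\<lambda>x. indicator \<Omega> x * (indicator B x * g x)) = (\<lambda>x. indicator B x * g x)"
      using B by (auto simp: indicator_def borel_subsets_def fun_eq_iff)
    then have gB: "(LINT x|restrict_space lborel \<Omega>. indicator B x * g x) = (LINT x|lborel. indicator B x * g x)"
      using gI[of "\<lambda>x. indicator B x * g x"] by (simp only:)
    have "?\<mu> B = real_measure_integral \<Omega> \<nu> (\<lambda>x. indicator B x * \<phi> x) + (LINT x|lborel. indicator B x * g x)"
      using B by (simp add: weighted_sum_measure_def)
    then show "(\<Sum>j<5. LINT x|M j. indicator B x * k j x) = 0"
      using real_measure_integral_indicator[OF \<mu> \<Omega> B]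
      by (simp add: five M_def k_def gB real_measure_integral_def)
  next
    show "\<And>x. x \<in> space (restrict_space borel \<Omega>) \<Longrightarrow> \<bar>f x\<bar> \<le> D"
      using f(2) \<Omega> by (auto simp: space_restrict_space)
  qed (use f in auto)
  then show "real_measure_integral \<Omega> ?\<mu> f =
      real_measure_integral \<Omega> \<nu> (\<lambda>x. f x * \<phi> x) + (LINT x|lborel. indicator \<Omega> x * (f x * g x))"
    by (simp add: five M_def k_def gI real_measure_integral_def)
qed

section \<open>The product rule\<close>

text \<open>Besides shrinking to 0, all supports lie in one ball of radius \<open>r\<close>, so that
  kernels centred in a compact set stay in a prescribed neighbourhood of it. The bounds
  \<open>C n\<close> may blow up; they serve integrability for one fixed n at a time.\<close>

lemma ex_mollifier:
  assumes "0 < (r::real)"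
  obtains \<rho> :: "nat \<Rightarrow> 'a::euclidean_space \<Rightarrow> real" and C :: "nat \<Rightarrow> real"
  where "\<And>n k. Ck k (\<rho> n)" "\<And>n h. 0 \<le> \<rho> n h" "\<And>n h. \<rho> n h \<le> C n"
    "\<And>n. integrable lborel (\<rho> n)" "\<And>n. (LINT h|lborel. \<rho> n h) = 1"
    "\<And>n h. \<rho> n h \<noteq> 0 \<Longrightarrow> norm h < r"
    "\<And>d. d > 0 \<Longrightarrow> eventually (\<lambda>n. \<forall>h. \<rho> n h \<noteq> 0 \<longrightarrow> norm h < d) sequentially"
proof -
  \<comment> \<open>Half the side length of the n-th cube. The norm is at most the sum of the
    absolute coordinates, so dividing by the dimension gives
    \<open>norm h < r / real (Suc n)\<close>.\<close>
  define s where "s n = r / (real DIM('a) * real (Suc n))" for n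
  have s: "s n > 0" for n using assms by (simp add: s_def)
  define Q where "Q n = box (- s n *\<^sub>R One) (s n *\<^sub>R One :: 'a)" for n
  define \<beta> where "\<beta> n = box_bump 1 (- s n *\<^sub>R One) (s n *\<^sub>R One :: 'a)" for n
  define c where "c n = (LINT h|lborel. \<beta> n h)" for n
  have \<beta>0: "0 \<le> \<beta> n h" "\<beta> n h \<le> 1" for n h by (auto simp: \<beta>_def box_bump_bounds)
  have \<beta>Q: "\<beta> n h \<noteq> 0 \<longleftrightarrow> h \<in> Q n" for n h by (simp add: \<beta>_def Q_def box_bump_neq_0_iff)
  have Ck\<beta>: "Ck k (\<beta> n)" for k n by (simp add: \<beta>_def Ck_box_bump)
  then have m\<beta>: "\<beta> n \<in> borel_measurable borel" for n
    by (intro borel_measurable_continuous_onI Ck_imp_continuous_on)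
  have mQ: "Q n \<in> sets borel" "emeasure lborel (Q n) < \<infinity>" for n
    by (auto simp: Q_def emeasure_lborel_box_eq)
  have int\<beta>: "integrable lborel (\<beta> n)" for n
  proof (rule Bochner_Integration.integrable_bound)
    show "integrable lborel (indicator (Q n) :: 'a \<Rightarrow> real)" using mQ by (simp add: integrable_indicator_iff)
    show "AE x in lborel. norm (\<beta> n x) \<le> norm (indicator (Q n) x :: real)"
    proof (rule AE_I2)
      fix x show "norm (\<beta> n x) \<le> norm (indicator (Q n) x :: real)"
        using \<beta>0[of n x] \<beta>Q[of n x] by (auto simp: indicator_def)
    qed
  qed (use m\<beta> in auto)
  have c: "c n > 0" for n
  proof -
    \<comment> \<open>Otherwise the bump would vanish almost everywhere and the nonempty open box on
      which it is positive would be negligible.\<close>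
    have "c n \<noteq> 0"
    proof
      assume "c n = 0"
      then have "AE x in lborel. \<beta> n x = 0"
        using integral_nonneg_eq_0_iff_AE[OF int\<beta>] \<beta>0(1) by (simp add: c_def)
      then have "AE x in lborel. x \<notin> Q n" using \<beta>Q by (auto elim!: eventually_mono)
      then have "Q n \<in> null_sets lborel" using mQ(1) by (simp add: AE_iff_null_sets)
      then have "negligible (Q n)" by (simp add: negligible_iff_null_sets null_sets_completionI)
      then have "Q n = {}" using open_not_negligible[of "Q n"] by (auto simp: Q_def)
      moreover have "0 \<in> Q n" using s[of n] by (auto simp: Q_def mem_box)
      ultimately show False by simp
    qed
    then show ?thesis using integral_nonneg_AE[of "\<beta> n" lborel] \<beta>0(1) by (simp add: c_def order_less_le)
  qed
  define \<rho> where "\<rho> n h = inverse (c n) * \<beta> n h" for n h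
  have norm_lt: "norm h < r / real (Suc n)" if "\<rho> n h \<noteq> 0" for n h
  proof -
    have h: "h \<in> Q n" using that \<beta>Q[of n h] by (simp add: \<rho>_def)
    have "norm h \<le> (\<Sum>i\<in>Basis. \<bar>h \<bullet> i\<bar>)" by (rule norm_le_l1)
    also have "\<dots> < (\<Sum>i\<in>(Basis::'a set). s n)"
      using h by (intro sum_strict_mono) (auto simp: Q_def mem_box abs_less_iff)
    also have "\<dots> = r / real (Suc n)" by (simp add: s_def field_simps del: of_nat_Suc)
    finally show ?thesis .
  qed
  show ?thesis
  proof (rule that[of \<rho> "\<lambda>n. inverse (c n)"])
    show "Ck k (\<rho> n)" for k n unfolding \<rho>_def[abs_def] by (intro Ck_mult Ck_const Ck\<beta>)
    show "0 \<le> \<rho> n h" for n h using c[of n] \<beta>0(1)[of n h] by (simp add: \<rho>_def)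
    show "\<rho> n h \<le> inverse (c n)" for n h
      unfolding \<rho>_def using c[of n] \<beta>0[of n h] by (intro mult_right_le_one_le) auto
    show "integrable lborel (\<rho> n)" for n unfolding \<rho>_def[abs_def] using int\<beta> by simp
    show "(LINT h|lborel. \<rho> n h) = 1" for n
      unfolding \<rho>_def using c[of n] by (simp add: c_def)
    show "norm h < r" if "\<rho> n h \<noteq> 0" for n h
    proof -
      have "r / real (Suc n) \<le> r" using assms by (simp add: field_simps)
      then show ?thesis using norm_lt[OF that] by linarith
    qed
    fix d :: real assume "d > 0"
    obtain N where N: "r / d < real N" using reals_Archimedean2 by blast
    have "norm h < d" if "n \<ge> N" "\<rho> n h \<noteq> 0" for n h
    proof -
      have "r / d < real (Suc n)" using N that(1) by simp
      then have "r / real (Suc n) < d" using \<open>d > 0\<close> by (simp add: field_simps)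
      then show ?thesis using norm_lt[OF that(2)] by linarith
    qed
    then show "eventually (\<lambda>n. \<forall>h. \<rho> n h \<noteq> 0 \<longrightarrow> norm h < d) sequentially"
      by (auto simp: eventually_sequentially)
  qed
qed

subsection \<open>Borel representatives\<close>

lemma lebesgue_ex_borel_version:
  fixes f :: "'a::euclidean_space \<Rightarrow> 'b::euclidean_space"
  assumes "f \<in> borel_measurable lebesgue"
  shows "\<exists>g\<in>borel_measurable borel. AE x in lborel. f x = g x"
proof -
  have "\<exists>g. g \<in> borel_measurable lborel \<and> (AE x in lborel. f x \<bullet> i = g x)" for i
    using completion_ex_borel_measurable_real[of "\<lambda>x. f x \<bullet> i" lborel] assms by auto
  then obtain g where g: "\<And>i. g i \<in> borel_measurable lborel" "\<And>i. AE x in lborel. f x \<bullet> i = g i x"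
    by metis
  have "AE x in lborel. \<forall>i\<in>Basis. f x \<bullet> i = g i x"
    using g(2) by (intro AE_finite_allI) auto
  then have "AE x in lborel. f x = (\<Sum>i\<in>Basis. g i x *\<^sub>R i)"
    by eventually_elim (simp add: euclidean_eq_iff[where 'a='b])
  moreover have "(\<lambda>x. \<Sum>i\<in>Basis. g i x *\<^sub>R i) \<in> borel_measurable borel" using g(1) by auto
  ultimately show ?thesis by (intro bexI[of _ "\<lambda>x. \<Sum>i\<in>Basis. g i x *\<^sub>R i"])
qed

lemma integral_lebesgue_eq_lborel:
  fixes f g :: "'a::euclidean_space \<Rightarrow> 'b::euclidean_space"
  assumes "f \<in> borel_measurable lebesgue" "g \<in> borel_measurable borel" "AE x in lborel. f x = g x"
  shows "integral\<^sup>L lebesgue f = integral\<^sup>L lborel g"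
    and "integrable lebesgue f \<longleftrightarrow> integrable lborel g"
proof -
  have g: "g \<in> borel_measurable lebesgue" "g \<in> borel_measurable lborel"
    using assms(2) by (auto intro: measurable_completion)
  have ae: "AE x in lebesgue. f x = g x" using assms(3) by (simp add: AE_completion_iff)
  show "integral\<^sup>L lebesgue f = integral\<^sup>L lborel g"
    using integral_cong_AE[OF assms(1) g(1) ae] integral_completion[OF g(2)] by simp
  show "integrable lebesgue f \<longleftrightarrow> integrable lborel g"
    using integrable_cong_AE[OF assms(1) g(1) ae] integrable_completion[OF g(2)] by simp
qed

lemma integrable_ex_borel_version:
  fixes f :: "'a::euclidean_space \<Rightarrow> 'b::euclidean_space"
  assumes "integrable lebesgue f"
  obtains g where "integrable lborel g" "AE x in lborel. f x = g x"
proof -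
  obtain g where g: "g \<in> borel_measurable borel" "AE x in lborel. f x = g x"
    using lebesgue_ex_borel_version[of f] assms by auto
  then show ?thesis
    using integral_lebesgue_eq_lborel(2)[of f g] assms that by auto
qed

text \<open>All four Borel versions are set to 0 on one common null set. A pair that meets this set
  has left side 0, and the right side is nonnegative there because the given majorants are; every
  other pair satisfies \<open>Q\<close> at both points.\<close>

lemma ex_paired_fields:
  fixes H\<^sub>0 G\<^sub>0 :: "'a::euclidean_space \<Rightarrow> 'a"
  assumes int: "integrable lebesgue H\<^sub>0" "integrable lebesgue G\<^sub>0" "integrable lebesgue A\<^sub>0" "integrable lebesgue B\<^sub>0"
    and nonneg: "\<And>x. 0 \<le> A\<^sub>0 x" "\<And>x. 0 \<le> (B\<^sub>0 x :: real)"
    and ae: "AE x in lborel. Q x"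
    and bound: "\<And>x y. Q x \<Longrightarrow> Q y \<Longrightarrow> norm (H\<^sub>0 x) * norm (G\<^sub>0 y) \<le> A\<^sub>0 x + B\<^sub>0 y"
  obtains H G A B where "paired_fields H G A B" "AE x in lborel. H\<^sub>0 x = H x" "AE x in lborel. G\<^sub>0 x = G x"
proof -
  obtain H where H: "integrable lborel H" "AE x in lborel. H\<^sub>0 x = H x"
    using int(1) by (rule integrable_ex_borel_version)
  obtain G where G: "integrable lborel G" "AE x in lborel. G\<^sub>0 x = G x"
    using int(2) by (rule integrable_ex_borel_version)
  obtain A where A: "integrable lborel A" "AE x in lborel. A\<^sub>0 x = A x"
    using int(3) by (rule integrable_ex_borel_version)
  obtain B where B: "integrable lborel B" "AE x in lborel. B\<^sub>0 x = B x"
    using int(4) by (rule integrable_ex_borel_version)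
  have "AE x in lborel. Q x \<and> H\<^sub>0 x = H x \<and> G\<^sub>0 x = G x \<and> A\<^sub>0 x = A x \<and> B\<^sub>0 x = B x"
    using ae H(2) G(2) A(2) B(2) by eventually_elim auto
  from AE_E3[OF this] obtain N where N: "N \<in> null_sets lborel"
    "\<And>x. x \<in> space lborel - N \<Longrightarrow> Q x \<and> H\<^sub>0 x = H x \<and> G\<^sub>0 x = G x \<and> A\<^sub>0 x = A x \<and> B\<^sub>0 x = B x"
    by blast
  have N': "- N \<in> sets lborel" using N(1) by (auto simp: null_sets_def)
  have aeN: "AE x in lborel. x \<notin> N" by (rule AE_not_in[OF N(1)])
  show ?thesis
  proof (rule that)
    show "paired_fields (\<lambda>x. indicator (- N) x *\<^sub>R H x) (\<lambda>x. indicator (- N) x *\<^sub>R G x)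
        (\<lambda>x. indicator (- N) x *\<^sub>R A x) (\<lambda>x. indicator (- N) x *\<^sub>R B x)"
    proof
      show "norm (indicator (- N) x *\<^sub>R H x) * norm (indicator (- N) y *\<^sub>R G y)
          \<le> indicator (- N) x *\<^sub>R A x + indicator (- N) y *\<^sub>R B y" for x y
        using bound[of x y] nonneg[of x] nonneg[of y] N(2)[of x] N(2)[of y]
        by (auto simp: indicator_def)
    qed (intro integrable_mult_indicator N' H(1) G(1) A(1) B(1))+
    show "AE x in lborel. H\<^sub>0 x = indicator (- N) x *\<^sub>R H x"
      using aeN by eventually_elim (use N(2) in auto)
    show "AE x in lborel. G\<^sub>0 x = indicator (- N) x *\<^sub>R G x"
      using aeN by eventually_elim (use N(2) in auto)
  qed
qed

subsection \<open>Young's inequality for fields with conjugate exponents\<close>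

text \<open>Young's inequality covers finite p > 1; at the two endpoints the bounded field is
  replaced by an essential bound and the other field supplies the integrable majorant. The
  exceptional set is described by a predicate on single points, so that x and y remain
  independent.\<close>

lemma Lp_Young_bound:
  fixes F G :: "'a::euclidean_space \<Rightarrow> 'a"
  assumes p: "1 \<le> p" and F: "F \<in> Lp p \<Omega>" and G: "G \<in> Lp (conj_exponent p) \<Omega>" and \<Omega>: "\<Omega> \<in> sets lebesgue"
  obtains A B P where "integrable (lebesgue_on \<Omega>) A" "integrable (lebesgue_on \<Omega>) B"
    "\<And>x. 0 \<le> A x" "\<And>x. 0 \<le> (B x :: real)" "AE x in lebesgue. P x"
    "\<And>x y. x \<in> \<Omega> \<Longrightarrow> y \<in> \<Omega> \<Longrightarrow> P x \<Longrightarrow> P y \<Longrightarrow> norm (F x) * norm (G y) \<le> A x + B y"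
proof -
  have L1: "integrable (lebesgue_on \<Omega>) (\<lambda>x. norm (f x))" if "f \<in> Lp 1 \<Omega>" for f :: "'a \<Rightarrow> 'a"
    using that by (simp add: Lp_def)
  have Linf: "\<exists>C\<ge>0. AE x in lebesgue. x \<in> \<Omega> \<longrightarrow> norm (f x) \<le> C" if "f \<in> Lp \<infinity> \<Omega>" for f :: "'a \<Rightarrow> 'a"
  proof -
    have "\<exists>C. AE x in lebesgue_on \<Omega>. norm (f x) \<le> C" using that by (simp add: Lp_def)
    then obtain C where "AE x in lebesgue_on \<Omega>. norm (f x) \<le> C" by blast
    then have "AE x in lebesgue. x \<in> \<Omega> \<longrightarrow> norm (f x) \<le> C"
      using \<Omega> by (simp add: AE_restrict_space_iff)
    then have "AE x in lebesgue. x \<in> \<Omega> \<longrightarrow> norm (f x) \<le> max 0 C" by eventually_elim auto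
    then show ?thesis by (intro exI[of _ "max 0 C"]) auto
  qed
  consider "p = 1" | "p = \<infinity>" | "p \<noteq> 1" "p \<noteq> \<infinity>" by auto
  then show ?thesis
  proof cases
    case 1
    then have "G \<in> Lp \<infinity> \<Omega>" using G by (simp add: conj_exponent_def)
    then obtain C where C: "C \<ge> 0" "AE x in lebesgue. x \<in> \<Omega> \<longrightarrow> norm (G x) \<le> C" using Linf by blast
    show ?thesis
    proof (rule that[of "\<lambda>x. C * norm (F x)" "\<lambda>_. 0", OF _ _ _ _ C(2)])
      show "integrable (lebesgue_on \<Omega>) (\<lambda>x. C * norm (F x))" using L1 F 1 by simp
      show "norm (F x) * norm (G y) \<le> C * norm (F x) + 0"
        if "y \<in> \<Omega>" "y \<in> \<Omega> \<longrightarrow> norm (G y) \<le> C" for x y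
        using that mult_left_mono[of "norm (G y)" C "norm (F x)"] by (simp add: mult.commute)
    qed (use C in auto)
  next
    case 2
    then have "G \<in> Lp 1 \<Omega>" using G by (simp add: conj_exponent_def)
    moreover obtain C where C: "C \<ge> 0" "AE x in lebesgue. x \<in> \<Omega> \<longrightarrow> norm (F x) \<le> C" using Linf F 2 by blast
    ultimately show ?thesis
    proof (intro that[of "\<lambda>_. 0" "\<lambda>x. C * norm (G x)", OF _ _ _ _ C(2)])
      assume "G \<in> Lp 1 \<Omega>"
      then show "integrable (lebesgue_on \<Omega>) (\<lambda>x. C * norm (G x))" using L1 by simp
      show "norm (F x) * norm (G y) \<le> 0 + C * norm (G y)"
        if "x \<in> \<Omega>" "x \<in> \<Omega> \<longrightarrow> norm (F x) \<le> C" for x y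
        using that by (simp add: mult_right_mono)
    qed (use C in auto)
  next
    case 3
    define r where "r = enn2real p"
    have pr: "p = ennreal r" using 3 by (simp add: r_def less_top)
    have r: "r > 1"
    proof -
      have "ennreal 1 < ennreal r" using 3 p pr by (simp add: order_less_le)
      then show ?thesis by (simp add: ennreal_less_iff)
    qed
    define q where "q = r / (r - 1)"
    have q: "q > 1" "1 / r + 1 / q = 1" using r by (auto simp: q_def field_simps)
    have "p - 1 = ennreal (r - 1)" unfolding pr using r by (simp add: ennreal_minus flip: ennreal_1)
    then have cq: "conj_exponent p = ennreal q"
      using 3 r unfolding conj_exponent_def q_def by (simp add: pr divide_ennreal)
    show ?thesis
    proof (rule that[of "\<lambda>x. norm (F x) powr r / r" "\<lambda>x. norm (G x) powr q / q" "\<lambda>_. True"])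
      show "integrable (lebesgue_on \<Omega>) (\<lambda>x. norm (F x) powr r / r)"
        using F 3 by (simp add: Lp_def r_def)
      show "integrable (lebesgue_on \<Omega>) (\<lambda>x. norm (G x) powr q / q)"
        using G q unfolding cq by (simp add: Lp_def)
      show "norm (F x) * norm (G y) \<le> norm (F x) powr r / r + norm (G y) powr q / q" for x y
        using Youngs_inequality[OF r q] by simp
    qed (use r q in auto)
  qed
qed

lemma integral_lebesgue_on_eq:
  fixes f :: "'a::euclidean_space \<Rightarrow> real"
  assumes "\<Omega> \<in> sets lebesgue"
  shows "(LINT x|lebesgue_on \<Omega>. f x) = (LINT x|lebesgue. indicator \<Omega> x * f x)"
    and "integrable (lebesgue_on \<Omega>) f \<longleftrightarrow> integrable lebesgue (\<lambda>x. indicator \<Omega> x * f x)"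
  using assms by (simp_all add: integral_restrict_space integrable_restrict_space)

subsection \<open>Passage to the limit in the tested product rule\<close>

lemma integrable_lebesgue_inner_compact_support:
  fixes F V :: "'a::euclidean_space \<Rightarrow> 'a"
  assumes F: "integrable lebesgue (\<lambda>x. indicator K x *\<^sub>R F x)"
    and K: "compact K" and V: "continuous_on UNIV V" and supp: "\<And>x. x \<notin> K \<Longrightarrow> V x = 0"
  shows "integrable lebesgue (\<lambda>x. F x \<bullet> V x)"
proof -
  have "bounded (V ` K)"
    using V K by (intro compact_imp_bounded compact_continuous_image) (auto intro: continuous_on_subset)
  then obtain C where C: "\<And>x. x \<in> K \<Longrightarrow> norm (V x) \<le> C" by (auto simp: bounded_iff)
  have "V \<in> borel_measurable lebesgue"
    using borel_measurable_continuous_onI[OF V] by (auto intro: measurable_completion)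
  then have m: "(\<lambda>x. (indicator K x *\<^sub>R F x) \<bullet> V x) \<in> borel_measurable lebesgue"
    using F by (intro borel_measurable_inner) auto
  have eq: "(indicator K x *\<^sub>R F x) \<bullet> V x = F x \<bullet> V x" for x
    using supp[of x] by (auto simp: indicator_def)
  have "integrable lebesgue (\<lambda>x. (indicator K x *\<^sub>R F x) \<bullet> V x)"
  proof (rule Bochner_Integration.integrable_bound[OF _ m])
    show "integrable lebesgue (\<lambda>x. C * norm (indicator K x *\<^sub>R F x))"
      by (intro integrable_mult_right integrable_norm F)
    show "AE x in lebesgue. norm ((indicator K x *\<^sub>R F x) \<bullet> V x) \<le> norm (C * norm (indicator K x *\<^sub>R F x))"
    proof (rule AE_I2)
      fix x
      show "norm ((indicator K x *\<^sub>R F x) \<bullet> V x) \<le> norm (C * norm (indicator K x *\<^sub>R F x))"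
      proof (cases "x \<in> K")
        case True
        have "\<bar>F x \<bullet> V x\<bar> \<le> norm (F x) * norm (V x)" by (rule Cauchy_Schwarz_ineq2)
        also have "\<dots> \<le> \<bar>C\<bar> * norm (F x)"
          using mult_left_mono[of "norm (V x)" "\<bar>C\<bar>" "norm (F x)"] C[OF True] by (simp add: mult.commute)
        finally show ?thesis using True by (simp add: abs_mult)
      qed simp
    qed
  qed
  then show ?thesis unfolding eq .
qed

text \<open>The exponents have disappeared in favour of the separated bound. The gradients of the
  mollifications are never shown to converge by themselves; only their pairing with \<psi> F
  is.\<close>

lemma product_rule_test_function:
  fixes \<Omega> :: "'a::euclidean_space set" and F G :: "'a \<Rightarrow> 'a"
  assumes \<Omega>: "open \<Omega>" and F: "has_divergence_measure \<Omega> F \<nu>"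
    and \<phi>: "continuous_on \<Omega> \<phi>" "\<And>x. x \<in> \<Omega> \<Longrightarrow> \<bar>\<phi> x\<bar> \<le> C" "C \<ge> 0"
    and wG: "has_weak_gradient \<Omega> \<phi> G"
    and AB: "integrable (lebesgue_on \<Omega>) A" "integrable (lebesgue_on \<Omega>) B" "\<And>x. 0 \<le> A x" "\<And>x. 0 \<le> (B x :: real)"
    and P: "AE x in lebesgue. P x"
    and bound: "\<And>x y. x \<in> \<Omega> \<Longrightarrow> y \<in> \<Omega> \<Longrightarrow> P x \<Longrightarrow> P y \<Longrightarrow> norm (F x) * norm (G y) \<le> A x + B y"
    and \<psi>: "\<psi> \<in> test_functions \<Omega>"
  shows "(LINT x|lebesgue_on \<Omega>. \<phi> x * (F x \<bullet> grad \<psi> x)) + (LINT x|lebesgue_on \<Omega>. \<psi> x * (F x \<bullet> G x)) =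
    - real_measure_integral \<Omega> \<nu> (\<lambda>x. \<psi> x * \<phi> x)"
proof -
  have \<Omega>m: "\<Omega> \<in> sets borel" "\<Omega> \<in> sets lebesgue" using \<Omega> by auto
  have \<nu>: "real_radon_measure \<Omega> \<nu>" using F by (simp add: has_divergence_measure_def)
  define K where "K = closure {x. \<psi> x \<noteq> 0}"
  have K: "compact K" "K \<subseteq> \<Omega>" using \<psi> by (auto simp: K_def test_functions_def)
  have \<psi>K: "\<psi> x = 0" if "x \<notin> K" for x using that closure_subset[of "{x. \<psi> x \<noteq> 0}"] by (auto simp: K_def)
  have gK: "grad \<psi> x = 0" if "x \<notin> K" for x using that by (simp add: K_def grad_eq_0)
  have Ck\<psi>: "Ck k \<psi>" for k using \<psi> by (rule test_functions_Ck)
  have cont\<psi>: "continuous_on UNIV \<psi>" by (rule Ck_imp_continuous_on[OF Ck\<psi>])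
  have contg: "continuous_on UNIV (grad \<psi>)" by (rule continuous_on_grad[OF Ck\<psi>])
  obtain C' where C': "\<And>x. \<bar>\<psi> x\<bar> \<le> C'" "C' \<ge> 0"
  proof -
    have "bounded (\<psi> ` K)"
      using K(1) cont\<psi> by (intro compact_imp_bounded compact_continuous_image) (auto intro: continuous_on_subset)
    then obtain c where c: "\<And>x. x \<in> K \<Longrightarrow> \<bar>\<psi> x\<bar> \<le> c" by (auto simp: bounded_iff)
    have "\<bar>\<psi> x\<bar> \<le> max c 0" for x using c[of x] \<psi>K[of x] by (cases "x \<in> K") auto
    then show ?thesis by (rule that) simp
  qed
  obtain r where r: "r > 0" "(\<Union>x\<in>K. cball x r) \<subseteq> \<Omega>"
    using compact_subset_open_imp_cball_epsilon_subset[OF K(1) \<Omega> K(2)] by metis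
  \<comment> \<open>The closed r-neighbourhood of \<open>K\<close>: it contains the supports of all
    kernels of radius below r centred in \<open>K\<close>, and is still a compact subset of
    \<open>\<Omega>\<close>.\<close>
  define L where "L = {x + y |x y. x \<in> K \<and> y \<in> cball 0 r}"
  have L: "compact L" unfolding L_def using K(1) by (intro compact_sums) auto
  have LI: "y \<in> L" if "x \<in> K" "norm (x - y) \<le> r" for x y
    unfolding L_def using that by (intro CollectI exI[of _ x] exI[of _ "y - x"]) (auto simp: norm_minus_commute)
  have KL: "K \<subseteq> L" using LI r(1) by fastforce
  have L\<Omega>: "L \<subseteq> \<Omega>" using r(2) by (force simp: L_def dist_norm)
  have Lm: "L \<in> sets borel" using L by (simp add: compact_imp_closed)
  obtain b where b: "L \<subseteq> cbox (- b) b" using bounded_subset_cbox_symmetric[OF compact_imp_bounded[OF L]] by metis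

  \<comment> \<open>Tietze extension preserves the bound \<open>C\<close>. Values outside
    \<open>L\<close> have no influence on the mollification over \<open>K\<close>, but smoothness of
    the convolution is available for functions continuous on the whole space.\<close>
  obtain \<phi>' where \<phi>': "continuous_on UNIV \<phi>'" "\<And>x. x \<in> L \<Longrightarrow> \<phi>' x = \<phi> x" "\<And>x. \<bar>\<phi>' x\<bar> \<le> C"
  proof -
    have "continuous_on L \<phi>" using \<phi>(1) L\<Omega> by (rule continuous_on_subset)
    moreover have "closedin (top_of_set UNIV) L" using L by (simp add: compact_imp_closed)
    ultimately obtain g where "continuous_on UNIV g" "\<And>x. x \<in> L \<Longrightarrow> g x = \<phi> x" "\<And>x. x \<in> UNIV \<Longrightarrow> norm (g x) \<le> C"
      using Tietze[of L \<phi> UNIV C] \<phi> L\<Omega> by auto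
    then show ?thesis using that[of g] by auto
  qed
  have m\<phi>': "\<phi>' \<in> borel_measurable borel" using \<phi>'(1) by (rule borel_measurable_continuous_onI)
  obtain \<rho> :: "nat \<Rightarrow> 'a \<Rightarrow> real" and R :: "nat \<Rightarrow> real"
    where \<rho>: "\<And>n k. Ck k (\<rho> n)" "\<And>n h. 0 \<le> \<rho> n h" "\<And>n h. \<rho> n h \<le> R n"
      "\<And>n. integrable lborel (\<rho> n)" "\<And>n. (LINT h|lborel. \<rho> n h) = 1"
      "\<And>n h. \<rho> n h \<noteq> 0 \<Longrightarrow> norm h < r"
      "\<And>d. d > 0 \<Longrightarrow> eventually (\<lambda>n. \<forall>h. \<rho> n h \<noteq> 0 \<longrightarrow> norm h < d) sequentially"
  proof (rule ex_mollifier[where 'a='a, OF r(1)])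
    fix \<rho> :: "nat \<Rightarrow> 'a \<Rightarrow> real" and R :: "nat \<Rightarrow> real"
    assume "\<And>n k. Ck k (\<rho> n)" "\<And>n h. 0 \<le> \<rho> n h" "\<And>n h. \<rho> n h \<le> R n"
      "\<And>n. integrable lborel (\<rho> n)" "\<And>n. (LINT h|lborel. \<rho> n h) = 1"
      "\<And>n h. \<rho> n h \<noteq> 0 \<Longrightarrow> norm h < r"
      "\<And>d. d > 0 \<Longrightarrow> eventually (\<lambda>n. \<forall>h. \<rho> n h \<noteq> 0 \<longrightarrow> norm h < d) sequentially"
    show thesis by (rule that[of \<rho> R]; fact)
  qed
  have c\<rho>: "continuous_on UNIV (\<rho> n)" for n by (rule Ck_imp_continuous_on[OF \<rho>(1)])
  have m\<rho>: "\<rho> n \<in> borel_measurable borel" for n using c\<rho> by (rule borel_measurable_continuous_onI)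

  have locF: "integrable lebesgue (\<lambda>x. indicator K x *\<^sub>R F x)"
    using F K by (simp add: has_divergence_measure_def locally_integrable_def set_integrable_def)
  have GI: "integrable lebesgue (\<lambda>x. indicator L x *\<^sub>R G x)"
    using wG L L\<Omega> by (simp add: has_weak_gradient_def locally_integrable_def set_integrable_def)
  have m\<psi>: "\<psi> \<in> borel_measurable lebesgue"
    using borel_measurable_continuous_onI[OF cont\<psi>] by (auto intro: measurable_completion)
  have HI: "integrable lebesgue (\<lambda>x. \<psi> x *\<^sub>R F x)"
  proof -
    have "integrable lebesgue (\<lambda>x. \<psi> x *\<^sub>R (indicator K x *\<^sub>R F x))"
    proof (rule Bochner_Integration.integrable_bound)
      show "integrable lebesgue (\<lambda>x. C' * norm (indicator K x *\<^sub>R F x))"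
        by (intro integrable_mult_right integrable_norm locF)
      show "(\<lambda>x. \<psi> x *\<^sub>R (indicator K x *\<^sub>R F x)) \<in> borel_measurable lebesgue"
        by (rule borel_measurable_scaleR[OF m\<psi> borel_measurable_integrable[OF locF]])
      show "AE x in lebesgue. norm (\<psi> x *\<^sub>R (indicator K x *\<^sub>R F x)) \<le> norm (C' * norm (indicator K x *\<^sub>R F x))"
        using C' by (intro AE_I2) (simp add: mult_right_mono abs_mult mult.assoc)
    qed
    moreover have "\<psi> x *\<^sub>R (indicator K x *\<^sub>R F x) = \<psi> x *\<^sub>R F x" for x
      using \<psi>K[of x] by (auto simp: indicator_def)
    ultimately show ?thesis by (simp only:)
  qed
  \<comment> \<open>Multiplying F by \<psi> and cutting G off to \<open>L\<close> makes both fields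
    integrable on the whole space. The bound gets the factor \<open>C'\<close> from \<psi>, and the
    left side is 0 unless x lies in \<open>K\<close> and y in \<open>L\<close>.\<close>
  obtain H G' A' B' where pf: "paired_fields H G' A' B'"
    and aeH: "AE x in lborel. \<psi> x *\<^sub>R F x = H x" and aeG: "AE x in lborel. indicator L x *\<^sub>R G x = G' x"
  proof (rule ex_paired_fields)
    show "integrable lebesgue (\<lambda>x. \<psi> x *\<^sub>R F x)" by (rule HI)
    show "integrable lebesgue (\<lambda>x. indicator L x *\<^sub>R G x)" by (rule GI)
    show "integrable lebesgue (\<lambda>x. C' * (indicator \<Omega> x * A x))" "integrable lebesgue (\<lambda>x. C' * (indicator \<Omega> x * B x))"
      using AB(1,2) integral_lebesgue_on_eq(2)[OF \<Omega>m(2)] by auto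
    show "0 \<le> C' * (indicator \<Omega> x * A x)" "0 \<le> C' * (indicator \<Omega> x * B x)" for x
      using AB(3,4) C'(2) by auto
    show "AE x in lborel. P x" using P by (simp add: AE_completion_iff)
    show "norm (\<psi> x *\<^sub>R F x) * norm (indicator L y *\<^sub>R G y) \<le> C' * (indicator \<Omega> x * A x) + C' * (indicator \<Omega> y * B y)"
      if "P x" "P y" for x y
    proof (cases "x \<in> K \<and> y \<in> L")
      case True
      then have xy: "x \<in> \<Omega>" "y \<in> \<Omega>" using K(2) L\<Omega> by auto
      have "norm (\<psi> x *\<^sub>R F x) * norm (indicator L y *\<^sub>R G y) = \<bar>\<psi> x\<bar> * (norm (F x) * norm (G y))"
        using True by simp
      also have "\<dots> \<le> C' * (A x + B y)"
        using C' bound[OF xy that] by (intro mult_mono) auto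
      finally show ?thesis using xy by (simp add: distrib_left)
    next
      case False
      then have "norm (\<psi> x *\<^sub>R F x) * norm (indicator L y *\<^sub>R G y) = 0" using \<psi>K[of x] by auto
      also have "0 \<le> C' * (indicator \<Omega> x * A x) + C' * (indicator \<Omega> y * B y)"
        using AB(3,4) C'(2) by auto
      finally show ?thesis .
    qed
  qed
  interpret paired_fields H G' A' B' by (rule pf)

  define \<Phi> where "\<Phi> n = box_convolution (- b) b (\<rho> n) \<phi>'" for n
  have Ck\<Phi>: "Ck k (\<Phi> n)" for k n unfolding \<Phi>_def by (rule Ck_box_convolution[OF \<phi>'(1) \<rho>(1)])
  have c\<Phi>: "continuous_on UNIV (\<Phi> n)" for n by (rule Ck_imp_continuous_on[OF Ck\<Phi>])
  have cgrad\<Phi>: "continuous_on UNIV (grad (\<Phi> n))" for n by (rule continuous_on_grad[OF Ck\<Phi>])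
  have box_int: "integral (cbox (- b) b) f = (LINT y|lborel. f y)"
    if "continuous_on UNIV f" "\<And>y. y \<notin> L \<Longrightarrow> f y = 0" for f :: "'a \<Rightarrow> real"
  proof -
    have "set_integrable lborel (cbox (- b) b) f"
      unfolding set_integrable_def
      using that(1) by (intro borel_integrable_compact) (auto intro: continuous_on_subset)
    from set_borel_integral_eq_integral(2)[OF this]
    have "integral (cbox (- b) b) f = (LINT y|lborel. indicator (cbox (- b) b) y *\<^sub>R f y)"
      by (simp add: set_lebesgue_integral_def)
    also have "\<dots> = (LINT y|lborel. f y)"
      using that(2) b by (intro Bochner_Integration.integral_cong) (auto simp: indicator_def)
    finally show ?thesis .
  qed
  have suppL: "\<rho> n (x - y) = 0" if "x \<in> K" "y \<notin> L" for x y n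
    using \<rho>(6)[of n "x - y"] LI[of x y] that by force
  \<comment> \<open>The kernel centred at x as a function of y. For x in \<open>K\<close> it is
    supported in \<open>L\<close>, hence admissible in the definition of the weak gradient of
    \<phi>.\<close>
  define \<kappa> where "\<kappa> n x = (\<lambda>y. \<rho> n (x - y))" for n x
  have \<kappa>: "\<kappa> n x \<in> test_functions \<Omega>" "\<And>y. y \<notin> L \<Longrightarrow> grad (\<kappa> n x) y = 0" if "x \<in> K" for n x
  proof -
    have "{y. \<kappa> n x y \<noteq> 0} \<subseteq> L" using suppL[OF that] by (auto simp: \<kappa>_def)
    then have cl: "closure {y. \<kappa> n x y \<noteq> 0} \<subseteq> L" using L by (intro closure_minimal compact_imp_closed)
    moreover have "compact (closure {y. \<kappa> n x y \<noteq> 0})"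
      using cl L by (metis closed_closure compact_Int_closed inf.absorb_iff2)
    moreover have "Ck k (\<kappa> n x)" for k
      using Ck_affine[OF \<rho>(1), of k n x "-1"] by (simp add: \<kappa>_def)
    ultimately show "\<kappa> n x \<in> test_functions \<Omega>" using L\<Omega> by (auto simp: test_functions_def)
    show "grad (\<kappa> n x) y = 0" if "y \<notin> L" for y using that cl by (intro grad_eq_0) auto
  qed

  \<comment> \<open>Away from \<open>K\<close> the box may cut off part of the kernel. This is
    harmless, because each integrand in which \<open>\<Phi> n\<close> occurs also contains \<psi> or
    its gradient.\<close>
  have \<Phi>_eq: "\<Phi> n x = (LINT h|lborel. \<rho> n h * \<phi>' (x - h))" if "x \<in> K" for n x
  proof -
    let ?f = "\<lambda>y. \<phi>' y * \<rho> n (x - y)"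
    have c: "continuous_on UNIV ?f"
      by (intro continuous_on_mult \<phi>'(1) continuous_on_compose2[OF c\<rho>] continuous_intros) auto
    have "\<Phi> n x = (LINT y|lborel. ?f y)"
      unfolding \<Phi>_def box_convolution_def using suppL[OF that] by (intro box_int c) auto
    also have "\<dots> = (LINT h|lborel. ?f (x - h))"
      using integral_lborel_reflect[OF borel_measurable_continuous_onI[OF c], of x] by simp
    finally show ?thesis by (simp add: mult.commute)
  qed
  have int\<rho>\<phi>: "integrable lborel (\<lambda>h. \<rho> n h * \<phi>' (x - h))" for n x
  proof (rule Bochner_Integration.integrable_bound)
    show "integrable lborel (\<lambda>h. \<rho> n h * C)" using \<rho>(4) by simp
    show "(\<lambda>h. \<rho> n h * \<phi>' (x - h)) \<in> borel_measurable lborel" using m\<phi>' m\<rho> by measurable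
    show "AE h in lborel. norm (\<rho> n h * \<phi>' (x - h)) \<le> norm (\<rho> n h * C)"
    proof (rule AE_I2)
      fix h show "norm (\<rho> n h * \<phi>' (x - h)) \<le> norm (\<rho> n h * C)"
        using \<phi>'(3)[of "x - h"] \<phi>(3) \<rho>(2)[of n h] by (simp add: abs_mult mult_left_mono)
    qed
  qed
  have \<Phi>_bound: "\<bar>\<Phi> n x\<bar> \<le> C" if "x \<in> K" for n x
  proof -
    have "norm (LINT h|lborel. \<rho> n h * \<phi>' (x - h)) \<le> (LINT h|lborel. \<rho> n h * C)"
    proof (rule Bochner_Integration.integral_norm_bound_integral[OF int\<rho>\<phi>])
      show "norm (\<rho> n h * \<phi>' (x - h)) \<le> \<rho> n h * C" for h
        using \<phi>'(3)[of "x - h"] \<rho>(2)[of n h] by (simp add: abs_mult mult_left_mono)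
    qed (use \<rho>(4) in auto)
    then show ?thesis using \<Phi>_eq[OF that] \<rho>(5) by simp
  qed
  have \<Phi>_lim: "(\<lambda>n. \<Phi> n x) \<longlonglongrightarrow> \<phi> x" if "x \<in> K" for x
  proof -
    have "isCont (\<lambda>h. x - h) 0" by (intro continuous_intros)
    moreover have "isCont \<phi>' (x - 0)" using \<phi>'(1) by (simp add: continuous_on_eq_continuous_at)
    ultimately have "isCont (\<lambda>h. \<phi>' (x - h)) 0" by (rule isCont_o2)
    from mollifier_tendsto[OF \<rho>(4,2,5,7) int\<rho>\<phi> this]
    have "(\<lambda>n. LINT h|lborel. \<rho> n h * \<phi>' (x - h)) \<longlonglongrightarrow> \<phi>' x" by simp
    then show ?thesis using \<Phi>_eq[OF that] \<phi>'(2)[of x] KL that by auto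
  qed
  \<comment> \<open>The derivative first falls on the kernel and is then moved to G by testing the
    weak gradient with \<open>\<kappa> n x\<close>. The reflection of the kernel and the integration
    by parts contribute one minus sign each, and the two cancel.\<close>
  have gradPhi: "grad (\<Phi> n) x \<bullet> i = (LINT h|lborel. \<rho> n h * (G' (x - h) \<bullet> i))"
    if x: "x \<in> K" and i: "i \<in> Basis" for n x i
  proof -
    note \<kappa>x = \<kappa>(1)[OF x, of n] and \<kappa>0 = \<kappa>(2)[OF x, of _ n]
    have gk: "grad (\<kappa> n x) y = - grad (\<rho> n) (x - y)" for y
      unfolding \<kappa>_def by (rule grad_reflect[OF \<rho>(1)])
    let ?f = "\<lambda>y. \<phi>' y * (grad (\<kappa> n x) y \<bullet> i)"
    have ck: "continuous_on UNIV (grad (\<kappa> n x))"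
      by (rule continuous_on_grad[OF test_functions_Ck[OF \<kappa>x]])
    have cf: "continuous_on UNIV ?f" by (intro continuous_intros \<phi>'(1) ck)
    have mf: "?f \<in> borel_measurable borel" by (rule borel_measurable_continuous_onI[OF cf])
    have "(LINT y|lborel. ?f y) = (LINT y|lebesgue. ?f y)"
      by (rule integral_completion[symmetric]) (use mf in simp)
    also have "\<dots> = (LINT y|lebesgue. indicator \<Omega> y * (\<phi> y * (grad (\<kappa> n x) y \<bullet> i)))"
    proof (rule Bochner_Integration.integral_cong[OF refl])
      fix y show "?f y = indicator \<Omega> y * (\<phi> y * (grad (\<kappa> n x) y \<bullet> i))"
        using \<phi>'(2)[of y] \<kappa>0[of y] L\<Omega> by (cases "y \<in> L") auto
    qed
    also have "\<dots> = (LINT y|lebesgue_on \<Omega>. \<phi> y * (grad (\<kappa> n x) y \<bullet> i))"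
      by (rule integral_lebesgue_on_eq(1)[OF \<Omega>m(2), symmetric])
    also have "\<dots> = - (LINT y|lebesgue_on \<Omega>. (G y \<bullet> i) * \<kappa> n x y)"
      using wG \<kappa>x i by (simp add: has_weak_gradient_def)
    finally have wgrad: "(LINT y|lborel. ?f y) = - (LINT y|lebesgue_on \<Omega>. (G y \<bullet> i) * \<kappa> n x y)" .
    have "grad (\<Phi> n) x \<bullet> i = integral (cbox (- b) b) (\<lambda>y. \<phi>' y * (grad (\<rho> n) (x - y) \<bullet> i))"
      unfolding \<Phi>_def by (rule grad_box_convolution[OF \<rho>(1) \<phi>'(1) i])
    also have "\<dots> = integral (cbox (- b) b) (\<lambda>y. - ?f y)" by (simp add: gk)
    also have "\<dots> = - (LINT y|lborel. ?f y)"
      using box_int[OF cf] \<kappa>0 by simp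
    also have "\<dots> = (LINT y|lebesgue. indicator \<Omega> y * ((G y \<bullet> i) * \<kappa> n x y))"
      unfolding wgrad by (simp add: integral_lebesgue_on_eq(1)[OF \<Omega>m(2)])
    also have "\<dots> = (LINT y|lebesgue. ((indicator L y *\<^sub>R G y) \<bullet> i) * \<kappa> n x y)"
    proof (rule Bochner_Integration.integral_cong[OF refl])
      fix y show "indicator \<Omega> y * ((G y \<bullet> i) * \<kappa> n x y) = ((indicator L y *\<^sub>R G y) \<bullet> i) * \<kappa> n x y"
        using suppL[OF x, of y n] L\<Omega> by (cases "y \<in> L") (auto simp: \<kappa>_def)
    qed
    also have "\<dots> = (LINT y|lborel. (G' y \<bullet> i) * \<kappa> n x y)"
    proof (rule integral_lebesgue_eq_lborel(1))
      have mk: "\<kappa> n x \<in> borel_measurable borel"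
        by (rule borel_measurable_continuous_onI[OF Ck_imp_continuous_on[OF test_functions_Ck[OF \<kappa>x]]])
      then have "\<kappa> n x \<in> borel_measurable lebesgue" by (auto intro: measurable_completion)
      then show "(\<lambda>y. ((indicator L y *\<^sub>R G y) \<bullet> i) * \<kappa> n x y) \<in> borel_measurable lebesgue"
        by (intro borel_measurable_times borel_measurable_inner[OF borel_measurable_integrable[OF GI]]) auto
      show "(\<lambda>y. (G' y \<bullet> i) * \<kappa> n x y) \<in> borel_measurable borel" using mk by measurable
      show "AE y in lborel. ((indicator L y *\<^sub>R G y) \<bullet> i) * \<kappa> n x y = (G' y \<bullet> i) * \<kappa> n x y"
        using aeG by eventually_elim simp
    qed
    also have "\<dots> = (LINT h|lborel. (G' (x - h) \<bullet> i) * \<kappa> n x (x - h))"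
    proof -
      have "(\<lambda>y. (G' y \<bullet> i) * \<kappa> n x y) \<in> borel_measurable borel" using m\<rho> unfolding \<kappa>_def by measurable
      from integral_lborel_reflect[OF this, of x] show ?thesis by simp
    qed
    finally show ?thesis by (simp add: \<kappa>_def mult.commute)
  qed
  \<comment> \<open>The condition holds almost everywhere, by the choice of \<open>H\<close>. Off
    \<open>K\<close> both sides are 0; on \<open>K\<close> the sum over coordinates is interchanged
    with the integral, and the bound \<open>R n\<close> on the kernel gives the integrability this
    takes.\<close>
  have pairing: "(\<psi> x *\<^sub>R F x) \<bullet> grad (\<Phi> n) x = (LINT h|lborel. \<rho> n h * (H x \<bullet> G' (x - h)))"
    if "\<psi> x *\<^sub>R F x = H x" for n x
  proof (cases "x \<in> K")
    case False
    then show ?thesis using \<psi>K[of x] that by simp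
  next
    case True
    have int: "integrable lborel (\<lambda>h. \<rho> n h * (G' (x - h) \<bullet> i))" if "i \<in> Basis" for i
    proof (rule Bochner_Integration.integrable_bound)
      have "integrable lborel (\<lambda>h. norm (G' (x - h)))"
      proof -
        have "integrable (distr lborel borel (\<lambda>h. x - h)) G'"
          using G lborel_affine[of "-1" x] by (simp add: density_1)
        then show ?thesis using integrable_distr[of "\<lambda>h. x - h" lborel borel G'] by simp
      qed
      then show "integrable lborel (\<lambda>h. R n * norm (G' (x - h)))" by simp
      show "(\<lambda>h. \<rho> n h * (G' (x - h) \<bullet> i)) \<in> borel_measurable lborel" using m\<rho> by measurable
      show "AE h in lborel. norm (\<rho> n h * (G' (x - h) \<bullet> i)) \<le> norm (R n * norm (G' (x - h)))"
      proof (rule AE_I2)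
        fix h
        have "\<bar>\<rho> n h\<bar> \<le> \<bar>R n\<bar>" "\<bar>G' (x - h) \<bullet> i\<bar> \<le> norm (G' (x - h))"
          using \<rho>(2,3)[of n h] Basis_le_norm[OF that] by auto
        then show "norm (\<rho> n h * (G' (x - h) \<bullet> i)) \<le> norm (R n * norm (G' (x - h)))"
          by (simp add: abs_mult mult_mono)
      qed
    qed
    have "(\<psi> x *\<^sub>R F x) \<bullet> grad (\<Phi> n) x = (\<Sum>i\<in>Basis. (H x \<bullet> i) * (grad (\<Phi> n) x \<bullet> i))"
      unfolding that by (rule euclidean_inner)
    also have "\<dots> = (\<Sum>i\<in>Basis. LINT h|lborel. (H x \<bullet> i) * (\<rho> n h * (G' (x - h) \<bullet> i)))"
      by (simp add: gradPhi[OF True])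
    also have "\<dots> = (LINT h|lborel. (\<Sum>i\<in>Basis. (H x \<bullet> i) * (\<rho> n h * (G' (x - h) \<bullet> i))))"
      by (intro Bochner_Integration.integral_sum[symmetric] integrable_mult_right int)
    also have "\<dots> = (LINT h|lborel. \<rho> n h * (H x \<bullet> G' (x - h)))"
    proof (rule Bochner_Integration.integral_cong[OF refl])
      fix h
      show "(\<Sum>i\<in>Basis. (H x \<bullet> i) * (\<rho> n h * (G' (x - h) \<bullet> i))) = \<rho> n h * (H x \<bullet> G' (x - h))"
        by (subst euclidean_inner[of "H x" "G' (x - h)"]) (simp add: sum_distrib_left mult_ac)
    qed
    finally show ?thesis .
  qed

  have toL: "integrable (lebesgue_on \<Omega>) f" if "integrable lebesgue f" for f :: "'a \<Rightarrow> real"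
    using that integrable_mult_indicator[OF \<Omega>m(2) that] by (simp add: integral_lebesgue_on_eq(2)[OF \<Omega>m(2)])
  have int1: "integrable (lebesgue_on \<Omega>) (\<lambda>x. \<Phi> n x * (F x \<bullet> grad \<psi> x))" for n
  proof -
    have "integrable lebesgue (\<lambda>x. F x \<bullet> (\<Phi> n x *\<^sub>R grad \<psi> x))"
      by (rule integrable_lebesgue_inner_compact_support[OF locF K(1)])
        (auto intro!: continuous_on_scaleR c\<Phi> contg simp: gK)
    then show ?thesis by (intro toL) simp
  qed
  have int2: "integrable (lebesgue_on \<Omega>) (\<lambda>x. \<psi> x * (F x \<bullet> grad (\<Phi> n) x))" for n
  proof -
    have "integrable lebesgue (\<lambda>x. F x \<bullet> (\<psi> x *\<^sub>R grad (\<Phi> n) x))"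
      by (rule integrable_lebesgue_inner_compact_support[OF locF K(1)])
        (auto intro!: continuous_on_scaleR cgrad\<Phi> cont\<psi> simp: \<psi>K)
    then show ?thesis by (intro toL) simp
  qed
  have int3: "integrable (lebesgue_on \<Omega>) (\<lambda>x. F x \<bullet> grad \<psi> x)"
    by (intro toL integrable_lebesgue_inner_compact_support[OF locF K(1)] contg gK)

  \<comment> \<open>The product of \<psi> with \<open>\<Phi> n\<close> is smooth on the whole space
    and supported in \<open>K\<close>, so it is a legitimate test function for the divergence of
    F.\<close>
  have approx: "(LINT x|lebesgue_on \<Omega>. \<Phi> n x * (F x \<bullet> grad \<psi> x)) +
      (LINT x|lebesgue_on \<Omega>. \<psi> x * (F x \<bullet> grad (\<Phi> n) x)) =
      - real_measure_integral \<Omega> \<nu> (\<lambda>x. \<psi> x * \<Phi> n x)" for n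
  proof -
    have "{x. \<psi> x * \<Phi> n x \<noteq> 0} \<subseteq> {x. \<psi> x \<noteq> 0}" by auto
    then have cl: "closure {x. \<psi> x * \<Phi> n x \<noteq> 0} \<subseteq> K" unfolding K_def by (rule closure_mono)
    moreover have "compact (closure {x. \<psi> x * \<Phi> n x \<noteq> 0})"
      using cl K(1) by (metis closed_closure compact_Int_closed inf.absorb_iff2)
    ultimately have "(\<lambda>x. \<psi> x * \<Phi> n x) \<in> test_functions \<Omega>"
      using K(2) Ck_mult[OF Ck\<psi> Ck\<Phi>, of _ n] by (auto simp: test_functions_def)
    then have "(LINT x|lebesgue_on \<Omega>. F x \<bullet> grad (\<lambda>x. \<psi> x * \<Phi> n x) x) =
        - real_measure_integral \<Omega> \<nu> (\<lambda>x. \<psi> x * \<Phi> n x)"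
      using F by (simp add: has_divergence_measure_def)
    moreover have "grad (\<lambda>x. \<psi> x * \<Phi> n x) x = \<psi> x *\<^sub>R grad (\<Phi> n) x + \<Phi> n x *\<^sub>R grad \<psi> x" for x
      using Ck\<psi>[of "Suc 0"] Ck\<Phi>[of "Suc 0" n] by (intro grad_mult) auto
    ultimately show ?thesis
      using int1[of n] int2[of n] by (simp add: inner_add_right)
  qed

  have lim1: "(\<lambda>n. LINT x|lebesgue_on \<Omega>. \<Phi> n x * (F x \<bullet> grad \<psi> x))
      \<longlonglongrightarrow> (LINT x|lebesgue_on \<Omega>. \<phi> x * (F x \<bullet> grad \<psi> x))"
  proof (rule integral_dominated_convergence)
    show "integrable (lebesgue_on \<Omega>) (\<lambda>x. C * norm (F x \<bullet> grad \<psi> x))" using int3 by simp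
    show "AE x in lebesgue_on \<Omega>. norm (\<Phi> n x * (F x \<bullet> grad \<psi> x)) \<le> C * norm (F x \<bullet> grad \<psi> x)" for n
    proof (rule AE_I2)
      fix x show "norm (\<Phi> n x * (F x \<bullet> grad \<psi> x)) \<le> C * norm (F x \<bullet> grad \<psi> x)"
        using \<Phi>_bound[of x n] gK[of x] by (cases "x \<in> K") (auto simp: abs_mult mult_right_mono)
    qed
    show "AE x in lebesgue_on \<Omega>. (\<lambda>n. \<Phi> n x * (F x \<bullet> grad \<psi> x)) \<longlonglongrightarrow> \<phi> x * (F x \<bullet> grad \<psi> x)"
    proof (rule AE_I2)
      fix x show "(\<lambda>n. \<Phi> n x * (F x \<bullet> grad \<psi> x)) \<longlonglongrightarrow> \<phi> x * (F x \<bullet> grad \<psi> x)"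
        using \<Phi>_lim[of x] gK[of x] by (cases "x \<in> K") (auto intro: tendsto_mult_right)
    qed
    show "(\<lambda>x. \<Phi> n x * (F x \<bullet> grad \<psi> x)) \<in> borel_measurable (lebesgue_on \<Omega>)" for n using int1 by auto
    show "(\<lambda>x. \<phi> x * (F x \<bullet> grad \<psi> x)) \<in> borel_measurable (lebesgue_on \<Omega>)"
      by (rule borel_measurable_times[OF continuous_imp_measurable_on_sets_lebesgue[OF \<phi>(1) \<Omega>m(2)]
            borel_measurable_integrable[OF int3]])
  qed
  have lim2: "(\<lambda>n. LINT x|lebesgue_on \<Omega>. \<psi> x * (F x \<bullet> grad (\<Phi> n) x))
      \<longlonglongrightarrow> (LINT x|lebesgue_on \<Omega>. \<psi> x * (F x \<bullet> G x))"
  proof -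
    have mH: "(\<lambda>x. \<psi> x *\<^sub>R F x) \<in> borel_measurable lebesgue" by (rule borel_measurable_integrable[OF HI])
    have "(LINT x|lebesgue_on \<Omega>. \<psi> x * (F x \<bullet> grad (\<Phi> n) x)) =
        (LINT x|lborel. LINT h|lborel. \<rho> n h * (H x \<bullet> G' (x - h)))" for n
    proof -
      have "indicator \<Omega> x * (\<psi> x * (F x \<bullet> grad (\<Phi> n) x)) = (\<psi> x *\<^sub>R F x) \<bullet> grad (\<Phi> n) x" for x
        using \<psi>K[of x] K(2) by (auto simp: indicator_def)
      then have "(LINT x|lebesgue_on \<Omega>. \<psi> x * (F x \<bullet> grad (\<Phi> n) x)) =
          (LINT x|lebesgue. (\<psi> x *\<^sub>R F x) \<bullet> grad (\<Phi> n) x)"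
        by (simp only: integral_lebesgue_on_eq(1)[OF \<Omega>m(2)])
      also have "\<dots> = (LINT x|lborel. LINT h|lborel. \<rho> n h * (H x \<bullet> G' (x - h)))"
      proof (rule integral_lebesgue_eq_lborel(1))
        show "(\<lambda>x. (\<psi> x *\<^sub>R F x) \<bullet> grad (\<Phi> n) x) \<in> borel_measurable lebesgue"
          using borel_measurable_continuous_onI[OF cgrad\<Phi>, of n]
          by (intro borel_measurable_inner mH) (auto intro: measurable_completion)
        show "(\<lambda>x. LINT h|lborel. \<rho> n h * (H x \<bullet> G' (x - h))) \<in> borel_measurable borel"
          using borel_measurable_integrable[OF integrable_mollified_pairing[OF \<rho>(4,2)]] by simp
        show "AE x in lborel. (\<psi> x *\<^sub>R F x) \<bullet> grad (\<Phi> n) x = (LINT h|lborel. \<rho> n h * (H x \<bullet> G' (x - h)))"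
          using aeH by eventually_elim (rule pairing)
      qed
      finally show ?thesis .
    qed
    moreover have "(LINT x|lebesgue_on \<Omega>. \<psi> x * (F x \<bullet> G x)) = (LINT x|lborel. H x \<bullet> G' x)"
    proof -
      have "indicator \<Omega> x * (\<psi> x * (F x \<bullet> G x)) = (\<psi> x *\<^sub>R F x) \<bullet> (indicator L x *\<^sub>R G x)" for x
        using \<psi>K[of x] KL L\<Omega> by (auto simp: indicator_def)
      then have "(LINT x|lebesgue_on \<Omega>. \<psi> x * (F x \<bullet> G x)) =
          (LINT x|lebesgue. (\<psi> x *\<^sub>R F x) \<bullet> (indicator L x *\<^sub>R G x))"
        by (simp only: integral_lebesgue_on_eq(1)[OF \<Omega>m(2)])
      also have "\<dots> = (LINT x|lborel. H x \<bullet> G' x)"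
      proof (rule integral_lebesgue_eq_lborel(1))
        show "(\<lambda>x. (\<psi> x *\<^sub>R F x) \<bullet> (indicator L x *\<^sub>R G x)) \<in> borel_measurable lebesgue"
          by (rule borel_measurable_inner[OF mH borel_measurable_integrable[OF GI]])
        show "AE x in lborel. (\<psi> x *\<^sub>R F x) \<bullet> (indicator L x *\<^sub>R G x) = H x \<bullet> G' x"
          using aeH aeG by eventually_elim simp
      qed measurable
      finally show ?thesis .
    qed
    ultimately show ?thesis
      using mollified_pairing_tendsto[OF \<rho>(4,2,5,7)] by simp
  qed
  \<comment> \<open>Here convergence is needed at every point of \<open>\<Omega>\<close>, because
    \<nu> may charge Lebesgue null sets; the continuity of \<phi> provides it.\<close>
  have lim3: "(\<lambda>n. real_measure_integral \<Omega> \<nu> (\<lambda>x. \<psi> x * \<Phi> n x)) \<longlonglongrightarrow> real_measure_integral \<Omega> \<nu> (\<lambda>x. \<psi> x * \<phi> x)"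
  proof (rule real_measure_integral_tendsto[OF \<nu> \<Omega>m(1), where C="C' * C"])
    have "\<phi> \<in> borel_measurable (restrict_space borel \<Omega>)"
      using \<phi>(1) by (rule borel_measurable_continuous_on_restrict)
    then show "(\<lambda>x. \<psi> x * \<phi> x) \<in> borel_measurable (restrict_space borel \<Omega>)"
      by (rule borel_measurable_times[OF continuous_on_imp_measurable_restrict[OF cont\<psi>]])
    show "(\<lambda>x. \<psi> x * \<Phi> n x) \<in> borel_measurable (restrict_space borel \<Omega>)" for n
      by (intro borel_measurable_times continuous_on_imp_measurable_restrict cont\<psi> c\<Phi>)
    show "\<bar>\<psi> x * \<Phi> n x\<bar> \<le> C' * C" for n x
    proof (cases "x \<in> K")
      case True
      then show ?thesis using \<Phi>_bound[OF True, of n] C' by (simp add: abs_mult mult_mono)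
    next
      case False
      then show ?thesis using \<psi>K[of x] C'(2) \<phi>(3) by simp
    qed
    show "(\<lambda>n. \<psi> x * \<Phi> n x) \<longlonglongrightarrow> \<psi> x * \<phi> x" for x
      using \<Phi>_lim[of x] \<psi>K[of x] by (cases "x \<in> K") (auto intro: tendsto_mult_left)
  qed
  have "(\<lambda>n. - real_measure_integral \<Omega> \<nu> (\<lambda>x. \<psi> x * \<Phi> n x)) \<longlonglongrightarrow>
      (LINT x|lebesgue_on \<Omega>. \<phi> x * (F x \<bullet> grad \<psi> x)) + (LINT x|lebesgue_on \<Omega>. \<psi> x * (F x \<bullet> G x))"
    using tendsto_add[OF lim1 lim2] by (simp add: approx)
  then show ?thesis using tendsto_minus[OF lim3] LIMSEQ_unique by blast
qed

text \<open>The set where the essential bound fails is open by continuity and negligible, hence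
  empty. An almost-everywhere bound would not control integrals against \<nu>, which need not be
  absolutely continuous.\<close>

lemma Lp_infinity_continuous_bounded:
  fixes \<phi> :: "'a::euclidean_space \<Rightarrow> real"
  assumes "open \<Omega>" "continuous_on \<Omega> \<phi>" "\<phi> \<in> Lp \<infinity> \<Omega>"
  obtains C where "C \<ge> 0" "\<And>x. x \<in> \<Omega> \<Longrightarrow> \<bar>\<phi> x\<bar> \<le> C"
proof -
  have \<Omega>: "\<Omega> \<in> sets lebesgue" using assms(1) by auto
  have "\<exists>C. AE x in lebesgue_on \<Omega>. \<bar>\<phi> x\<bar> \<le> C" using assms(3) by (simp add: Lp_def)
  then obtain C where "AE x in lebesgue_on \<Omega>. \<bar>\<phi> x\<bar> \<le> C" by blast
  then have ae: "AE x in lebesgue. x \<in> \<Omega> \<longrightarrow> \<bar>\<phi> x\<bar> \<le> C"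
    using \<Omega> by (simp add: AE_restrict_space_iff)
  define U where "U = {x \<in> \<Omega>. C < \<bar>\<phi> x\<bar>}"
  have "open U"
    unfolding U_def
    using continuous_open_preimage[OF continuous_on_rabs[OF assms(2)] assms(1), of "{C<..}"]
    by (simp add: vimage_def Int_def)
  moreover have "negligible U"
  proof -
    have "AE x in lebesgue. x \<notin> U" using ae by eventually_elim (auto simp: U_def)
    moreover have "U \<in> sets lebesgue" using \<open>open U\<close> by auto
    ultimately have "U \<in> null_sets lebesgue" by (simp add: AE_iff_null_sets)
    then show ?thesis by (simp add: negligible_iff_null_sets)
  qed
  ultimately have "U = {}" using open_not_negligible by blast
  then have "\<bar>\<phi> x\<bar> \<le> max C 0" if "x \<in> \<Omega>" for x using that by (force simp: U_def)
  then show ?thesis by (intro that[of "max C 0"]) auto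
qed

lemma Lp_mult_bounded:
  fixes F :: "'a::euclidean_space \<Rightarrow> 'a"
  assumes F: "F \<in> Lp p \<Omega>" and m: "\<phi> \<in> borel_measurable (lebesgue_on \<Omega>)"
    and bd: "\<And>x. x \<in> \<Omega> \<Longrightarrow> \<bar>\<phi> x\<bar> \<le> C" and "C \<ge> 0"
  shows "(\<lambda>x. \<phi> x *\<^sub>R F x) \<in> Lp p \<Omega>"
proof (cases "p = \<infinity>")
  case True
  have mF: "F \<in> borel_measurable (lebesgue_on \<Omega>)" using F by (simp add: Lp_def)
  have "\<exists>D. AE x in lebesgue_on \<Omega>. norm (F x) \<le> D" using F True by (simp add: Lp_def)
  then obtain D where D: "AE x in lebesgue_on \<Omega>. norm (F x) \<le> D" by blast
  have "AE x in lebesgue_on \<Omega>. norm (\<phi> x *\<^sub>R F x) \<le> C * D"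
    using D AE_space
  proof eventually_elim
    case (elim x)
    then show ?case using bd[of x] assms(4) by (auto simp: space_restrict_space intro!: mult_mono)
  qed
  then show ?thesis using True borel_measurable_scaleR[OF m mF] by (auto simp: Lp_def)
next
  case False
  let ?r = "enn2real p"
  have mF: "F \<in> borel_measurable (lebesgue_on \<Omega>)" using F by (simp add: Lp_def)
  have intF: "integrable (lebesgue_on \<Omega>) (\<lambda>x. norm (F x) powr ?r)" using F False by (simp add: Lp_def)
  note mp = borel_measurable_scaleR[OF m mF]
  have "integrable (lebesgue_on \<Omega>) (\<lambda>x. norm (\<phi> x *\<^sub>R F x) powr ?r)"
  proof (rule Bochner_Integration.integrable_bound)
    show "integrable (lebesgue_on \<Omega>) (\<lambda>x. C powr ?r * norm (F x) powr ?r)" using intF by simp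
    show "(\<lambda>x. norm (\<phi> x *\<^sub>R F x) powr ?r) \<in> borel_measurable (lebesgue_on \<Omega>)"
      by (rule powr_real_measurable[OF measurable_compose[OF mp borel_measurable_norm] borel_measurable_const])
    show "AE x in lebesgue_on \<Omega>. norm (norm (\<phi> x *\<^sub>R F x) powr ?r) \<le> norm (C powr ?r * norm (F x) powr ?r)"
    proof (rule AE_I2)
      fix x assume "x \<in> space (lebesgue_on \<Omega>)"
      then have "\<bar>\<phi> x\<bar> powr ?r \<le> C powr ?r"
        using bd[of x] by (intro powr_mono2) (auto simp: space_restrict_space)
      then show "norm (norm (\<phi> x *\<^sub>R F x) powr ?r) \<le> norm (C powr ?r * norm (F x) powr ?r)"
        by (simp add: powr_mult mult_right_mono)
    qed
  qed
  then show ?thesis using False mp by (simp add: Lp_def)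
qed

lemma locally_integrable_mult_continuous:
  fixes F :: "'a::euclidean_space \<Rightarrow> 'a" and \<phi> :: "'a \<Rightarrow> real"
  assumes F: "locally_integrable \<Omega> F" and c: "continuous_on \<Omega> \<phi>"
  shows "locally_integrable \<Omega> (\<lambda>x. \<phi> x *\<^sub>R F x)"
  unfolding locally_integrable_def
proof (intro allI impI)
  fix K assume K: "compact K \<and> K \<subseteq> \<Omega>"
  then have cK: "continuous_on K \<phi>" using c continuous_on_subset by blast
  have Km: "K \<in> sets lebesgue" using K by (auto simp: compact_imp_closed)
  have FK: "integrable lebesgue (\<lambda>x. indicator K x *\<^sub>R F x)"
    using F K by (simp add: locally_integrable_def set_integrable_def)
  have "bounded (\<phi> ` K)" using K cK by (intro compact_imp_bounded compact_continuous_image) auto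
  then obtain D where D: "\<And>x. x \<in> K \<Longrightarrow> \<bar>\<phi> x\<bar> \<le> D" by (auto simp: bounded_iff)
  have "\<phi> \<in> borel_measurable (lebesgue_on K)"
    using cK Km by (rule continuous_imp_measurable_on_sets_lebesgue)
  then have mK: "(\<lambda>x. indicator K x *\<^sub>R \<phi> x) \<in> borel_measurable lebesgue"
    using Km by (subst (asm) borel_measurable_restrict_space_iff) (auto simp: mult.commute)
  have "integrable lebesgue (\<lambda>x. (indicator K x *\<^sub>R \<phi> x) *\<^sub>R (indicator K x *\<^sub>R F x))"
  proof (rule Bochner_Integration.integrable_bound)
    show "integrable lebesgue (\<lambda>x. D * norm (indicator K x *\<^sub>R F x))"
      by (intro integrable_mult_right integrable_norm FK)
    show "(\<lambda>x. (indicator K x *\<^sub>R \<phi> x) *\<^sub>R (indicator K x *\<^sub>R F x)) \<in> borel_measurable lebesgue"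
      by (rule borel_measurable_scaleR[OF mK borel_measurable_integrable[OF FK]])
    show "AE x in lebesgue. norm ((indicator K x *\<^sub>R \<phi> x) *\<^sub>R (indicator K x *\<^sub>R F x)) \<le> norm (D * norm (indicator K x *\<^sub>R F x))"
    proof (rule AE_I2)
      fix x show "norm ((indicator K x *\<^sub>R \<phi> x) *\<^sub>R (indicator K x *\<^sub>R F x)) \<le> norm (D * norm (indicator K x *\<^sub>R F x))"
        using D[of x] by (cases "x \<in> K") (auto simp: abs_mult intro!: mult_right_mono)
    qed
  qed
  moreover have "(indicator K x *\<^sub>R \<phi> x) *\<^sub>R (indicator K x *\<^sub>R F x) = indicator K x *\<^sub>R \<phi> x *\<^sub>R F x" for x
    by (auto simp: indicator_def)
  ultimately show "set_integrable lebesgue K (\<lambda>x. \<phi> x *\<^sub>R F x)"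
    by (simp only: set_integrable_def)
qed

theorem proposition3p1:
  fixes \<Omega> :: "'a::euclidean_space set"
    and p :: ennreal
    and F :: "'a \<Rightarrow> 'a"
    and \<phi> :: "'a \<Rightarrow> real"
    and G :: "'a \<Rightarrow> 'a"
  assumes "open \<Omega>"
    and "1 \<le> p"
    and "F \<in> DM p \<Omega>"
    and "continuous_on \<Omega> \<phi>"
    and "\<phi> \<in> Lp \<infinity> \<Omega>"
    and "has_weak_gradient \<Omega> \<phi> G"
    and "G \<in> Lp (conj_exponent p) \<Omega>"
  shows "(\<lambda>x. \<phi> x *\<^sub>R F x) \<in> DM p \<Omega> \<and>
    (\<forall>B \<in> borel_subsets \<Omega>.
       divergence \<Omega> (\<lambda>x. \<phi> x *\<^sub>R F x) B =
         real_measure_integral \<Omega> (divergence \<Omega> F) (\<lambda>x. indicator B x * \<phi> x)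
         + (LINT x:B|lebesgue. F x \<bullet> G x))"
proof -
  have \<Omega>: "\<Omega> \<in> sets borel" "\<Omega> \<in> sets lebesgue" using assms(1) by auto
  obtain \<nu> where F: "F \<in> Lp p \<Omega>" and div: "has_divergence_measure \<Omega> F \<nu>"
    using assms(3) by (auto simp: DM_def)
  have \<nu>: "real_radon_measure \<Omega> \<nu>" using div by (simp add: has_divergence_measure_def)
  obtain C where C: "C \<ge> 0" "\<And>x. x \<in> \<Omega> \<Longrightarrow> \<bar>\<phi> x\<bar> \<le> C"
    using Lp_infinity_continuous_bounded[OF assms(1,4,5)] by blast
  obtain A B P where AB: "integrable (lebesgue_on \<Omega>) A" "integrable (lebesgue_on \<Omega>) B"
    "\<And>x. 0 \<le> A x" "\<And>x. 0 \<le> (B x :: real)" "AE x in lebesgue. P x"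
    and bound: "\<And>x y. x \<in> \<Omega> \<Longrightarrow> y \<in> \<Omega> \<Longrightarrow> P x \<Longrightarrow> P y \<Longrightarrow> norm (F x) * norm (G y) \<le> A x + B y"
    using Lp_Young_bound[OF assms(2) F assms(7) \<Omega>(2)] by metis
  have tested: "(LINT x|lebesgue_on \<Omega>. \<phi> x * (F x \<bullet> grad \<psi> x)) + (LINT x|lebesgue_on \<Omega>. \<psi> x * (F x \<bullet> G x)) =
      - real_measure_integral \<Omega> \<nu> (\<lambda>x. \<psi> x * \<phi> x)" if "\<psi> \<in> test_functions \<Omega>" for \<psi>
    by (rule product_rule_test_function[OF assms(1) div assms(4) C(2,1) assms(6) AB bound that])
  have mF: "F \<in> borel_measurable (lebesgue_on \<Omega>)" and mG: "G \<in> borel_measurable (lebesgue_on \<Omega>)"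
    using F assms(7) by (auto simp: Lp_def)
  have m\<phi>: "\<phi> \<in> borel_measurable (lebesgue_on \<Omega>)" using assms(5) by (simp add: Lp_def)
  have m\<phi>': "\<phi> \<in> borel_measurable (restrict_space borel \<Omega>)"
    using assms(4) by (rule borel_measurable_continuous_on_restrict)
  \<comment> \<open>This is the separated bound on the diagonal y = x.\<close>
  have FG: "integrable (lebesgue_on \<Omega>) (\<lambda>x. F x \<bullet> G x)"
  proof (rule Bochner_Integration.integrable_bound)
    show "integrable (lebesgue_on \<Omega>) (\<lambda>x. A x + B x)" using AB(1,2) by simp
    show "(\<lambda>x. F x \<bullet> G x) \<in> borel_measurable (lebesgue_on \<Omega>)" by (rule borel_measurable_inner[OF mF mG])
    have "AE x in lebesgue_on \<Omega>. P x" using AB(5) \<Omega>(2) by (auto simp: AE_restrict_space_iff)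
    then show "AE x in lebesgue_on \<Omega>. norm (F x \<bullet> G x) \<le> norm (A x + B x)"
      using AE_space
    proof eventually_elim
      case (elim x)
      then have "x \<in> \<Omega>" by (simp add: space_restrict_space)
      then show ?case
        using bound[of x x] elim(1) Cauchy_Schwarz_ineq2[of "F x" "G x"] by simp
    qed
  qed
  \<comment> \<open>The variation measures live on the Borel sigma-algebra, so the density is
    replaced by a Borel version, extended by 0 outside \<open>\<Omega>\<close>.\<close>
  then have "integrable lebesgue (\<lambda>x. indicator \<Omega> x * (F x \<bullet> G x))"
    by (simp add: integral_lebesgue_on_eq(2)[OF \<Omega>(2)])
  then obtain g where g: "integrable lborel g" "AE x in lborel. indicator \<Omega> x * (F x \<bullet> G x) = g x"
    by (rule integrable_ex_borel_version)
  have mFG: "(\<lambda>x. indicator \<Omega> x * (F x \<bullet> G x)) \<in> borel_measurable lebesgue"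
    using FG by (auto simp: integral_lebesgue_on_eq(2)[OF \<Omega>(2)])
  \<comment> \<open>Used with \<open>u\<close> the indicator of \<open>\<Omega>\<close> times \<psi>
    for the tested identity, and with \<open>u\<close> the indicator of \<open>B\<close> for the
    final formula.\<close>
  have weighted: "(LINT x|lborel. u x * g x) = (LINT x|lebesgue. u x * (indicator \<Omega> x * (F x \<bullet> G x)))"
    if u: "u \<in> borel_measurable borel" for u :: "'a \<Rightarrow> real"
  proof (rule integral_lebesgue_eq_lborel(1)[symmetric])
    have "u \<in> borel_measurable lebesgue" using u by (auto intro: measurable_completion)
    then show "(\<lambda>x. u x * (indicator \<Omega> x * (F x \<bullet> G x))) \<in> borel_measurable lebesgue"
      by (rule borel_measurable_times[OF _ mFG])
    show "(\<lambda>x. u x * g x) \<in> borel_measurable borel" using u g(1) by auto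
    show "AE x in lborel. u x * (indicator \<Omega> x * (F x \<bullet> G x)) = u x * g x"
      using g(2) by eventually_elim simp
  qed
  define \<mu> where "\<mu> = weighted_sum_measure \<Omega> \<nu> \<phi> g"
  have \<mu>: "real_radon_measure \<Omega> \<mu>"
    unfolding \<mu>_def by (rule real_radon_measure_weighted_sum[OF \<nu> \<Omega>(1) m\<phi>' C(2) g(1)])
  have div': "has_divergence_measure \<Omega> (\<lambda>x. \<phi> x *\<^sub>R F x) \<mu>"
    unfolding has_divergence_measure_def
  proof (intro conjI ballI \<mu>)
    show "locally_integrable \<Omega> (\<lambda>x. \<phi> x *\<^sub>R F x)"
      using div assms(4) by (intro locally_integrable_mult_continuous) (auto simp: has_divergence_measure_def)
    fix \<psi> :: "'a \<Rightarrow> real" assume \<psi>: "\<psi> \<in> test_functions \<Omega>"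
    have c\<psi>: "continuous_on UNIV \<psi>" by (rule Ck_imp_continuous_on[OF test_functions_Ck[OF \<psi>]])
    have m\<psi>: "\<psi> \<in> borel_measurable borel" by (rule borel_measurable_continuous_onI[OF c\<psi>])
    have K: "compact (closure {x. \<psi> x \<noteq> 0})" using \<psi> by (simp add: test_functions_def)
    have "bounded (\<psi> ` closure {x. \<psi> x \<noteq> 0})"
      using K c\<psi> by (intro compact_imp_bounded compact_continuous_image) (auto intro: continuous_on_subset)
    then obtain D where D: "\<And>x. x \<in> closure {x. \<psi> x \<noteq> 0} \<Longrightarrow> \<bar>\<psi> x\<bar> \<le> D" by (auto simp: bounded_iff)
    have D': "\<bar>\<psi> x\<bar> \<le> max D 0" for x
      using D[of x] closure_subset[of "{x. \<psi> x \<noteq> 0}"] by (cases "\<psi> x = 0") auto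
    have "real_measure_integral \<Omega> \<mu> \<psi> =
        real_measure_integral \<Omega> \<nu> (\<lambda>x. \<psi> x * \<phi> x) + (LINT x|lborel. indicator \<Omega> x * (\<psi> x * g x))"
      unfolding \<mu>_def
      by (rule real_measure_integral_weighted_sum[OF \<nu> \<Omega>(1) m\<phi>' C(2) g(1) test_functions_measurable[OF \<psi>] D'])
    also have "(LINT x|lborel. indicator \<Omega> x * (\<psi> x * g x)) = (LINT x|lebesgue_on \<Omega>. \<psi> x * (F x \<bullet> G x))"
    proof -
      have "(\<lambda>x. indicator \<Omega> x * \<psi> x) \<in> borel_measurable borel" using m\<psi> \<Omega>(1) by auto
      from weighted[OF this]
      have "(LINT x|lborel. indicator \<Omega> x * (\<psi> x * g x)) =
          (LINT x|lebesgue. indicator \<Omega> x * \<psi> x * (indicator \<Omega> x * (F x \<bullet> G x)))"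
        by (simp only: mult.assoc)
      also have "\<dots> = (LINT x|lebesgue. indicator \<Omega> x * (\<psi> x * (F x \<bullet> G x)))"
        by (rule Bochner_Integration.integral_cong) (auto simp: indicator_def)
      finally show ?thesis by (simp only: integral_lebesgue_on_eq(1)[OF \<Omega>(2)])
    qed
    finally show "(LINT x|lebesgue_on \<Omega>. (\<phi> x *\<^sub>R F x) \<bullet> grad \<psi> x) = - real_measure_integral \<Omega> \<mu> \<psi>"
      using tested[OF \<psi>] by simp
  qed
  have "(\<lambda>x. \<phi> x *\<^sub>R F x) \<in> DM p \<Omega>"
    using Lp_mult_bounded[OF F m\<phi> C(2,1)] div' by (auto simp: DM_def)
  \<comment> \<open>Uniqueness identifies \<open>divergence\<close> with \<nu> for F and with \<mu>
    for \<phi> F, so the formula unfolds from the definition of \<open>weighted_sum_measure\<close>,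
    up to returning from \<open>g\<close> to F \<bullet> G.\<close>
  moreover have "divergence \<Omega> (\<lambda>x. \<phi> x *\<^sub>R F x) B =
      real_measure_integral \<Omega> (divergence \<Omega> F) (\<lambda>x. indicator B x * \<phi> x) + (LINT x:B|lebesgue. F x \<bullet> G x)"
    if B: "B \<in> borel_subsets \<Omega>" for B
  proof -
    have "(indicator B :: 'a \<Rightarrow> real) \<in> borel_measurable borel" using B by (auto simp: borel_subsets_def)
    from weighted[OF this] have "(LINT x|lborel. indicator B x * g x) =
        (LINT x|lebesgue. indicator B x * (indicator \<Omega> x * (F x \<bullet> G x)))" .
    also have "\<dots> = (LINT x:B|lebesgue. F x \<bullet> G x)"
      unfolding set_lebesgue_integral_def
      by (rule Bochner_Integration.integral_cong) (use B in \<open>auto simp: indicator_def borel_subsets_def\<close>)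
    finally show ?thesis
      using B by (simp add: divergence_eqI[OF assms(1) div] divergence_eqI[OF assms(1) div'] \<mu>_def weighted_sum_measure_def)
  qed
  ultimately show ?thesis by blast
qed

end
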